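(* $1$-${\mathrm{LK}}$ polynomially simulates ${\mathrm{LDT}}$, and tree-like $1$-${\mathrm{LK}}$ quasipolynomially simulates tree-like ${\mathrm{LDT}}$. Explicitly: there is a polynomial-time procedure which, given an ${\mathrm{LDT}}$ proof of a sequent $A_0,\dots,A_{m-1}\to B_0,\dots,B_{n-1}$ of DT formulas, outputs a $1$-${\mathrm{LK}}$ proof of ${\mathrm{Cls}}(A_0),\dots,{\mathrm{Cls}}(A_{m-1})\to {\mathrm{Tms}}(B_0),\dots,{\mathrm{Tms}}(B_{n-1})$; and there is a procedure running in time $2^{(\log n)^{O(1)}}$ (with $n$ the input size) which, given a tree-like ${\mathrm{LDT}}$ proof of such a sequent, outputs a tree-like $1$-${\mathrm{LK}}$ proof of the same translated sequent.
   Context: A literal is a propositional variable $x$ or its negation $\overline x$. Decision tree (DT) formulas: every literal is a DT formula, and if $A,B$ are DT formulas and $p$ a literal then $(ApB)$ is a DT formula ("if $p$ is false then $A$, else $B$"). Formula size = number of occurrences of atomic formulas; proof size = sum of sizes of its formulas. Sequents are $\Gamma\to\Delta$ with $\Gamma,\Delta$ finite multisets of formulas. ${\mathrm{LDT}}$ has lines that are sequents of DT formulas, initial sequents $p\to p$, $p,\overline p\to$, $\to p,\overline p$, and rules: contraction, weakening (left and right), cut (from $\Gamma\to\Delta,A$ and $A,\Gamma\to\Delta$ infer $\Gamma\to\Delta$), dec-l (from $A,\Gamma\to\Delta,p$ and $p,B,\Gamma\to\Delta$ infer $ApB,\Gamma\to\Delta$), dec-r (from $\Gamma\to\Delta,A,p$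 and $p,\Gamma\to\Delta,B$ infer $\Gamma\to\Delta,ApB$). Proofs are dag-like unless specified tree-like. ${\mathrm{LK}}$ is the usual sequent calculus for Boolean formulas built from literals by binary $\land,\lor$, with the same initial sequents, contraction, weakening, cut, and the standard left/right rules for $\land$ and $\lor$ (from $A,B,\Gamma\to\Delta$ infer $A\land B,\Gamma\to\Delta$; from $\Gamma\to\Delta,A$ and $\Gamma\to\Delta,B$ infer $\Gamma\to\Delta,A\land B$; from $A,\Gamma\to\Delta$ and $B,\Gamma\to\Delta$ infer $A\lor B,\Gamma\to\Delta$; from $\Gamma\to\Delta,A,B$ infer $\Gamma\to\Delta,A\lor B$). A depth one formula is a clause (disjunction of literals) or a term (conjunction of literals); $1$-${\mathrm{LK}}$ is ${\mathrm{LK}}$ with all formulas in proofs depth one. For a DT formula $A$, the multisets of terms ${\mathrm{Tms}}(A)$ and clauses ${\mathrm{Cls}}(A)$ are defined by ${\mathrm{Tms}}(p)={\mathrm{Cls}}(p)=\{p\}$ and ${\mathrm{Tms}}(BpC)=\{\overline p\land D: D\in{\mathrm{Tms}}(B)\}\cup\{p\land D: D\in{\mathrm{Tms}}(C)\}$, ${\mathrm{Cls}}(BpC)=\{p\lor D: D\in{\mathrm{Cls}}(B)\}\cup\{\overline p\lor D: D\in{\mathrm{Cls}}(C)\}$, conjunctions and disjunctions associated from right to left. In a sequent, ${\mathrm{Cls}}(A)$ and ${\mathrm{Tms}}(B)$ stand for the cedents consisting of these multisets. *)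

theory Defs
  imports "HOL-Library.Multiset" "HOL-Library.Landau_Symbols"
begin

section \<open>Formulas and sequents\<close>

datatype lit = Pos nat | Neg nat

fun bar :: "lit \<Rightarrow> lit" where
  "bar (Pos x) = Neg x"
| "bar (Neg x) = Pos x"

text \<open>\<open>Dec A p B\<close> is the formula \<open>(ApB)\<close>: if \<open>p\<close> is false then \<open>A\<close>, else \<open>B\<close>.\<close>

datatype dt = DLit lit | Dec dt lit dt

datatype fm = FLit lit | And fm fm | Or fm fm

primrec is_clause :: "fm \<Rightarrow> bool" where
  "is_clause (FLit p) = True"
| "is_clause (And A B) = False"
| "is_clause (Or A B) = (is_clause A \<and> is_clause B)"

primrec is_term :: "fm \<Rightarrow> bool" where
  "is_term (FLit p) = True"
| "is_term (And A B) = (is_term A \<and> is_term B)"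
| "is_term (Or A B) = False"

definition depth_one :: "fm \<Rightarrow> bool" where
  "depth_one A \<longleftrightarrow> is_clause A \<or> is_term A"

type_synonym 'f sequent = "'f multiset \<times> 'f multiset"

text \<open>Cedents are multisets. Written proofs list the members of a cedent in some order;
  \<open>\<Gamma> \<turnstile> \<Delta>\<close> is the sequent denoted by two such lists.\<close>

definition sequent_of :: "'f list \<Rightarrow> 'f list \<Rightarrow> 'f sequent"  (infix "\<turnstile>" 50) where
  "\<Gamma> \<turnstile> \<Delta> = (mset \<Gamma>, mset \<Delta>)"

definition depth_one_sequent :: "fm sequent \<Rightarrow> bool" where
  "depth_one_sequent S \<longleftrightarrow> (\<forall>A \<in># fst S + snd S. depth_one A)"


section \<open>Rules of inference\<close>

text \<open>An element of a rule type is an instance of a rule with all its parameters, the side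
  cedents included, so that it determines its premises and its conclusion.\<close>

datatype 'f common_rule =
    Init lit
  | InitL lit
  | InitR lit
  | ContrL 'f "'f list" "'f list"
  | ContrR 'f "'f list" "'f list"
  | WeakL 'f "'f list" "'f list"
  | WeakR 'f "'f list" "'f list"
  | Cut 'f "'f list" "'f list"

fun common_prems :: "'f common_rule \<Rightarrow> 'f sequent list" where
  "common_prems (Init p) = []"
| "common_prems (InitL p) = []"
| "common_prems (InitR p) = []"
| "common_prems (ContrL A \<Gamma> \<Delta>) = [A # A # \<Gamma> \<turnstile> \<Delta>]"
| "common_prems (ContrR A \<Gamma> \<Delta>) = [\<Gamma> \<turnstile> \<Delta> @ [A, A]]"
| "common_prems (WeakL A \<Gamma> \<Delta>) = [\<Gamma> \<turnstile> \<Delta>]"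
| "common_prems (WeakR A \<Gamma> \<Delta>) = [\<Gamma> \<turnstile> \<Delta>]"
| "common_prems (Cut A \<Gamma> \<Delta>) = [\<Gamma> \<turnstile> \<Delta> @ [A], A # \<Gamma> \<turnstile> \<Delta>]"

text \<open>The first argument embeds literals as formulas.\<close>

fun common_concl :: "(lit \<Rightarrow> 'f) \<Rightarrow> 'f common_rule \<Rightarrow> 'f sequent" where
  "common_concl a (Init p) = ([a p] \<turnstile> [a p])"
| "common_concl a (InitL p) = ([a p, a (bar p)] \<turnstile> [])"
| "common_concl a (InitR p) = ([] \<turnstile> [a p, a (bar p)])"
| "common_concl a (ContrL A \<Gamma> \<Delta>) = (A # \<Gamma> \<turnstile> \<Delta>)"
| "common_concl a (ContrR A \<Gamma> \<Delta>) = (\<Gamma> \<turnstile> \<Delta> @ [A])"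
| "common_concl a (WeakL A \<Gamma> \<Delta>) = (A # \<Gamma> \<turnstile> \<Delta>)"
| "common_concl a (WeakR A \<Gamma> \<Delta>) = (\<Gamma> \<turnstile> \<Delta> @ [A])"
| "common_concl a (Cut A \<Gamma> \<Delta>) = (\<Gamma> \<turnstile> \<Delta>)"

datatype ldt_rule =
    LDTCommon "dt common_rule"
  | DecL dt lit dt "dt list" "dt list"
  | DecR dt lit dt "dt list" "dt list"

fun ldt_prems :: "ldt_rule \<Rightarrow> dt sequent list" where
  "ldt_prems (LDTCommon r) = common_prems r"
| "ldt_prems (DecL A p B \<Gamma> \<Delta>) =
     [A # \<Gamma> \<turnstile> \<Delta> @ [DLit p], DLit p # B # \<Gamma> \<turnstile> \<Delta>]"
| "ldt_prems (DecR A p B \<Gamma> \<Delta>) =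
     [\<Gamma> \<turnstile> \<Delta> @ [A, DLit p], DLit p # \<Gamma> \<turnstile> \<Delta> @ [B]]"

fun ldt_concl :: "ldt_rule \<Rightarrow> dt sequent" where
  "ldt_concl (LDTCommon r) = common_concl DLit r"
| "ldt_concl (DecL A p B \<Gamma> \<Delta>) = (Dec A p B # \<Gamma> \<turnstile> \<Delta>)"
| "ldt_concl (DecR A p B \<Gamma> \<Delta>) = (\<Gamma> \<turnstile> \<Delta> @ [Dec A p B])"

datatype lk_rule =
    LKCommon "fm common_rule"
  | AndL fm fm "fm list" "fm list"
  | AndR fm fm "fm list" "fm list"
  | OrL fm fm "fm list" "fm list"
  | OrR fm fm "fm list" "fm list"

fun lk_prems :: "lk_rule \<Rightarrow> fm sequent list" where
  "lk_prems (LKCommon r) = common_prems r"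
| "lk_prems (AndL A B \<Gamma> \<Delta>) = [A # B # \<Gamma> \<turnstile> \<Delta>]"
| "lk_prems (AndR A B \<Gamma> \<Delta>) = [\<Gamma> \<turnstile> \<Delta> @ [A], \<Gamma> \<turnstile> \<Delta> @ [B]]"
| "lk_prems (OrL A B \<Gamma> \<Delta>) = [A # \<Gamma> \<turnstile> \<Delta>, B # \<Gamma> \<turnstile> \<Delta>]"
| "lk_prems (OrR A B \<Gamma> \<Delta>) = [\<Gamma> \<turnstile> \<Delta> @ [A, B]]"

fun lk_concl :: "lk_rule \<Rightarrow> fm sequent" where
  "lk_concl (LKCommon r) = common_concl FLit r"
| "lk_concl (AndL A B \<Gamma> \<Delta>) = (And A B # \<Gamma> \<turnstile> \<Delta>)"
| "lk_concl (AndR A B \<Gamma> \<Delta>) = (\<Gamma> \<turnstile> \<Delta> @ [And A B])"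
| "lk_concl (OrL A B \<Gamma> \<Delta>) = (Or A B # \<Gamma> \<turnstile> \<Delta>)"
| "lk_concl (OrR A B \<Gamma> \<Delta>) = (\<Gamma> \<turnstile> \<Delta> @ [Or A B])"


section \<open>Dag-like and tree-like proofs\<close>

text \<open>A dag-like proof is a sequence of lines. A line consists of a rule instance, whose
  conclusion is the sequent on that line, and of the positions (from 0) of the earlier lines
  that serve as its premises. The last line is the conclusion of the proof.\<close>

type_synonym 'r dag = "('r \<times> nat list) list"

definition dag_proof :: "('r \<Rightarrow> 'f sequent list) \<Rightarrow> ('r \<Rightarrow> 'f sequent) \<Rightarrow> 'r dag \<Rightarrow> bool" where
  "dag_proof prems concl \<pi> \<longleftrightarrow> \<pi> \<noteq> [] \<and>
     (\<forall>k < length \<pi>. (\<forall>i \<in> set (snd (\<pi> ! k)). i < k) \<and>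
        map (\<lambda>i. concl (fst (\<pi> ! i))) (snd (\<pi> ! k)) = prems (fst (\<pi> ! k)))"

definition dag_concl :: "('r \<Rightarrow> 'f sequent) \<Rightarrow> 'r dag \<Rightarrow> 'f sequent" where
  "dag_concl concl \<pi> = concl (fst (last \<pi>))"

datatype 'r ptree = Infer (last_rule: 'r) (subproofs: "'r ptree list")

fun tree_proof :: "('r \<Rightarrow> 'f sequent list) \<Rightarrow> ('r \<Rightarrow> 'f sequent) \<Rightarrow> 'r ptree \<Rightarrow> bool" where
  "tree_proof prems concl (Infer r \<tau>s) \<longleftrightarrow>
     map (\<lambda>\<tau>. concl (last_rule \<tau>)) \<tau>s = prems r \<and> (\<forall>\<tau> \<in> set \<tau>s. tree_proof prems concl \<tau>)"

definition tree_concl :: "('r \<Rightarrow> 'f sequent) \<Rightarrow> 'r ptree \<Rightarrow> 'f sequent" where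
  "tree_concl concl \<tau> = concl (last_rule \<tau>)"

definition LDT_proof :: "ldt_rule dag \<Rightarrow> dt sequent \<Rightarrow> bool" where
  "LDT_proof \<pi> S \<longleftrightarrow> dag_proof ldt_prems ldt_concl \<pi> \<and> dag_concl ldt_concl \<pi> = S"

definition LDT_tree_proof :: "ldt_rule ptree \<Rightarrow> dt sequent \<Rightarrow> bool" where
  "LDT_tree_proof \<tau> S \<longleftrightarrow> tree_proof ldt_prems ldt_concl \<tau> \<and> tree_concl ldt_concl \<tau> = S"

definition LK_proof :: "lk_rule dag \<Rightarrow> fm sequent \<Rightarrow> bool" where
  "LK_proof \<pi> S \<longleftrightarrow> dag_proof lk_prems lk_concl \<pi> \<and> dag_concl lk_concl \<pi> = S"

definition LK_tree_proof :: "lk_rule ptree \<Rightarrow> fm sequent \<Rightarrow> bool" where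
  "LK_tree_proof \<tau> S \<longleftrightarrow> tree_proof lk_prems lk_concl \<tau> \<and> tree_concl lk_concl \<tau> = S"

definition LK1_proof :: "lk_rule dag \<Rightarrow> fm sequent \<Rightarrow> bool" where
  "LK1_proof \<pi> S \<longleftrightarrow> LK_proof \<pi> S \<and>
     (\<forall>l \<in> set \<pi>. depth_one_sequent (lk_concl (fst l)))"

definition LK1_tree_proof :: "lk_rule ptree \<Rightarrow> fm sequent \<Rightarrow> bool" where
  "LK1_tree_proof \<tau> S \<longleftrightarrow> LK_tree_proof \<tau> S \<and>
     (\<forall>r \<in> set_ptree \<tau>. depth_one_sequent (lk_concl r))"


section \<open>The translation of sequents\<close>

primrec Tms :: "dt \<Rightarrow> fm multiset" where
  "Tms (DLit p) = {#FLit p#}"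
| "Tms (Dec B p C) =
     image_mset (And (FLit (bar p))) (Tms B) + image_mset (And (FLit p)) (Tms C)"

primrec Cls :: "dt \<Rightarrow> fm multiset" where
  "Cls (DLit p) = {#FLit p#}"
| "Cls (Dec B p C) =
     image_mset (Or (FLit p)) (Cls B) + image_mset (Or (FLit (bar p))) (Cls C)"

definition cls_tms :: "dt sequent \<Rightarrow> fm sequent" where
  "cls_tms S = (\<Sum>A \<in># fst S. Cls A, \<Sum>B \<in># snd S. Tms B)"


section \<open>Procedures and their running time\<close>

text \<open>Procedures are first-order recursive programs over binary trees (pure Lisp over a single
  atom). A program is a list of bodies of unary functions; a body is evaluated in the
  environment holding just the argument, and \<open>Let\<close> and \<open>Case\<close> push their bound values
  to the front of the environment (de Bruijn indices). Every evaluation step is charged one unit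
  plus the size of the value it returns. Since a step creates and copies nothing but values that
  have been charged in this way, the running time agrees up to a polynomial with the running time
  on Turing machines. Charging single units would not do so, because repeated \<open>Let\<close>s of
  pairs \<open>Dot x x\<close> would build exponentially large trees in linear time.\<close>

datatype data = Nul | Dot data data

primrec dsize :: "data \<Rightarrow> nat" where
  "dsize Nul = 1"
| "dsize (Dot x y) = Suc (dsize x + dsize y)"

datatype expr =
    Var nat
  | NulE
  | DotE expr expr
  | Case expr expr expr
  | Let expr expr
  | Call nat expr

type_synonym program = "expr list"

inductive eval :: "program \<Rightarrow> data list \<Rightarrow> expr \<Rightarrow> data \<Rightarrow> nat \<Rightarrow> bool" for P :: program where
  Var: "i < length \<rho> \<Longrightarrow> eval P \<rho> (Var i) (\<rho> ! i) (1 + dsize (\<rho> ! i))"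
| NulE: "eval P \<rho> NulE Nul (1 + dsize Nul)"
| DotE: "eval P \<rho> a x s \<Longrightarrow> eval P \<rho> b y t \<Longrightarrow>
    eval P \<rho> (DotE a b) (Dot x y) (s + t + 1 + dsize (Dot x y))"
| Case_Nul: "eval P \<rho> e Nul s \<Longrightarrow> eval P \<rho> a v t \<Longrightarrow>
    eval P \<rho> (Case e a b) v (s + t + 1 + dsize v)"
| Case_Dot: "eval P \<rho> e (Dot x y) s \<Longrightarrow> eval P (x # y # \<rho>) b v t \<Longrightarrow>
    eval P \<rho> (Case e a b) v (s + t + 1 + dsize v)"
| Let: "eval P \<rho> e u s \<Longrightarrow> eval P (u # \<rho>) b v t \<Longrightarrow>
    eval P \<rho> (Let e b) v (s + t + 1 + dsize v)"
| Call: "f < length P \<Longrightarrow> eval P \<rho> e u s \<Longrightarrow> eval P [u] (P ! f) v t \<Longrightarrow>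
    eval P \<rho> (Call f e) v (s + t + 1 + dsize v)"

text \<open>\<open>run P x y t\<close>: on input \<open>x\<close>, program \<open>P\<close> (started with its function \<open>0\<close>) halts after
  time \<open>t\<close> with output \<open>y\<close>.\<close>

definition run :: "program \<Rightarrow> data \<Rightarrow> data \<Rightarrow> nat \<Rightarrow> bool" where
  "run P x y t \<longleftrightarrow> eval P [x] (Call 0 (Var 0)) y t"

lemma eval_deterministic:
  "eval P \<rho> e v t \<Longrightarrow> eval P \<rho> e v' t' \<Longrightarrow> v = v' \<and> t = t'"
proof (induction arbitrary: v' t' rule: eval.induct)
  case (Var i \<rho>)
  then show ?case by (auto elim: eval.cases)
next
  case (NulE \<rho>)
  then show ?case by (auto elim: eval.cases)
next
  case (DotE \<rho> a x s b y t)
  from DotE.prems show ?case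
    by (cases rule: eval.cases) (use DotE.IH in blast)
next
  case (Case_Nul \<rho> e s a v t b)
  from Case_Nul.prems show ?case
    by (cases rule: eval.cases) (use Case_Nul.IH in blast)+
next
  case (Case_Dot \<rho> e x y s b v t a)
  from Case_Dot.prems show ?case
    by (cases rule: eval.cases) (use Case_Dot.IH in blast)+
next
  case (Let \<rho> e u s b v t)
  from Let.prems show ?case
    by (cases rule: eval.cases) (use Let.IH in blast)
next
  case (Call f \<rho> e u s v t)
  from Call.prems show ?case
    by (cases rule: eval.cases) (use Call.IH in blast)
qed

definition polynomially_bounded :: "(nat \<Rightarrow> nat) \<Rightarrow> bool" where
  "polynomially_bounded T \<longleftrightarrow> (\<exists>k::nat. (\<lambda>n. real (T n)) \<in> O(\<lambda>n. real n ^ k))"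

definition quasipolynomially_bounded :: "(nat \<Rightarrow> nat) \<Rightarrow> bool" where
  "quasipolynomially_bounded T \<longleftrightarrow>
     (\<exists>k::nat. \<forall>\<^sub>F n in sequentially. real (T n) \<le> 2 powr ((log 2 (real n)) ^ k))"


section \<open>Proofs as inputs and outputs\<close>

text \<open>Variables and line numbers are written in binary, least significant bit first.\<close>

fun enc_nat :: "nat \<Rightarrow> data" where
  "enc_nat n = (if n = 0 then Nul
     else Dot (if odd n then Dot Nul Nul else Nul) (enc_nat (n div 2)))"

declare enc_nat.simps [simp del]

primrec enc_list :: "data list \<Rightarrow> data" where
  "enc_list [] = Nul"
| "enc_list (x # xs) = Dot x (enc_list xs)"

definition enc_node :: "nat \<Rightarrow> data list \<Rightarrow> data" where
  "enc_node tag xs = Dot (enc_nat tag) (enc_list xs)"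

primrec enc_lit :: "lit \<Rightarrow> data" where
  "enc_lit (Pos x) = enc_node 0 [enc_nat x]"
| "enc_lit (Neg x) = enc_node 1 [enc_nat x]"

primrec enc_dt :: "dt \<Rightarrow> data" where
  "enc_dt (DLit p) = enc_node 0 [enc_lit p]"
| "enc_dt (Dec A p B) = enc_node 1 [enc_dt A, enc_lit p, enc_dt B]"

primrec enc_fm :: "fm \<Rightarrow> data" where
  "enc_fm (FLit p) = enc_node 0 [enc_lit p]"
| "enc_fm (And A B) = enc_node 1 [enc_fm A, enc_fm B]"
| "enc_fm (Or A B) = enc_node 2 [enc_fm A, enc_fm B]"

definition enc_cedent :: "('f \<Rightarrow> data) \<Rightarrow> 'f list \<Rightarrow> data" where
  "enc_cedent enc \<Gamma> = enc_list (map enc \<Gamma>)"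

primrec enc_common :: "('f \<Rightarrow> data) \<Rightarrow> 'f common_rule \<Rightarrow> data" where
  "enc_common enc (Init p) = enc_node 0 [enc_lit p]"
| "enc_common enc (InitL p) = enc_node 1 [enc_lit p]"
| "enc_common enc (InitR p) = enc_node 2 [enc_lit p]"
| "enc_common enc (ContrL A \<Gamma> \<Delta>) = enc_node 3 [enc A, enc_cedent enc \<Gamma>, enc_cedent enc \<Delta>]"
| "enc_common enc (ContrR A \<Gamma> \<Delta>) = enc_node 4 [enc A, enc_cedent enc \<Gamma>, enc_cedent enc \<Delta>]"
| "enc_common enc (WeakL A \<Gamma> \<Delta>) = enc_node 5 [enc A, enc_cedent enc \<Gamma>, enc_cedent enc \<Delta>]"
| "enc_common enc (WeakR A \<Gamma> \<Delta>) = enc_node 6 [enc A, enc_cedent enc \<Gamma>, enc_cedent enc \<Delta>]"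
| "enc_common enc (Cut A \<Gamma> \<Delta>) = enc_node 7 [enc A, enc_cedent enc \<Gamma>, enc_cedent enc \<Delta>]"

primrec enc_ldt_rule :: "ldt_rule \<Rightarrow> data" where
  "enc_ldt_rule (LDTCommon r) = enc_node 0 [enc_common enc_dt r]"
| "enc_ldt_rule (DecL A p B \<Gamma> \<Delta>) =
     enc_node 1 [enc_dt A, enc_lit p, enc_dt B, enc_cedent enc_dt \<Gamma>, enc_cedent enc_dt \<Delta>]"
| "enc_ldt_rule (DecR A p B \<Gamma> \<Delta>) =
     enc_node 2 [enc_dt A, enc_lit p, enc_dt B, enc_cedent enc_dt \<Gamma>, enc_cedent enc_dt \<Delta>]"

primrec enc_lk_rule :: "lk_rule \<Rightarrow> data" where
  "enc_lk_rule (LKCommon r) = enc_node 0 [enc_common enc_fm r]"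
| "enc_lk_rule (AndL A B \<Gamma> \<Delta>) =
     enc_node 1 [enc_fm A, enc_fm B, enc_cedent enc_fm \<Gamma>, enc_cedent enc_fm \<Delta>]"
| "enc_lk_rule (AndR A B \<Gamma> \<Delta>) =
     enc_node 2 [enc_fm A, enc_fm B, enc_cedent enc_fm \<Gamma>, enc_cedent enc_fm \<Delta>]"
| "enc_lk_rule (OrL A B \<Gamma> \<Delta>) =
     enc_node 3 [enc_fm A, enc_fm B, enc_cedent enc_fm \<Gamma>, enc_cedent enc_fm \<Delta>]"
| "enc_lk_rule (OrR A B \<Gamma> \<Delta>) =
     enc_node 4 [enc_fm A, enc_fm B, enc_cedent enc_fm \<Gamma>, enc_cedent enc_fm \<Delta>]"

definition enc_dag :: "('r \<Rightarrow> data) \<Rightarrow> 'r dag \<Rightarrow> data" where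
  "enc_dag enc \<pi> = enc_list (map (\<lambda>(r, is). Dot (enc r) (enc_list (map enc_nat is))) \<pi>)"

primrec enc_tree :: "('r \<Rightarrow> data) \<Rightarrow> 'r ptree \<Rightarrow> data" where
  "enc_tree enc (Infer r \<tau>s) = Dot (enc r) (enc_list (map (enc_tree enc) \<tau>s))"

lemma enc_nat_inject [simp]: "enc_nat m = enc_nat n \<longleftrightarrow> m = n"
proof (induction m arbitrary: n rule: less_induct)
  case (less m)
  show ?case
  proof (cases "m = 0 \<or> n = 0")
    case True
    then show ?thesis by (auto simp: enc_nat.simps[of m] enc_nat.simps[of n])
  next
    case False
    then have "enc_nat m = enc_nat n \<longleftrightarrow> odd m = odd n \<and> m div 2 = n div 2"
      using less.IH[of "m div 2" "n div 2"]
      by (auto simp: enc_nat.simps[of m] enc_nat.simps[of n])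
    also have "\<dots> \<longleftrightarrow> m = n"
      by (metis bit_eq_rec)
    finally show ?thesis .
  qed
qed

lemma enc_list_inject [simp]: "enc_list xs = enc_list ys \<longleftrightarrow> xs = ys"
proof (induction xs arbitrary: ys)
  case Nil
  then show ?case by (cases ys) auto
next
  case (Cons x xs)
  then show ?case by (cases ys) auto
qed

lemma enc_node_inject [simp]: "enc_node k xs = enc_node l ys \<longleftrightarrow> k = l \<and> xs = ys"
  by (simp add: enc_node_def)

lemma enc_lit_inject [simp]: "enc_lit p = enc_lit q \<longleftrightarrow> p = q"
  by (cases p; cases q) auto

lemma enc_dt_inject [simp]: "enc_dt A = enc_dt B \<longleftrightarrow> A = B"
proof (induction A arbitrary: B)
  case (DLit p)
  then show ?case by (cases B) auto
next
  case (Dec A1 p A2)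
  then show ?case by (cases B) auto
qed

lemma enc_fm_inject [simp]: "enc_fm A = enc_fm B \<longleftrightarrow> A = B"
proof (induction A arbitrary: B)
  case (FLit p)
  then show ?case by (cases B) auto
next
  case (And A1 A2)
  then show ?case by (cases B) auto
next
  case (Or A1 A2)
  then show ?case by (cases B) auto
qed

lemma inj_enc_cedent: "inj enc \<Longrightarrow> inj (enc_cedent enc)"
  by (auto simp: inj_def enc_cedent_def inj_map_eq_map)

lemma inj_enc_common: "inj enc \<Longrightarrow> inj (enc_common enc)"
proof (rule injI)
  fix r s
  assume "inj enc" "enc_common enc r = enc_common enc s"
  then show "r = s"
    using inj_enc_cedent[OF \<open>inj enc\<close>]
    by (cases r; cases s) (auto dest: injD)
qed

lemma inj_enc_dt: "inj enc_dt" and inj_enc_fm: "inj enc_fm"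
  by (auto simp: inj_def)

lemma inj_enc_ldt_rule: "inj enc_ldt_rule"
proof (rule injI)
  fix r s
  assume "enc_ldt_rule r = enc_ldt_rule s"
  then show "r = s"
    using inj_enc_cedent[OF inj_enc_dt] inj_enc_common[OF inj_enc_dt]
    by (cases r; cases s) (auto dest: injD)
qed

lemma inj_enc_lk_rule: "inj enc_lk_rule"
proof (rule injI)
  fix r s
  assume "enc_lk_rule r = enc_lk_rule s"
  then show "r = s"
    using inj_enc_cedent[OF inj_enc_fm] inj_enc_common[OF inj_enc_fm]
    by (cases r; cases s) (auto dest: injD)
qed

lemma inj_enc_dag: "inj enc \<Longrightarrow> inj (enc_dag enc)"
proof -
  assume inj: "inj enc"
  have "inj enc_nat" by (simp add: inj_def)
  with inj have "inj (\<lambda>(r, is). Dot (enc r) (enc_list (map enc_nat is)))"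
    by (auto simp: inj_def inj_map_eq_map)
  then show ?thesis
    by (auto simp: inj_def enc_dag_def inj_map_eq_map)
qed

lemma inj_enc_tree: "inj enc \<Longrightarrow> inj (enc_tree enc)"
proof (rule injI)
  fix \<tau> \<tau>'
  assume inj: "inj enc"
  show "enc_tree enc \<tau> = enc_tree enc \<tau>' \<Longrightarrow> \<tau> = \<tau>'"
  proof (induction \<tau> arbitrary: \<tau>')
    case (Infer r \<tau>s)
    obtain r' \<tau>s' where \<tau>': "\<tau>' = Infer r' \<tau>s'" by (cases \<tau>')
    have "map (enc_tree enc) \<tau>s = map (enc_tree enc) \<tau>s'" "r = r'"
      using Infer.prems inj by (auto simp: \<tau>' dest: injD)
    then have "length \<tau>s = length \<tau>s'"
      by (metis length_map)
    have "\<tau>s = \<tau>s'"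
    proof (rule nth_equalityI)
      fix i assume i: "i < length \<tau>s"
      then have "enc_tree enc (\<tau>s ! i) = enc_tree enc (\<tau>s' ! i)"
        using \<open>map (enc_tree enc) \<tau>s = map (enc_tree enc) \<tau>s'\<close> \<open>length \<tau>s = length \<tau>s'\<close>
        by (metis nth_map)
      then show "\<tau>s ! i = \<tau>s' ! i"
        using Infer.IH i by simp
    qed fact
    with \<open>r = r'\<close> show ?case by (simp add: \<tau>')
  qed
qed

end

theory Submission
  imports Defs "HOL-Library.Discrete_Functions"
begin

text \<open>Each rule of the decision tree calculus is translated into a derivation of the translated conclusion
  from the translated premises. A term and a clause of the same formula \<open>A\<close> always share a literal, so that
  they clash, and a cut on \<open>A\<close> becomes cuts of all clauses of \<open>A\<close> against all its terms. These cuts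
  use the derivation of one of the two premises once, and that of the other one, which can be chosen freely,
  once for each branch of \<open>A\<close>. In dag-like proofs the repetition costs nothing; in
  tree-like proofs duplicating the smaller subproof gives size \<open>n\<^bsup>O(log n)\<^esup>\<close>.

  That the translation is computable within these bounds is shown without writing any program: the functions that some
  program computes in polynomial time on encodings contain the constructors and selectors of all data types
  involved and are closed under composition and under structural recursion with additive growth.\<close>

section \<open>Polynomial bounds\<close>

text \<open>The obstacle is that a cut formula A becomes many formulas: one premise of the
  translated cut has all terms of A in the succedent, the other all its clauses in the antecedent,
  and depth one forbids joining them again. So each branch \<open>b\<close> of one premise needs the
  other premise afresh, with \<open>b\<close> in place of all branches of the opposite kind. Only
  cuts need copies; the decision rules use each premise once. If f(m) bounds the result for a tree
  of size m, a cut gives f(m) \<le> f(i) + c * f(j) + K with i + j < m and c at most the number of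
  branches; the choice of roles ensures j \<le> i. Then j is below m / 2, copying nests to
  logarithmic depth, and f(m) \<le> m * K^(1 + log m).

  Rules are translated into schemes with two open hypotheses, which are either flattened into lines
  or filled with subproofs. Their running times need bounds on intermediate results as well:
  polynomial steps along a recursion stay harmless only if the values passed up stay small, by
  additive growth in general, by the estimate for f in the tree-like case.\<close>

definition poly_bd :: "(nat \<Rightarrow> nat) \<Rightarrow> bool" where
  "poly_bd b \<longleftrightarrow> mono b \<and> (\<exists>c k. \<forall>n. b n \<le> c * Suc n ^ k)"

lemma poly_bdI: "mono b \<Longrightarrow> (\<And>n. b n \<le> c * Suc n ^ k) \<Longrightarrow> poly_bd b"
  by (auto simp: poly_bd_def)

lemma poly_bd_const: "poly_bd (\<lambda>n. a)"
  by (rule poly_bdI[where c = a and k = 0]) (auto simp: mono_def)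

lemma poly_bd_id: "poly_bd (\<lambda>n. n)"
  by (rule poly_bdI[where c = 1 and k = 1]) (auto simp: mono_def)

lemma poly_bd_add:
  assumes "poly_bd f" "poly_bd g"
  shows "poly_bd (\<lambda>n. f n + g n)"
proof -
  from assms obtain c k d l where
    *: "mono f" "mono g" "\<And>n. f n \<le> c * Suc n ^ k" "\<And>n. g n \<le> d * Suc n ^ l"
    by (auto simp: poly_bd_def)
  show ?thesis
  proof (rule poly_bdI[where c = "c + d" and k = "k + l"])
    show "mono (\<lambda>n. f n + g n)"
      using * by (auto simp: mono_def intro: add_mono)
    fix n
    have "Suc n ^ k \<le> Suc n ^ (k + l)" "Suc n ^ l \<le> Suc n ^ (k + l)"
      by (rule power_increasing; simp)+
    then have "c * Suc n ^ k \<le> c * Suc n ^ (k + l)" "d * Suc n ^ l \<le> d * Suc n ^ (k + l)"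
      by (simp_all only: mult_le_mono2)
    then show "f n + g n \<le> (c + d) * Suc n ^ (k + l)"
      using *(3)[of n] *(4)[of n] by (simp only: distrib_right)
  qed
qed

lemma poly_bd_mult:
  assumes "poly_bd f" "poly_bd g"
  shows "poly_bd (\<lambda>n. f n * g n)"
proof -
  from assms obtain c k d l where
    *: "mono f" "mono g" "\<And>n. f n \<le> c * Suc n ^ k" "\<And>n. g n \<le> d * Suc n ^ l"
    by (auto simp: poly_bd_def)
  show ?thesis
  proof (rule poly_bdI[where c = "c * d" and k = "k + l"])
    show "mono (\<lambda>n. f n * g n)"
      using * by (auto simp: mono_def intro: mult_mono)
    fix n
    have "f n * g n \<le> (c * Suc n ^ k) * (d * Suc n ^ l)"
      by (intro mult_mono *) auto
    then show "f n * g n \<le> c * d * Suc n ^ (k + l)"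
      by (simp only: power_add mult.assoc mult.left_commute)
  qed
qed

text \<open>Monotonicity is part of \<open>poly_bd\<close> so that a bound on the size of an
  intermediate value may be substituted for that size. Powers of \<open>Suc n\<close> instead of
  \<open>n\<close> avoid an exception at 0.\<close>

lemma poly_bd_comp:
  assumes "poly_bd f" "poly_bd g"
  shows "poly_bd (\<lambda>n. f (g n))"
proof -
  from assms obtain c k d l where
    *: "mono f" "mono g" "\<And>n. f n \<le> c * Suc n ^ k" "\<And>n. g n \<le> d * Suc n ^ l"
    by (auto simp: poly_bd_def)
  show ?thesis
  proof (rule poly_bdI[where c = "c * Suc d ^ k" and k = "l * k"])
    show "mono (\<lambda>n. f (g n))"
      using * by (auto simp: mono_def)
    fix n
    have "Suc (g n) \<le> Suc d * Suc n ^ l"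
      using *(4)[of n] one_le_power[of "Suc n" l] unfolding mult_Suc by linarith
    then have "Suc (g n) ^ k \<le> (Suc d * Suc n ^ l) ^ k"
      by (rule power_mono) simp
    also have "\<dots> = Suc d ^ k * Suc n ^ (l * k)"
      by (simp only: power_mult_distrib power_mult)
    finally have "c * Suc (g n) ^ k \<le> c * (Suc d ^ k * Suc n ^ (l * k))"
      by (rule mult_le_mono2)
    then show "f (g n) \<le> c * Suc d ^ k * Suc n ^ (l * k)"
      using *(3)[of "g n"] by (simp only: mult.assoc)
  qed
qed

lemma poly_bd_Suc: "poly_bd f \<Longrightarrow> poly_bd (\<lambda>n. Suc (f n))"
  using poly_bd_add[OF poly_bd_const[of 1]] by simp

lemmas poly_bd_intros = poly_bd_const poly_bd_id poly_bd_add poly_bd_mult poly_bd_Suc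

lemma poly_bd_mono: "poly_bd b \<Longrightarrow> m \<le> n \<Longrightarrow> b m \<le> b n"
  by (auto simp: poly_bd_def mono_def)


section \<open>Encodable types\<close>

text \<open>Injectivity is not demanded; it is assumed separately where values are compared.\<close>

class enc =
  fixes encode :: "'a \<Rightarrow> data"

definition sz :: "'a::enc \<Rightarrow> nat" where
  "sz x = dsize (encode x)"

lemma dsize_pos: "1 \<le> dsize d"
  by (cases d) auto

lemma sz_pos: "1 \<le> sz x"
  unfolding sz_def by (rule dsize_pos)

instantiation data :: enc begin
definition "encode (x::data) = x"
instance ..
end

text \<open>Sharing \<open>Nul\<close> with the empty list gives a tuple ending in \<open>()\<close>
  the encoding of the list of its encoded components. This is how argument lists of mixed types are
  handled.\<close>

instantiation unit :: enc begin
definition "encode (x::unit) = Nul"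
instance ..
end

text \<open>\<open>False\<close> is \<open>Nul\<close>, so that \<open>Case\<close> can branch on a
  truth value.\<close>

instantiation bool :: enc begin
definition "encode b = (if b then Dot Nul Nul else Nul)"
instance ..
end

instantiation nat :: enc begin
definition "encode = enc_nat"
instance ..
end

instantiation prod :: (enc, enc) enc begin
definition "encode p = Dot (encode (fst p)) (encode (snd p))"
instance ..
end

instantiation list :: (enc) enc begin
definition "encode xs = enc_list (map encode xs)"
instance ..
end

lemma encode_data [simp]: "encode (x::data) = x"
  by (simp add: encode_data_def)

lemma encode_unit [simp]: "encode (x::unit) = Nul"
  by (simp add: encode_unit_def)

lemma encode_True [simp]: "encode True = Dot Nul Nul"
  and encode_False [simp]: "encode False = Nul"
  by (simp_all add: encode_bool_def)

lemma encode_Pair [simp]: "encode (x, y) = Dot (encode x) (encode y)"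
  by (simp add: encode_prod_def)

lemma encode_Nil [simp]: "encode [] = Nul"
  and encode_Cons [simp]: "encode (x # xs) = Dot (encode x) (encode xs)"
  by (simp_all add: encode_list_def)

lemma sz_simps [simp]:
  "sz (u::unit) = 1" "sz (x, y) = Suc (sz x + sz y)"
  "sz ([]::'a::enc list) = 1" "sz (z # zs) = Suc (sz z + sz zs)"
  by (simp_all add: sz_def)

lemma sz_bool: "sz (b::bool) \<le> 3"
  by (simp add: sz_def encode_bool_def)

lemma sz_append: "Suc (sz (xs @ ys)) = sz xs + sz ys"
  by (induction xs) auto

lemma length_less_sz: "length xs < sz xs"
  by (induction xs) auto

lemma sz_mem_list: "x \<in> set xs \<Longrightarrow> sz x < sz xs"
  by (induction xs) auto

lemma sz_le_length:
  assumes "\<And>x. x \<in> set xs \<Longrightarrow> sz x \<le> D"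
  shows "sz xs \<le> Suc (length xs * Suc D)"
  using assms by (induction xs) fastforce+


section \<open>Linking programs\<close>

text \<open>Functions are called by their absolute index in the program, so a program copied to
  offset \<open>k\<close> has its calls relocated.\<close>

primrec shift :: "nat \<Rightarrow> expr \<Rightarrow> expr" where
  "shift k (Var i) = Var i"
| "shift k NulE = NulE"
| "shift k (DotE a b) = DotE (shift k a) (shift k b)"
| "shift k (Case e a b) = Case (shift k e) (shift k a) (shift k b)"
| "shift k (Let e b) = Let (shift k e) (shift k b)"
| "shift k (Call f e) = Call (k + f) (shift k e)"

definition embedded :: "program \<Rightarrow> nat \<Rightarrow> program \<Rightarrow> bool" where
  "embedded Q k P \<longleftrightarrow> (\<forall>f < length P. k + f < length Q \<and> Q ! (k + f) = shift k (P ! f))"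

lemma eval_shift:
  assumes "eval P \<rho> e v t" "embedded Q k P"
  shows "eval Q \<rho> (shift k e) v t"
  using assms
proof (induction rule: eval.induct)
  case (Call f \<rho> e u s v t)
  then have "k + f < length Q" "Q ! (k + f) = shift k (P ! f)"
    by (auto simp: embedded_def)
  then show ?case
    using Call eval.Call[of "k + f" Q \<rho> "shift k e" u s v t] by simp
qed (simp only: shift.simps, blast intro: eval.intros)+

lemma eval_Var: "i < length \<rho> \<Longrightarrow> v = \<rho> ! i \<Longrightarrow> eval P \<rho> (Var i) v (1 + dsize v)"
  using eval.Var by auto

lemma eval_call_embedded:
  assumes "embedded Q k P" "P \<noteq> []" "eval P [u] (P ! 0) v t" "eval Q \<rho> e u s"
  shows "eval Q \<rho> (Call k e) v (s + t + 1 + dsize v)"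
proof -
  have "k + 0 < length Q" "Q ! (k + 0) = shift k (P ! 0)"
    using assms(1,2) unfolding embedded_def by blast+
  then show ?thesis
    using eval.Call[of k Q \<rho> e u s v t] assms(4) eval_shift[OF assms(3,1)] by simp
qed

lemma embedded_append: "length A = k \<Longrightarrow> embedded (A @ map (shift k) P @ B) k P"
  by (auto simp: embedded_def nth_append)

text \<open>Three programs suffice for a conditional, and two new bodies for a recursion with its
  auxiliary loop over a list. The new bodies may refer to the offsets of the linked
  programs.\<close>

lemma link:
  obtains Q k1 k2 k3 where "embedded Q k1 P1" "embedded Q k2 P2" "embedded Q k3 P3"
    "1 < length Q" "Q ! 0 = F k1 k2 k3" "Q ! 1 = G k1 k2 k3"
proof -
  define k1 k2 k3 where "k1 = (2::nat)" and "k2 = k1 + length P1" and "k3 = k2 + length P2"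
  define Q where "Q = [F k1 k2 k3, G k1 k2 k3] @ map (shift k1) P1 @ map (shift k2) P2
    @ map (shift k3) P3 @ []"
  have "embedded Q k1 P1"
    unfolding Q_def by (rule embedded_append) (simp add: k1_def)
  moreover have "embedded Q k2 P2"
    using embedded_append[of "[F k1 k2 k3, G k1 k2 k3] @ map (shift k1) P1" k2 P2
        "map (shift k3) P3 @ []"]
    by (simp add: Q_def k2_def k1_def)
  moreover have "embedded Q k3 P3"
    using embedded_append[of "[F k1 k2 k3, G k1 k2 k3] @ map (shift k1) P1 @ map (shift k2) P2"
        k3 P3 "[]"]
    by (simp add: Q_def k3_def k2_def k1_def)
  ultimately show thesis
    by (rule that) (simp_all add: Q_def)
qed

text \<open>Every step is charged the size of its value, hence a time bound is also a bound on the
  output.\<close>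

lemma dsize_le_time: "eval P \<rho> e v t \<Longrightarrow> dsize v \<le> t"
  by (induction rule: eval.induct) auto


section \<open>Polynomial-time functions\<close>

text \<open>The program has to halt within the bound on every value of the input type, also on lists
  and trees of rules that are not proofs.\<close>

definition computes :: "program \<Rightarrow> (nat \<Rightarrow> nat) \<Rightarrow> ('a::enc \<Rightarrow> 'b::enc) \<Rightarrow> bool" where
  "computes P b f \<longleftrightarrow> P \<noteq> [] \<and>
     (\<forall>x. \<exists>t. eval P [encode x] (P ! 0) (encode (f x)) t \<and> t \<le> b (sz x))"

definition ptime :: "('a::enc \<Rightarrow> 'b::enc) \<Rightarrow> bool" where
  "ptime f \<longleftrightarrow> (\<exists>P b. poly_bd b \<and> computes P b f)"

lemma ptimeI: "poly_bd b \<Longrightarrow> computes P b f \<Longrightarrow> ptime f"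
  by (auto simp: ptime_def)

lemma computesD:
  assumes "computes P b f"
  obtains t where "eval P [encode x] (P ! 0) (encode (f x)) t" "t \<le> b (sz x)" "sz (f x) \<le> b (sz x)"
  using assms dsize_le_time unfolding computes_def sz_def by (metis le_trans)

lemma ptime_size:
  assumes "ptime f"
  obtains b where "poly_bd b" "\<And>x. sz (f x) \<le> b (sz x)"
  using assms unfolding ptime_def by (metis computesD)

lemma computes_call:
  assumes "computes P b f" "embedded Q k P" "eval Q \<rho> e (encode x) s"
  obtains t where "eval Q \<rho> (Call k e) (encode (f x)) t" "t \<le> s + 1 + (b (sz x) + b (sz x))"
    "sz (f x) \<le> b (sz x)"
proof -
  have "P \<noteq> []" using assms(1) by (simp add: computes_def)
  moreover obtain t where t: "eval P [encode x] (P ! 0) (encode (f x)) t" "t \<le> b (sz x)"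
    "sz (f x) \<le> b (sz x)" by (rule computesD[OF assms(1)])
  ultimately have "eval Q \<rho> (Call k e) (encode (f x)) (s + t + 1 + sz (f x))"
    unfolding sz_def using eval_call_embedded assms(2,3) by blast
  then show thesis by (rule that) (use t in simp_all)
qed

lemma eval_arg: "eval Q [encode x] (Var 0) (encode x) (1 + sz x)"
  unfolding sz_def by (rule eval_Var) auto

named_theorems ptime_intros

text \<open>Only encodings count, and the two functions may have different result types. A value can
  therefore be built as a tuple and reread as a formula or rule.\<close>

lemma ptime_cong:
  assumes "ptime f" "\<And>x. encode (g x) = encode (f x)"
  shows "ptime g"
  using assms by (simp add: ptime_def computes_def)

lemma ptime_id [ptime_intros]: "ptime (\<lambda>x. x)"
proof (rule ptimeI)
  show "computes [Var 0] (\<lambda>n. Suc n) (\<lambda>x. x)"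
    unfolding computes_def
    by (intro conjI allI) (auto intro!: exI eval_Var simp: sz_def)
qed (intro poly_bd_intros)

text \<open>Constants are compiled into the program, at a cost that does not depend on the
  input.\<close>

primrec quote :: "data \<Rightarrow> expr" where
  "quote Nul = NulE"
| "quote (Dot x y) = DotE (quote x) (quote y)"

lemma eval_quote: "\<exists>t. \<forall>P \<rho>. eval P \<rho> (quote d) d t"
proof (induction d)
  case Nul
  then show ?case using eval.NulE by auto
next
  case (Dot x y)
  then obtain s t where "\<forall>P \<rho>. eval P \<rho> (quote x) x s" "\<forall>P \<rho>. eval P \<rho> (quote y) y t" by blast
  then have "\<forall>P \<rho>. eval P \<rho> (quote (Dot x y)) (Dot x y) (s + t + 1 + dsize (Dot x y))"
    unfolding quote.simps by (blast intro: eval.DotE)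
  then show ?case by (rule exI)
qed

lemma ptime_const [ptime_intros]: "ptime (\<lambda>x. c)"
proof -
  obtain t where "\<And>P \<rho>. eval P \<rho> (quote (encode c)) (encode c) t"
    using eval_quote by metis
  then have "computes [quote (encode c)] (\<lambda>n. t) (\<lambda>x. c)"
    by (auto simp: computes_def)
  then show ?thesis
    using ptimeI poly_bd_const by blast
qed

lemma ptime_comp:
  assumes "ptime f" "ptime g"
  shows "ptime (\<lambda>x. g (f x))"
proof -
  from assms obtain P1 b1 P2 b2 where b: "poly_bd b1" "poly_bd b2"
    and P: "computes P1 b1 f" "computes P2 b2 g"
    by (auto simp: ptime_def)
  obtain Q k1 k2 k3 where Q: "embedded Q k1 P1" "embedded Q k2 P2" "embedded Q k3 P2"
    "1 < length Q" "Q ! 0 = Call k2 (Call k1 (Var 0))" "Q ! 1 = NulE"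
    by (rule link[where F = "\<lambda>k1 k2 k3. Call k2 (Call k1 (Var 0))" and G = "\<lambda>k1 k2 k3. NulE"])
  show ?thesis
  proof (rule ptimeI)
    show "computes Q (\<lambda>n. 3 + n + (b1 n + b1 n) + (b2 (b1 n) + b2 (b1 n))) (\<lambda>x. g (f x))"
      unfolding computes_def
    proof (intro conjI allI)
      show "Q \<noteq> []" using Q by auto
      fix x
      obtain t1 where t1: "eval Q [encode x] (Call k1 (Var 0)) (encode (f x)) t1"
        "t1 \<le> 1 + sz x + 1 + (b1 (sz x) + b1 (sz x))" "sz (f x) \<le> b1 (sz x)"
        by (rule computes_call[OF P(1) Q(1) eval_arg])
      obtain t2 where t2: "eval Q [encode x] (Q ! 0) (encode (g (f x))) t2"
        "t2 \<le> t1 + 1 + (b2 (sz (f x)) + b2 (sz (f x)))"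
        unfolding Q by (rule computes_call[OF P(2) Q(2) t1(1)])
      have "b2 (sz (f x)) \<le> b2 (b1 (sz x))"
        using poly_bd_mono[OF b(2) t1(3)] .
      then show "\<exists>t. eval Q [encode x] (Q ! 0) (encode (g (f x))) t \<and>
          t \<le> 3 + sz x + (b1 (sz x) + b1 (sz x)) + (b2 (b1 (sz x)) + b2 (b1 (sz x)))"
        using t1 t2 by (intro exI[of _ t2] conjI) (assumption, linarith)
    qed
  qed (intro poly_bd_intros b poly_bd_comp[OF b(2,1)])
qed

lemma ptime_Dot:
  assumes "ptime f" "ptime g" "\<And>x. encode (h x) = Dot (encode (f x)) (encode (g x))"
  shows "ptime h"
proof -
  from assms obtain P1 b1 P2 b2 where b: "poly_bd b1" "poly_bd b2"
    and P: "computes P1 b1 f" "computes P2 b2 g"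
    by (auto simp: ptime_def)
  obtain Q k1 k2 k3 where Q: "embedded Q k1 P1" "embedded Q k2 P2" "embedded Q k3 P2"
    "1 < length Q" "Q ! 0 = DotE (Call k1 (Var 0)) (Call k2 (Var 0))" "Q ! 1 = NulE"
    by (rule link[where F = "\<lambda>k1 k2 k3. DotE (Call k1 (Var 0)) (Call k2 (Var 0))"
          and G = "\<lambda>k1 k2 k3. NulE"])
  show ?thesis
  proof (rule ptimeI)
    show "computes Q (\<lambda>n. 6 + (n + n) + (b1 n + b1 n + b1 n) + (b2 n + b2 n + b2 n)) h"
      unfolding computes_def
    proof (intro conjI allI)
      show "Q \<noteq> []" using Q by auto
      fix x
      obtain t1 where t1: "eval Q [encode x] (Call k1 (Var 0)) (encode (f x)) t1"
        "t1 \<le> 1 + sz x + 1 + (b1 (sz x) + b1 (sz x))" "sz (f x) \<le> b1 (sz x)"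
        by (rule computes_call[OF P(1) Q(1) eval_arg])
      obtain t2 where t2: "eval Q [encode x] (Call k2 (Var 0)) (encode (g x)) t2"
        "t2 \<le> 1 + sz x + 1 + (b2 (sz x) + b2 (sz x))" "sz (g x) \<le> b2 (sz x)"
        by (rule computes_call[OF P(2) Q(2) eval_arg])
      show "\<exists>t. eval Q [encode x] (Q ! 0) (encode (h x)) t \<and> t \<le> 6 + (sz x + sz x) +
          (b1 (sz x) + b1 (sz x) + b1 (sz x)) + (b2 (sz x) + b2 (sz x) + b2 (sz x))"
        using eval.DotE[OF t1(1) t2(1)] t1 t2 unfolding Q assms(3)
        by (intro exI conjI) (assumption, simp add: sz_def[symmetric])
    qed
  qed (intro poly_bd_intros b)
qed

lemma ptime_If [ptime_intros]:
  fixes c :: "'a::enc \<Rightarrow> bool"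
  assumes "ptime c" "ptime f" "ptime g"
  shows "ptime (\<lambda>x. if c x then f x else g x)"
proof -
  from assms obtain P1 b1 P2 b2 P3 b3 where b: "poly_bd b1" "poly_bd b2" "poly_bd b3"
    and P: "computes P1 b1 c" "computes P2 b2 f" "computes P3 b3 g"
    by (auto simp: ptime_def)
  obtain Q k1 k2 k3 where Q: "embedded Q k1 P1" "embedded Q k2 P2" "embedded Q k3 P3"
    "1 < length Q" "Q ! 0 = Case (Call k1 (Var 0)) (Call k3 (Var 0)) (Call k2 (Var 2))"
    "Q ! 1 = NulE"
    by (rule link[where F = "\<lambda>k1 k2 k3. Case (Call k1 (Var 0)) (Call k3 (Var 0)) (Call k2 (Var 2))"
          and G = "\<lambda>k1 k2 k3. NulE"])
  show ?thesis
  proof (rule ptimeI)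
    show "computes Q (\<lambda>n. 5 + (n + n) + (b1 n + b1 n) + (b2 n + b2 n + b2 n) + (b3 n + b3 n + b3 n))
      (\<lambda>x. if c x then f x else g x)"
      unfolding computes_def
    proof (intro conjI allI)
      show "Q \<noteq> []" using Q by auto
      fix x :: 'a
      \<comment> \<open>Matching \<open>True\<close> pushes the two components of
        \<open>Dot Nul Nul\<close>, which moves the argument to index 2.\<close>
      have arg2: "eval Q [Nul, Nul, encode x] (Var 2) (encode x) (1 + sz x)"
        unfolding sz_def by (rule eval_Var) auto
      obtain t1 where t1: "eval Q [encode x] (Call k1 (Var 0)) (encode (c x)) t1"
        "t1 \<le> 1 + sz x + 1 + (b1 (sz x) + b1 (sz x))" "sz (c x) \<le> b1 (sz x)"
        by (rule computes_call[OF P(1) Q(1) eval_arg])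
      obtain t2 where t2: "eval Q [Nul, Nul, encode x] (Call k2 (Var 2)) (encode (f x)) t2"
        "t2 \<le> 1 + sz x + 1 + (b2 (sz x) + b2 (sz x))" "sz (f x) \<le> b2 (sz x)"
        by (rule computes_call[OF P(2) Q(2) arg2])
      obtain t3 where t3: "eval Q [encode x] (Call k3 (Var 0)) (encode (g x)) t3"
        "t3 \<le> 1 + sz x + 1 + (b3 (sz x) + b3 (sz x))" "sz (g x) \<le> b3 (sz x)"
        by (rule computes_call[OF P(3) Q(3) eval_arg])
      show "\<exists>t. eval Q [encode x] (Q ! 0) (encode (if c x then f x else g x)) t \<and>
        t \<le> 5 + (sz x + sz x) + (b1 (sz x) + b1 (sz x)) + (b2 (sz x) + b2 (sz x) + b2 (sz x)) +
          (b3 (sz x) + b3 (sz x) + b3 (sz x))"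
      proof (cases "c x")
        case True
        then have "eval Q [encode x] (Call k1 (Var 0)) (Dot Nul Nul) t1"
          using t1(1) by simp
        from eval.Case_Dot[OF this t2(1)] True
        have "eval Q [encode x] (Q ! 0) (encode (if c x then f x else g x)) (t1 + t2 + 1 + sz (f x))"
          unfolding Q sz_def by simp
        then show ?thesis
          by (intro exI conjI) (assumption, use t1 t2 in linarith)
      next
        case False
        then have "eval Q [encode x] (Call k1 (Var 0)) Nul t1"
          using t1(1) by simp
        from eval.Case_Nul[OF this t3(1)] False
        have "eval Q [encode x] (Q ! 0) (encode (if c x then f x else g x)) (t1 + t3 + 1 + sz (g x))"
          unfolding Q sz_def by simp
        then show ?thesis
          by (intro exI conjI) (assumption, use t1 t3 in linarith)
      qed
    qed
  qed (intro poly_bd_intros b)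
qed

section \<open>Access to the components of binary trees\<close>

primrec car :: "data \<Rightarrow> data" where
  "car Nul = Nul"
| "car (Dot x y) = x"

primrec cdr :: "data \<Rightarrow> data" where
  "cdr Nul = Nul"
| "cdr (Dot x y) = y"

lemma eval_NulE: "v = Nul \<Longrightarrow> eval P \<rho> NulE v 2"
  using eval.NulE[of P \<rho>] by (simp add: numeral_2_eq_2)

text \<open>The most expensive constant branch needed, \<open>DotE NulE NulE\<close>, costs exactly
  8. Adding the scrutinee and a result that is at most as large as the time of its branch gives 18 +
  3n.\<close>

lemma ptime_data_case:
  fixes f :: "data \<Rightarrow> 'b::enc"
  defines "P \<equiv> \<lambda>a b. [Case (Var 0) a b]"
  assumes "\<exists>s \<le> 8. eval (P a b) [Nul] a (encode (f Nul)) s"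
    and "\<And>y z. \<exists>s \<le> 8 + dsize (Dot y z). eval (P a b) [y, z, Dot y z] b (encode (f (Dot y z))) s"
  shows "ptime f"
proof (rule ptimeI)
  show "computes (P a b) (\<lambda>n. 18 + (n + n + n)) f"
    unfolding computes_def
  proof (intro conjI allI)
    fix x
    have var: "eval (P a b) [x] (Var 0) x (1 + dsize x)"
      by (rule eval_Var) auto
    obtain s where s: "eval (P a b) [x] (Case (Var 0) a b) (encode (f x))
        (1 + dsize x + s + 1 + dsize (encode (f x)))"
      "dsize (encode (f x)) \<le> s" "s \<le> 8 + dsize x"
    proof (cases x)
      case Nul
      with assms(2) obtain s where "s \<le> 8" "eval (P a b) [Nul] a (encode (f Nul)) s" by blast
      with that[of s] eval.Case_Nul[OF var[unfolded Nul] this(2)] dsize_le_time[OF this(2)]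
      show thesis unfolding Nul by simp
    next
      case (Dot y z)
      with assms(3)[of y z] obtain s where
        "s \<le> 8 + dsize (Dot y z)" "eval (P a b) [y, z, Dot y z] b (encode (f (Dot y z))) s" by blast
      with that[of s] eval.Case_Dot[OF var[unfolded Dot] this(2)] dsize_le_time[OF this(2)]
      show thesis unfolding Dot by simp
    qed
    then show "\<exists>t. eval (P a b) [encode x] (P a b ! 0) (encode (f x)) t \<and> t \<le> 18 + (sz x + sz x + sz x)"
      by (intro exI conjI) (simp add: P_def, simp add: sz_def)
  qed (simp add: P_def)
qed (intro poly_bd_intros)

lemma ptime_car: "ptime car"
proof (rule ptime_data_case[where a = NulE and b = "Var 0"])
  show "\<exists>s\<le>8. eval [Case (Var 0) NulE (Var 0)] [Nul] NulE (encode (car Nul)) s"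
    by (rule exI[of _ 2]) (simp add: eval_NulE)
  show "\<exists>s\<le>8 + dsize (Dot y z). eval [Case (Var 0) NulE (Var 0)] [y, z, Dot y z] (Var 0)
      (encode (car (Dot y z))) s" for y z
    by (rule exI[of _ "1 + dsize y"], intro conjI) (simp, simp only: car.simps cdr.simps encode_data, (rule eval_Var; simp))
qed

lemma ptime_cdr: "ptime cdr"
proof (rule ptime_data_case[where a = NulE and b = "Var 1"])
  show "\<exists>s\<le>8. eval [Case (Var 0) NulE (Var 1)] [Nul] NulE (encode (cdr Nul)) s"
    by (rule exI[of _ 2]) (simp add: eval_NulE)
  show "\<exists>s\<le>8 + dsize (Dot y z). eval [Case (Var 0) NulE (Var 1)] [y, z, Dot y z] (Var 1)
      (encode (cdr (Dot y z))) s" for y z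
    by (rule exI[of _ "1 + dsize z"], intro conjI) (simp, simp only: car.simps cdr.simps encode_data, (rule eval_Var; simp))
qed

lemma ptime_is_Nul: "ptime (\<lambda>d. d = Nul)"
proof (rule ptime_data_case[where a = "DotE NulE NulE" and b = NulE])
  show "\<exists>s\<le>8. eval [Case (Var 0) (DotE NulE NulE) NulE] [Nul] (DotE NulE NulE)
      (encode (Nul = Nul)) s"
    using eval.DotE[OF eval_NulE[OF refl] eval_NulE[OF refl]]
    by (intro exI[of _ "2 + 2 + 1 + dsize (Dot Nul Nul)"] conjI) (simp, simp only: encode_True refl)
  show "\<exists>s\<le>8 + dsize (Dot y z). eval [Case (Var 0) (DotE NulE NulE) NulE] [y, z, Dot y z] NulE
      (encode (Dot y z = Nul)) s" for y z
    by (rule exI[of _ 2]) (auto intro!: eval_NulE)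
qed

section \<open>Structural recursion\<close>

text \<open>The bound \<open>D\<close> on the values is not required to be polynomial, so that the lemma also serves for
  quasipolynomial time.\<close>

definition recursion_bounds ::
  "('a::enc \<Rightarrow> 'a list) \<Rightarrow> ('a \<Rightarrow> 'b::enc) \<Rightarrow> ('a \<Rightarrow> nat) \<Rightarrow> nat \<Rightarrow> nat \<Rightarrow> 'a set \<Rightarrow> bool" where
  "recursion_bounds subs h m N D X \<longleftrightarrow> (\<forall>x \<in> X. set (subs x) \<subseteq> X \<and>
     sum_list (map m (subs x)) < m x \<and> sz x \<le> N \<and> sz (h x) \<le> D)"

text \<open>Function 0 evaluates \<open>h\<close> at one argument, function 1 maps function 0 over a
  list. As the measure of an argument exceeds the sum of the measures of its subarguments, it bounds
  the number of calls of function 0; every call costs a polynomial in the sizes of arguments and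
  values. One program serves all measures and bounds, since these do not enter its
  construction.\<close>

lemma recursion_time:
  fixes subs :: "'a::enc \<Rightarrow> 'a list" and step :: "'a \<times> 'b::enc list \<Rightarrow> 'b"
  assumes "ptime subs" "ptime step" and h: "\<And>x. h x = step (x, map h (subs x))"
  obtains Q b where "Q \<noteq> []" "poly_bd b"
    "\<forall>m N D X. recursion_bounds subs h m N D X \<longrightarrow>
      (\<forall>x \<in> X. \<exists>t. eval Q [encode x] (Q ! 0) (encode (h x)) t \<and> t \<le> m x * b (N + D))"
proof -
  from assms obtain P1 b1 P2 b2 where b: "poly_bd b1" "poly_bd b2"
    and P: "computes P1 b1 subs" "computes P2 b2 step"
    by (auto simp: ptime_def)
  let ?F = "\<lambda>k1 k2 k3::nat. Call k2 (DotE (Var 0) (Call 1 (Call k1 (Var 0))))"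
  let ?G = "\<lambda>k1 k2 k3::nat. Case (Var 0) NulE (DotE (Call 0 (Var 0)) (Call 1 (Var 1)))"
  obtain Q k1 k2 k3 where Q: "embedded Q k1 P1" "embedded Q k2 P2" "embedded Q k3 P2"
    "1 < length Q" "Q ! 0 = ?F k1 k2 k3" "Q ! 1 = ?G k1 k2 k3"
    by (rule link[where F = ?F and G = ?G])
  \<comment> \<open>\<open>Z\<close> bounds the list of recursive results, \<open>U\<close> one
    round of the loop over the list, and \<open>B\<close> one call without its recursive
    calls.\<close>
  define Z where "Z n = Suc (b1 n * Suc n)" for n
  define U where "U n = 7 + (b1 n + b1 n + b1 n) + (Z n + Z n + Z n + Z n)" for n
  define B where "B n = 8 + (n + n + n) + (b1 n + b1 n) + Suc (b1 n) * U n + (Z n + Z n)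
    + (b2 (Suc (n + Z n)) + b2 (Suc (n + Z n)))" for n
  have Z: "poly_bd Z" unfolding Z_def by (intro poly_bd_intros b)
  have U: "poly_bd U" unfolding U_def by (intro poly_bd_intros b Z)
  have B: "poly_bd B" unfolding B_def
    by (intro poly_bd_intros b Z U poly_bd_comp[OF b(2)])
  have main: "\<exists>t. eval Q [encode x] (Q ! 0) (encode (h x)) t \<and> t \<le> m x * B (N + D)"
    if "recursion_bounds subs h m N D X" and "x \<in> X" for X m N D x
    using \<open>x \<in> X\<close>
  proof (induction "m x" arbitrary: x rule: less_induct)
    case less
    define n where "n = N + D"
    have X: "set (subs x) \<subseteq> X \<and> sum_list (map m (subs x)) < m x \<and> sz x \<le> n \<and> sz (h x) \<le> n"
      if "x \<in> X" for x
      using \<open>recursion_bounds subs h m N D X\<close> that by (auto simp: n_def recursion_bounds_def)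
    have Xx: "set (subs x) \<subseteq> X" "sum_list (map m (subs x)) < m x" "sz x \<le> n" "sz (h x) \<le> n"
      using X[OF less.prems] by auto
    \<comment> \<open>\<open>Suc (length ys)\<close> counts the final round at the empty list
      too.\<close>
    have list: "\<exists>t. eval Q [encode ys] (Q ! 1) (encode (map h ys)) t \<and>
        t \<le> sum_list (map m ys) * B n + Suc (length ys) * U n"
      if "\<And>y. y \<in> set ys \<Longrightarrow> \<exists>t. eval Q [encode y] (Q ! 0) (encode (h y)) t \<and> t \<le> m y * B n"
        "sz ys \<le> b1 n" "sz (map h ys) \<le> Z n" for ys
      using that
    proof (induction ys)
      case Nil
      have "eval Q [encode ([]::'a list)] (Var 0) Nul 2"
        using eval_Var[of 0 "[Nul]" Nul Q] by (simp add: numeral_2_eq_2)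
      from eval.Case_Nul[OF this eval_NulE[OF refl]]
      have "eval Q [encode ([]::'a list)] (Q ! 1) (encode (map h [])) 6"
        unfolding Q by simp
      then show ?case
        by (intro exI[of _ 6] conjI) (assumption, simp add: U_def)
    next
      case (Cons y ys)
      let ?\<rho> = "[encode y, encode ys, encode (y # ys)]"
      have "\<exists>t. eval Q [encode ys] (Q ! 1) (encode (map h ys)) t \<and>
          t \<le> sum_list (map m ys) * B n + Suc (length ys) * U n"
        using Cons.prems by (intro Cons.IH) auto
      then obtain t where t: "eval Q [encode ys] (Q ! 1) (encode (map h ys)) t"
        "t \<le> sum_list (map m ys) * B n + Suc (length ys) * U n" by blast
      from Cons.prems(1) obtain s where s: "eval Q [encode y] (Q ! 0) (encode (h y)) s" "s \<le> m y * B n"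
        by auto
      have 1: "eval Q ?\<rho> (Call 0 (Var 0)) (encode (h y)) ((1 + sz y) + s + 1 + sz (h y))"
        unfolding sz_def by (intro eval.Call[OF _ _ s(1)] eval_Var) (use Q(4) in auto)
      have 2: "eval Q ?\<rho> (Call 1 (Var 1)) (encode (map h ys)) ((1 + sz ys) + t + 1 + sz (map h ys))"
        unfolding sz_def by (intro eval.Call[OF _ _ t(1)] eval_Var) (use Q(4) in auto)
      have "eval Q [Dot (encode y) (encode ys)] (Var 0) (Dot (encode y) (encode ys)) (1 + sz (y # ys))"
        unfolding sz_def encode_Cons by (rule eval_Var) auto
      from eval.Case_Dot[OF this eval.DotE[OF 1 2, unfolded encode_Cons], of NulE]
      have "eval Q [encode (y # ys)] (Q ! 1) (encode (map h (y # ys)))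
        (1 + sz (y # ys) + (((1 + sz y) + s + 1 + sz (h y)) + ((1 + sz ys) + t + 1 + sz (map h ys)) + 1
          + sz (map h (y # ys))) + 1 + sz (map h (y # ys)))"
        unfolding Q sz_def list.map encode_Cons .
      moreover have "1 + sz (y # ys) + (((1 + sz y) + s + 1 + sz (h y)) + ((1 + sz ys) + t + 1 + sz (map h ys)) + 1
          + sz (map h (y # ys))) + 1 + sz (map h (y # ys)) \<le> s + t + U n"
        using Cons.prems(2,3) by (simp add: U_def)
      moreover have "s + t + U n \<le> sum_list (map m (y # ys)) * B n + Suc (length (y # ys)) * U n"
        using s(2) t(2) by (simp add: algebra_simps)
      ultimately show ?case by (meson le_trans)
    qed
    obtain t1 where t1: "eval Q [encode x] (Call k1 (Var 0)) (encode (subs x)) t1"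
      "t1 \<le> 1 + sz x + 1 + (b1 (sz x) + b1 (sz x))" "sz (subs x) \<le> b1 (sz x)"
      by (rule computes_call[OF P(1) Q(1) eval_arg])
    have b1: "b1 (sz x) \<le> b1 n"
      by (rule poly_bd_mono[OF b(1) Xx(3)])
    have len: "length (subs x) \<le> b1 n"
      using length_less_sz[of "subs x"] t1(3) b1 by linarith
    have "sz (map h (subs x)) \<le> Suc (length (map h (subs x)) * Suc n)"
    proof (rule sz_le_length)
      fix z assume "z \<in> set (map h (subs x))"
      then show "sz z \<le> n" using X Xx(1) by auto
    qed
    moreover have "length (subs x) * Suc n \<le> b1 n * Suc n"
      using len by (rule mult_le_mono1)
    ultimately have szm: "sz (map h (subs x)) \<le> Z n"
      unfolding Z_def length_map by linarith
    have IH: "\<exists>t. eval Q [encode y] (Q ! 0) (encode (h y)) t \<and> t \<le> m y * B n" if "y \<in> set (subs x)" for y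
    proof -
      have "m y \<le> sum_list (map m (subs x))"
        using that by (simp add: member_le_sum_list)
      then show ?thesis
        using less.hyps[of y] that Xx unfolding n_def by auto
    qed
    obtain t2 where t2: "eval Q [encode (subs x)] (Q ! 1) (encode (map h (subs x))) t2"
      "t2 \<le> sum_list (map m (subs x)) * B n + Suc (length (subs x)) * U n"
      using list[OF IH _ szm] t1(3) b1 by auto
    have "eval Q [encode x] (Call 1 (Call k1 (Var 0))) (encode (map h (subs x)))
        (t1 + t2 + 1 + sz (map h (subs x)))"
      unfolding sz_def by (rule eval.Call[OF Q(4) t1(1) t2(1)])
    from eval.DotE[OF eval_arg this]
    have t3: "eval Q [encode x] (DotE (Var 0) (Call 1 (Call k1 (Var 0)))) (encode (x, map h (subs x)))
        ((1 + sz x) + (t1 + t2 + 1 + sz (map h (subs x))) + 1 + sz (x, map h (subs x)))"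
      unfolding sz_def encode_Pair .
    obtain t where t: "eval Q [encode x] (Q ! 0) (encode (step (x, map h (subs x)))) t"
      "t \<le> ((1 + sz x) + (t1 + t2 + 1 + sz (map h (subs x))) + 1 + sz (x, map h (subs x))) + 1
        + (b2 (sz (x, map h (subs x))) + b2 (sz (x, map h (subs x))))"
      unfolding Q by (rule computes_call[OF P(2) Q(2) t3])
    have "b2 (sz (x, map h (subs x))) \<le> b2 (Suc (n + Z n))"
      using Xx(3) szm by (intro poly_bd_mono[OF b(2)]) simp
    moreover have "Suc (length (subs x)) * U n \<le> Suc (b1 n) * U n"
      using len by (intro mult_le_mono1) simp
    ultimately have "t \<le> sum_list (map m (subs x)) * B n + B n"
      using t(2) t1(2) t2(2) szm b1 Xx(3) unfolding B_def[of n] sz_simps by linarith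
    also have "\<dots> = Suc (sum_list (map m (subs x))) * B n" by simp
    also have "\<dots> \<le> m x * B n"
      using Xx(2) by (intro mult_le_mono1) simp
    finally show ?case
      using t(1) h[of x] unfolding n_def by auto
  qed
  show thesis
  proof (rule that)
    show "Q \<noteq> []" using Q(4) by auto
  qed (use B main in auto)
qed

text \<open>With additive growth each call contributes at most \<open>q\<close> of the size of the
  original input to the result, so values stay below the number of calls times \<open>q\<close>.
  Mere polynomial growth per call would not do: repeated doubling is exponential.\<close>

lemma ptime_recursion:
  fixes subs :: "'a::enc \<Rightarrow> 'a list" and step :: "'a \<times> 'b::enc list \<Rightarrow> 'b"
  assumes "ptime subs" "ptime step" and h: "\<And>x. h x = step (x, map h (subs x))"
    and m: "\<And>x. sum_list (map m (subs x)) < m x" "\<And>x. m x \<le> sz x"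
    and subs_sz: "\<And>x y. y \<in> set (subs x) \<Longrightarrow> sz y \<le> sz x"
    and q: "poly_bd q"
    and size: "\<And>x. sz (h x) \<le> sum_list (map (sz \<circ> h) (subs x)) + q (sz x)"
  shows "ptime h"
proof -
  obtain Q b where Q: "Q \<noteq> []" "poly_bd b"
    "\<forall>m N D X. recursion_bounds subs h m N D X \<longrightarrow>
      (\<forall>x \<in> X. \<exists>t. eval Q [encode x] (Q ! 0) (encode (h x)) t \<and> t \<le> m x * b (N + D))"
    by (rule recursion_time[OF assms(1,2) h])
  have sz: "sz (h x) \<le> m x * q N" if "sz x \<le> N" for x :: 'a and N
    using that
  proof (induction "m x" arbitrary: x rule: less_induct)
    case less
    have "sz (h y) \<le> m y * q N" if "y \<in> set (subs x)" for y :: 'a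
    proof (rule less.hyps)
      have "m y \<le> sum_list (map m (subs x))"
        using that by (simp add: member_le_sum_list)
      then show "m y < m x" using m(1)[of x] by simp
      show "sz y \<le> N" using subs_sz[OF that] less.prems by simp
    qed
    then have "sum_list (map (sz \<circ> h) (subs x)) \<le> sum_list (map (\<lambda>y. m y * q N) (subs x))"
      by (intro sum_list_mono) simp
    also have "\<dots> = sum_list (map m (subs x)) * q N"
      by (rule sum_list_mult_const)
    finally have "sz (h x) \<le> sum_list (map m (subs x)) * q N + q N"
      using size[of x] poly_bd_mono[OF q less.prems] by linarith
    also have "\<dots> = Suc (sum_list (map m (subs x))) * q N" by simp
    also have "\<dots> \<le> m x * q N"
      using m(1) by (intro mult_le_mono1) (simp add: Suc_le_eq)
    finally show ?case .
  qed
  have "computes Q (\<lambda>n. n * b (n + n * q n)) h"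
    unfolding computes_def
  proof (intro conjI allI)
    fix x :: 'a
    \<comment> \<open>Subarguments are not larger than the argument, so all values up to this size
      form a closed set.\<close>
    have "recursion_bounds subs h m (sz x) (sz x * q (sz x)) {y. sz y \<le> sz x}"
      unfolding recursion_bounds_def
    proof
      fix y :: 'a assume "y \<in> {y. sz y \<le> sz x}"
      then have y: "sz y \<le> sz x" by simp
      have "sz (h y) \<le> m y * q (sz x)" using sz[OF y] .
      also have "\<dots> \<le> sz x * q (sz x)"
        using m(2)[of y] y by (intro mult_le_mono1) simp
      finally show "set (subs y) \<subseteq> {y. sz y \<le> sz x} \<and> sum_list (map m (subs y)) < m y \<and>
          sz y \<le> sz x \<and> sz (h y) \<le> sz x * q (sz x)"
        using y m(1) subs_sz[of _ y] by (auto intro: le_trans)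
    qed
    then have "\<exists>t. eval Q [encode x] (Q ! 0) (encode (h x)) t \<and> t \<le> m x * b (sz x + sz x * q (sz x))"
      using Q(3) by blast
    then show "\<exists>t. eval Q [encode x] (Q ! 0) (encode (h x)) t \<and> t \<le> sz x * b (sz x + sz x * q (sz x))"
      using m(2)[of x] by (meson le_trans mult_le_mono1)
  qed (fact Q(1))
  moreover have "poly_bd (\<lambda>n. n * b (n + n * q n))"
    by (intro poly_bd_intros q poly_bd_comp[OF Q(2)])
  ultimately show ?thesis by (rule ptimeI[rotated])
qed

section \<open>Pairs, lists and equality\<close>

lemma ptime_Pair [ptime_intros]: "ptime f \<Longrightarrow> ptime g \<Longrightarrow> ptime (\<lambda>x. (f x, g x))"
  by (erule (1) ptime_Dot) simp

lemma ptime_Cons [ptime_intros]: "ptime f \<Longrightarrow> ptime g \<Longrightarrow> ptime (\<lambda>x. f x # g x)"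
  by (erule (1) ptime_Dot) simp

lemma ptime_Dot_data [ptime_intros]: "ptime f \<Longrightarrow> ptime g \<Longrightarrow> ptime (\<lambda>x. Dot (f x) (g x))"
  by (erule (1) ptime_Dot) simp

lemma ptime_encode: "ptime f \<Longrightarrow> ptime (\<lambda>x. encode (f x))"
  by (erule ptime_cong) simp

lemma ptime_car_comp [ptime_intros]: "ptime f \<Longrightarrow> ptime (\<lambda>x. car (f x))"
  and ptime_cdr_comp [ptime_intros]: "ptime f \<Longrightarrow> ptime (\<lambda>x. cdr (f x))"
  and ptime_is_Nul_comp [ptime_intros]: "ptime f \<Longrightarrow> ptime (\<lambda>x. f x = Nul)"
  by (erule ptime_comp, rule ptime_car ptime_cdr ptime_is_Nul)+

text \<open>Lets selectors be programmed with \<open>car\<close> and \<open>cdr\<close> on the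
  encoding.\<close>

lemma ptime_via_data:
  assumes "ptime F" "\<And>x. encode (f x) = encode (F (encode x))" "ptime g"
  shows "ptime (\<lambda>x. f (g x))"
proof -
  have "ptime (\<lambda>x. F (encode (g x)))"
    by (intro ptime_comp[OF _ assms(1)] ptime_encode assms(3))
  then show ?thesis
    by (rule ptime_cong) (simp add: assms(2))
qed

lemma ptime_fst [ptime_intros]: "ptime f \<Longrightarrow> ptime (\<lambda>x. fst (f x))"
  by (erule ptime_via_data[OF ptime_car, rotated]) (simp add: encode_prod_def)

lemma ptime_snd [ptime_intros]: "ptime f \<Longrightarrow> ptime (\<lambda>x. snd (f x))"
  by (erule ptime_via_data[OF ptime_cdr, rotated]) (simp add: encode_prod_def)

lemma ptime_null [ptime_intros]: "ptime f \<Longrightarrow> ptime (\<lambda>x. f x = [])"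
proof (erule ptime_via_data[OF ptime_is_Nul, rotated])
  show "encode (xs = []) = encode (encode xs = Nul)" for xs :: "'b list"
    by (cases xs) auto
qed

lemma ptime_tl [ptime_intros]: "ptime f \<Longrightarrow> ptime (\<lambda>x. tl (f x))"
proof (erule ptime_via_data[OF ptime_cdr, rotated])
  show "encode (tl xs) = encode (cdr (encode xs))" for xs :: "'b list"
    by (cases xs) auto
qed

lemma ptime_hd [ptime_intros]:
  fixes f :: "'a::enc \<Rightarrow> 'b::enc list"
  shows "ptime f \<Longrightarrow> ptime (\<lambda>x. hd (f x))"
proof (erule ptime_via_data[rotated 2])
  \<comment> \<open>The value \<open>hd []\<close> is unspecified but fixed, so its encoding is a
    constant of the program.\<close>
  show "ptime (\<lambda>d. if d = Nul then encode (hd ([]::'b list)) else car d)"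
    by (intro ptime_intros)
  show "encode (hd xs) = encode (if encode xs = Nul then encode (hd ([]::'b list)) else car (encode xs))"
    for xs :: "'b list"
    by (cases xs) auto
qed

lemma ptime_Not [ptime_intros]: "ptime f \<Longrightarrow> ptime (\<lambda>x. \<not> f x)"
  by (rule ptime_cong[of "\<lambda>x. if f x then False else True"], intro ptime_intros) auto

lemma ptime_conj [ptime_intros]: "ptime f \<Longrightarrow> ptime g \<Longrightarrow> ptime (\<lambda>x. f x \<and> g x)"
  by (rule ptime_cong[of "\<lambda>x. if f x then g x else False"], intro ptime_intros) auto

text \<open>Primitive recursion along a list with a fixed parameter \<open>p\<close>. The growth
  allowance of the general recursion is \<open>q\<close> increased by a bound for
  \<open>base\<close>, which is used once, at the empty list.\<close>

lemma ptime_list_rec: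
  fixes h :: "'p::enc \<times> 'c::enc list \<Rightarrow> 'b::enc"
  assumes base: "ptime base" and step: "ptime step"
    and h: "\<And>p. h (p, []) = base p" "\<And>p x xs. h (p, x # xs) = step (p, x, xs, h (p, xs))"
    and q: "poly_bd q" "\<And>p x xs. sz (h (p, x # xs)) \<le> sz (h (p, xs)) + q (sz (p, x # xs))"
    and f: "ptime f" "ptime g"
  shows "ptime (\<lambda>x. h (f x, g x))"
proof (rule ptime_comp[of "\<lambda>x. (f x, g x)" h])
  obtain b where b: "poly_bd b" "\<And>p. sz (base p) \<le> b (sz p)"
    using ptime_size[OF base] by blast
  show "ptime h"
  proof (rule ptime_recursion[where m = "\<lambda>px. Suc (length (snd px))" and q = "\<lambda>n. b n + q n"
        and subs = "\<lambda>px. if snd px = [] then [] else [(fst px, tl (snd px))]"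
        and step = "\<lambda>(px, rs). if snd px = [] then base (fst px)
          else step (fst px, hd (snd px), tl (snd px), hd rs)"])
    show "ptime (\<lambda>(px, rs). if snd px = [] then base (fst px)
          else step (fst px, hd (snd px), tl (snd px), hd rs))"
      unfolding split_beta by (intro ptime_intros ptime_comp[OF _ base] ptime_comp[OF _ step])
    show "h px = (case (px, map h (if snd px = [] then [] else [(fst px, tl (snd px))])) of
        (px, rs) \<Rightarrow> if snd px = [] then base (fst px)
          else step (fst px, hd (snd px), tl (snd px), hd rs))" for px
      by (cases px; cases "snd px") (auto simp: h)
    show "poly_bd (\<lambda>n. b n + q n)" by (intro poly_bd_intros b q)
    show "sz (h px) \<le> sum_list (map (sz \<circ> h) (if snd px = [] then [] else [(fst px, tl (snd px))])) +
        (b (sz px) + q (sz px))" for px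
    proof (cases px)
      case (Pair p xs)
      show ?thesis
      proof (cases xs)
        case Nil
        have "sz (base p) \<le> b (sz px)"
          using b(2)[of p] poly_bd_mono[OF b(1), of "sz p" "sz px"] Pair by simp
        then show ?thesis using Pair Nil h by simp
      next
        case (Cons y ys)
        then show ?thesis using q(2)[of p y ys] Pair by simp
      qed
    qed
    show "Suc (length (snd px)) \<le> sz px" for px :: "'p \<times> 'c list"
      using length_less_sz[of "snd px"] by (cases px) simp
    show "ptime (\<lambda>px::'p \<times> 'c list. if snd px = [] then [] else [(fst px, tl (snd px))])"
      by (intro ptime_intros)
    show "sum_list (map (\<lambda>px. Suc (length (snd px))) (if snd px = [] then [] else [(fst px, tl (snd px))]))
        < Suc (length (snd px))" for px :: "'p \<times> 'c list"
      by (cases "snd px") auto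
    show "y \<in> set (if snd px = [] then [] else [(fst px, tl (snd px))]) \<Longrightarrow> sz y \<le> sz px"
      for px y :: "'p \<times> 'c list"
      by (cases px; cases "snd px") (auto split: if_splits)
  qed
qed (intro ptime_intros f)

lemma ptime_append [ptime_intros]:
  assumes "ptime f" "ptime g"
  shows "ptime (\<lambda>x. f x @ g x)"
proof -
  have "ptime (\<lambda>x. (\<lambda>(ys, xs). xs @ ys) (g x, f x))"
    by (rule ptime_list_rec[where base = "\<lambda>ys. ys" and step = "\<lambda>(ys, x, xs, r). x # r" and q = "\<lambda>n. n"])
       (unfold split_beta, auto intro!: ptime_intros poly_bd_intros assms)
  then show ?thesis by simp
qed

lemma ptime_concat [ptime_intros]:
  assumes "ptime f"
  shows "ptime (\<lambda>x. concat (f x))"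
proof -
  have "ptime (\<lambda>x. (\<lambda>(u, xss). concat xss) ((), f x))"
  proof (rule ptime_list_rec[where base = "\<lambda>u. []" and step = "\<lambda>(ys, x, xs, r). x @ r" and q = "\<lambda>n. n"])
    show "sz (case (p, xs # xss) of (u, xss) \<Rightarrow> concat xss) \<le>
      sz (case (p, xss) of (u, xss) \<Rightarrow> concat xss) + sz (p, xs # xss)" for p :: unit and xs :: "'b list" and xss
      using sz_append[of xs "concat xss"] by simp
  qed (unfold split_beta, auto intro!: ptime_intros poly_bd_intros assms)
  then show ?thesis by simp
qed

text \<open>The mapped function may depend on the outer argument, which becomes the parameter of the
  list recursion. Bodies with free variables below nested \<open>map\<close>s are covered in this
  way.\<close>

lemma ptime_map [ptime_intros]:
  fixes f :: "'a::enc \<Rightarrow> 'b::enc \<Rightarrow> 'c::enc"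
  assumes "ptime g" "ptime (\<lambda>p. f (fst p) (snd p))"
  shows "ptime (\<lambda>x. map (f x) (g x))"
proof -
  obtain b where b: "poly_bd b" "\<And>p. sz (f (fst p) (snd p)) \<le> b (sz p)"
    using ptime_size[OF assms(2)] by blast
  have arg: "ptime (\<lambda>p::'a \<times> 'b \<times> 'b list \<times> 'c list. f (fst p) (fst (snd p)))"
    by (rule ptime_comp[OF _ assms(2), of "\<lambda>p. (fst p, fst (snd p))", unfolded fst_conv snd_conv])
       (intro ptime_intros)
  have "ptime (\<lambda>x. (\<lambda>(y, xs). map (f y) xs) (x, g x))"
  proof (rule ptime_list_rec[where base = "\<lambda>u. []" and step = "\<lambda>(y, x, xs, r). f y x # r"
        and q = "\<lambda>n. Suc (b n)"])
    show "ptime (\<lambda>(y, x, xs :: 'b list, r). f y x # r)"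
      unfolding split_beta by (intro ptime_intros arg)
    show "sz (case (p, x # xs) of (y, xs) \<Rightarrow> map (f y) xs) \<le>
      sz (case (p, xs) of (y, xs) \<Rightarrow> map (f y) xs) + Suc (b (sz (p, x # xs)))" for p x xs
      using b(2)[of "(p, x)"] poly_bd_mono[OF b(1), of "sz (p, x)" "sz (p, x # xs)"] by simp
  qed (auto intro!: ptime_intros poly_bd_intros assms b)
  then show ?thesis by simp
qed

lemma ptime_filter [ptime_intros]:
  fixes f :: "'a::enc \<Rightarrow> 'b::enc \<Rightarrow> bool"
  assumes "ptime g" "ptime (\<lambda>p. f (fst p) (snd p))"
  shows "ptime (\<lambda>x. filter (f x) (g x))"
proof -
  have arg: "ptime (\<lambda>p::'a \<times> 'b \<times> 'b list \<times> 'b list. f (fst p) (fst (snd p)))"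
    by (rule ptime_comp[OF _ assms(2), of "\<lambda>p. (fst p, fst (snd p))", unfolded fst_conv snd_conv])
       (intro ptime_intros)
  have "ptime (\<lambda>x. (\<lambda>(y, xs). filter (f y) xs) (x, g x))"
  proof (rule ptime_list_rec[where base = "\<lambda>u. []" and step = "\<lambda>(y, x, xs, r). if f y x then x # r else r"
        and q = "\<lambda>n. n"])
    show "ptime (\<lambda>(y, x, xs :: 'b list, r). if f y x then x # r else r)"
      unfolding split_beta by (intro ptime_intros arg)
  qed (auto intro!: ptime_intros poly_bd_intros assms)
  then show ?thesis by simp
qed

section \<open>Equality of values, by simultaneous descent into two trees\<close>

lemma ptime_data_eq: "ptime (\<lambda>(u::data, v::data). u = v)"
proof (rule ptime_recursion[where m = "\<lambda>(u::data, v::data). dsize u" and q = "\<lambda>n. 3"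
      and subs = "\<lambda>(u, v). if u = Nul then [] else if v = Nul then [] else [(car u, car v), (cdr u, cdr v)]"
      and step = "\<lambda>((u, v), rs). if u = Nul then v = Nul else if v = Nul then False else hd rs \<and> hd (tl rs)"])
  fix p :: "data \<times> data"
  obtain u v where p: "p = (u, v)" by force
  show "(case p of (u, v) \<Rightarrow> u = v) =
    (\<lambda>((u, v), rs). if u = Nul then v = Nul else if v = Nul then False else hd rs \<and> hd (tl rs))
      (p, map (\<lambda>(u, v). u = v) (case p of (u, v) \<Rightarrow>
        if u = Nul then [] else if v = Nul then [] else [(car u, car v), (cdr u, cdr v)]))"
    unfolding p by (cases u; cases v) auto
  show "sum_list (map (\<lambda>(u, v::data). dsize u) (case p of (u, v) \<Rightarrow>
      if u = Nul then [] else if v = Nul then [] else [(car u, car v), (cdr u, cdr v)]))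
    < (case p of (u, v) \<Rightarrow> dsize u)"
    unfolding p by (cases u; cases v) auto
  show "(case p of (u, v) \<Rightarrow> dsize u) \<le> sz p"
    unfolding p by (simp add: sz_def)
  show "sz (case p of (u, v) \<Rightarrow> u = v) \<le> sum_list (map (sz \<circ> (\<lambda>(u, v). u = v)) (case p of (u, v) \<Rightarrow>
      if u = Nul then [] else if v = Nul then [] else [(car u, car v), (cdr u, cdr v)])) + 3"
    using sz_bool le_add2 le_trans by blast
  fix r assume "r \<in> set (case p of (u, v) \<Rightarrow>
      if u = Nul then [] else if v = Nul then [] else [(car u, car v), (cdr u, cdr v)])"
  then show "sz r \<le> sz p"
    unfolding p by (cases u; cases v) (auto simp: sz_def)
next
  show "ptime (\<lambda>(u, v). if u = Nul then [] else if v = Nul then [] else [(car u, car v), (cdr u, cdr v)])"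
    unfolding split_beta by (intro ptime_intros)
  show "ptime (\<lambda>((u, v), rs). if u = Nul then v = Nul else if v = Nul then False else hd rs \<and> hd (tl rs))"
    unfolding split_beta by (intro ptime_intros)
qed (intro poly_bd_intros)

lemma ptime_eq:
  fixes f :: "'a::enc \<Rightarrow> 'b::enc"
  assumes "inj (encode :: 'b \<Rightarrow> data)" "ptime f" "ptime g"
  shows "ptime (\<lambda>x. f x = g x)"
proof -
  have "ptime (\<lambda>x. (\<lambda>(u, v). u = v) (encode (f x), encode (g x)))"
    by (intro ptime_comp[OF _ ptime_data_eq] ptime_intros ptime_encode assms)
  then show ?thesis
    using assms(1) by (simp add: inj_eq)
qed

lemma inj_encode_unit: "inj (encode :: unit \<Rightarrow> data)"
  by (simp add: inj_def)

lemma inj_encode_bool: "inj (encode :: bool \<Rightarrow> data)"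
  by (auto simp: inj_def encode_bool_def)

lemma inj_encode_prod:
  assumes "inj (encode :: 'a::enc \<Rightarrow> data)" "inj (encode :: 'b::enc \<Rightarrow> data)"
  shows "inj (encode :: 'a \<times> 'b \<Rightarrow> data)"
  using assms by (auto simp: inj_def)

lemma inj_encode_list:
  assumes "inj (encode :: 'a::enc \<Rightarrow> data)"
  shows "inj (encode :: 'a list \<Rightarrow> data)"
  using assms by (auto simp: inj_def encode_list_def inj_map_eq_map)

section \<open>Binary numbers and lengths of lists\<close>

lemma enc_nat_0 [simp]: "enc_nat 0 = Nul"
  by (simp add: enc_nat.simps)

text \<open>Binary increment with the lowest digit first: an even number changes this digit, an odd
  one sets it to 0 and passes the carry on to \<open>n div 2\<close>.\<close>

lemma ptime_Suc [ptime_intros]: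
  assumes "ptime f"
  shows "ptime (\<lambda>x. Suc (f x))"
proof (rule ptime_comp[OF assms])
  have half: "ptime (\<lambda>n::nat. n div 2)"
  proof (rule ptime_via_data[OF ptime_cdr, where g = "\<lambda>n. n"])
    show "encode (n div 2) = encode (cdr (encode n))" for n :: nat
      by (cases "n = 0") (simp_all add: encode_nat_def enc_nat.simps[of n])
  qed (intro ptime_intros)
  have zero: "ptime (\<lambda>n::nat. n = 0)"
  proof (rule ptime_via_data[OF ptime_is_Nul, where g = "\<lambda>n. n"])
    show "encode (n = 0) = encode (encode n = Nul)" for n :: nat
      by (cases "n = 0") (simp_all add: encode_nat_def enc_nat.simps[of n])
  qed (intro ptime_intros)
  have even: "ptime (\<lambda>n::nat. even n)"
  proof (rule ptime_via_data[where F = "\<lambda>d. car d = Nul" and g = "\<lambda>n. n"])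
    show "encode (even n) = encode (car (encode n) = Nul)" for n :: nat
      by (simp add: encode_nat_def enc_nat.simps[of n])
  qed (intro ptime_intros)+
  show "ptime Suc"
  proof (rule ptime_recursion[where m = "\<lambda>n. sz n" and q = "\<lambda>n. n + 5"
        and subs = "\<lambda>n. if even n then [] else [n div 2]"
        and step = "\<lambda>(n, rs). if n = 0 then 1 else if even n then Suc n else 2 * hd rs"])
    have dbl: "sz (2 * Suc n) = sz (Suc n) + 2" for n
      by (simp add: sz_def encode_nat_def enc_nat.simps[of "Suc (Suc (2 * n))"])
    have odd: "sz (n div 2) < sz n" if "odd n" for n :: nat
      using that by (cases "n = 0") (simp_all add: sz_def encode_nat_def enc_nat.simps[of n])
    have sz_Suc: "sz (Suc n) = sz n + 2" if "even n" "n \<noteq> 0" for n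
      using that by (simp add: sz_def encode_nat_def enc_nat.simps[of n] enc_nat.simps[of "Suc n"])
    show "ptime (\<lambda>n::nat. if even n then [] else [n div 2])"
      by (intro ptime_intros half even)
    fix n :: nat
    have n: "Suc n = 2 * Suc (n div 2)" if "odd n"
      using that by presburger
    show "Suc n = (case (n, map Suc (if even n then [] else [n div 2])) of
        (n, rs) \<Rightarrow> if n = 0 then 1 else if even n then Suc n else 2 * hd rs)"
      by (cases "n = 0") auto
    show "sum_list (map sz (if even n then [] else [n div 2])) < sz n"
      using odd[of n] sz_pos[of n] by simp
    show "sz n \<le> sz n" ..
    show "sz y \<le> sz n" if "y \<in> set (if even n then [] else [n div 2])" for y
      using that odd[of n] by (auto split: if_splits)
    show "sz (Suc n) \<le> sum_list (map (sz \<circ> Suc) (if even n then [] else [n div 2])) + (sz n + 5)"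
    proof (cases "even n")
      case True
      then show ?thesis
        using sz_Suc[of n] by (cases "n = 0") (auto simp: sz_def encode_nat_def enc_nat.simps[of "Suc 0"])
    next
      case False
      have "sz (Suc n) = sz (Suc (n div 2)) + 2"
        unfolding n[OF False] by (rule dbl)
      with False show ?thesis by simp
    qed
  next
    have dbl: "ptime (\<lambda>n::nat. 2 * n)"
    proof (rule ptime_via_data[where F = "\<lambda>d. if d = Nul then Nul else Dot Nul d" and g = "\<lambda>n. n"])
      show "encode (2 * n) = encode (if encode n = Nul then Nul else Dot Nul (encode n))" for n :: nat
        by (cases "n = 0") (auto simp: encode_nat_def enc_nat.simps[of n] enc_nat.simps[of "2 * n"])
    qed (intro ptime_intros)+
    have Suc_even: "ptime (\<lambda>n. if even n then Suc n else 0)"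
    proof (rule ptime_via_data[where F = "\<lambda>d. if car d = Nul then Dot (Dot Nul Nul) (cdr d) else Nul"
          and g = "\<lambda>n. n"])
      show "encode (if even n then Suc n else 0) =
          encode (if car (encode n) = Nul then Dot (Dot Nul Nul) (cdr (encode n)) else Nul)" for n :: nat
        by (cases "n = 0")
           (simp_all add: encode_nat_def enc_nat.simps[of n] enc_nat.simps[of "Suc 0"] enc_nat.simps[of "Suc n"])
    qed (intro ptime_intros)+
    \<comment> \<open>The step applies \<open>Suc\<close> to even numbers only, where it rewrites a
      single digit; the inner test makes this visible and avoids a circular appeal to
      \<open>Suc\<close>.\<close>
    have "ptime (\<lambda>p::nat \<times> nat list. if fst p = 0 then 1 else if even (fst p)
        then (if even (fst p) then Suc (fst p) else 0) else 2 * hd (snd p))"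
      by (intro ptime_intros ptime_comp[OF _ zero] ptime_comp[OF _ even] ptime_comp[OF _ dbl]
          ptime_comp[OF _ Suc_even])
    then show "ptime (\<lambda>(n::nat, rs). if n = 0 then 1 else if even n then Suc n else 2 * hd rs)"
      unfolding split_beta by (rule ptime_cong) simp
  qed (intro poly_bd_intros)
qed

lemma sz_nat_Suc: "sz (Suc n) \<le> sz n + 4"
proof (induction n rule: less_induct)
  case (less n)
  consider "n = 0" | "n \<noteq> 0" "even n" | "odd n" by blast
  then show ?case
  proof cases
    case 1
    then show ?thesis by (simp add: sz_def encode_nat_def enc_nat.simps[of "Suc 0"])
  next
    case 2
    then show ?thesis
      by (simp add: sz_def encode_nat_def enc_nat.simps[of n] enc_nat.simps[of "Suc n"])
  next
    case 3
    then have "sz (Suc (n div 2)) \<le> sz (n div 2) + 4"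
      by (intro less) (cases n; simp)
    with 3 show ?thesis
      by (auto simp: sz_def encode_nat_def enc_nat.simps[of n] enc_nat.simps[of "Suc n"])
  qed
qed

lemma ptime_length [ptime_intros]:
  assumes "ptime f"
  shows "ptime (\<lambda>x. length (f x))"
proof -
  have "ptime (\<lambda>x. (\<lambda>(u, xs). length xs) ((), f x))"
    by (rule ptime_list_rec[where base = "\<lambda>u. 0" and step = "\<lambda>(ys, x, xs, r). Suc r" and q = "\<lambda>n. 4"])
       (unfold split_beta, auto intro!: ptime_intros poly_bd_intros assms sz_nat_Suc)
  then show ?thesis by simp
qed

section \<open>Signed sequents\<close>

text \<open>A sequent is written as a list of signed formulas, those with sign \<open>True\<close> forming the
  succedent. This merges every left rule with its dual right rule.\<close>

type_synonym sfm = "bool \<times> fm"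

definition lefts :: "sfm list \<Rightarrow> fm list" where
  "lefts S = map snd (filter (\<lambda>x. \<not> fst x) S)"

definition rights :: "sfm list \<Rightarrow> fm list" where
  "rights S = map snd (filter (\<lambda>x. fst x) S)"

definition seq_of :: "sfm list \<Rightarrow> fm sequent" where
  "seq_of S = (lefts S \<turnstile> rights S)"

lemma lefts_simps [simp]:
  "lefts [] = []" "lefts ((s, A) # S) = (if s then lefts S else A # lefts S)"
  "lefts (S @ S') = lefts S @ lefts S'"
  by (simp_all add: lefts_def)

lemma rights_simps [simp]:
  "rights [] = []" "rights ((s, A) # S) = (if s then A # rights S else rights S)"
  "rights (S @ S') = rights S @ rights S'"
  by (simp_all add: rights_def)

lemma seq_of_altdef: "seq_of S = (image_mset snd (filter_mset (\<lambda>x. \<not> fst x) (mset S)),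
    image_mset snd (filter_mset fst (mset S)))"
  by (simp add: seq_of_def sequent_of_def lefts_def rights_def)

lemma seq_of_cong:
  assumes "mset S = mset S'"
  shows "seq_of S = seq_of S'"
  unfolding seq_of_altdef assms ..

text \<open>In Smullyan's uniform notation, \<open>conn s\<close> is the connective of type alpha
  for sign \<open>s\<close>, with a one-premise rule, and \<open>conn (\<not> s)\<close> the one of
  type beta, with two premises.\<close>

definition conn :: "bool \<Rightarrow> fm \<Rightarrow> fm \<Rightarrow> fm" where
  "conn s A B = (if s then Or A B else And A B)"

definition weak_rule :: "sfm \<Rightarrow> sfm list \<Rightarrow> lk_rule" where
  "weak_rule x S = LKCommon (if fst x then WeakR (snd x) (lefts S) (rights S)
     else WeakL (snd x) (lefts S) (rights S))"

definition contr_rule :: "sfm \<Rightarrow> sfm list \<Rightarrow> lk_rule" where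
  "contr_rule x S = LKCommon (if fst x then ContrR (snd x) (lefts S) (rights S)
     else ContrL (snd x) (lefts S) (rights S))"

definition cut_rule :: "fm \<Rightarrow> sfm list \<Rightarrow> lk_rule" where
  "cut_rule A S = LKCommon (Cut A (lefts S) (rights S))"

definition alpha_rule :: "bool \<Rightarrow> fm \<Rightarrow> fm \<Rightarrow> sfm list \<Rightarrow> lk_rule" where
  "alpha_rule s A B S = (if s then OrR A B (lefts S) (rights S) else AndL A B (lefts S) (rights S))"

definition beta_rule :: "bool \<Rightarrow> fm \<Rightarrow> fm \<Rightarrow> sfm list \<Rightarrow> lk_rule" where
  "beta_rule s A B S = (if s then AndR A B (lefts S) (rights S) else OrL A B (lefts S) (rights S))"

lemma weak_rule: "lk_concl (weak_rule x S) = seq_of (x # S)" "lk_prems (weak_rule x S) = [seq_of S]"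
  by (cases x; simp add: weak_rule_def seq_of_def sequent_of_def)+

lemma contr_rule: "lk_concl (contr_rule x S) = seq_of (x # S)"
  "lk_prems (contr_rule x S) = [seq_of (x # x # S)]"
  by (cases x; simp add: contr_rule_def seq_of_def sequent_of_def)+

lemma cut_rule: "lk_concl (cut_rule A S) = seq_of S"
  "lk_prems (cut_rule A S) = [seq_of ((True, A) # S), seq_of ((False, A) # S)]"
  by (simp_all add: cut_rule_def seq_of_def sequent_of_def)

lemma alpha_rule: "lk_concl (alpha_rule s A B S) = seq_of ((s, conn s A B) # S)"
  "lk_prems (alpha_rule s A B S) = [seq_of ((s, A) # (s, B) # S)]"
  by (simp_all add: alpha_rule_def seq_of_def sequent_of_def conn_def)

lemma beta_rule: "lk_concl (beta_rule s A B S) = seq_of ((s, conn (\<not> s) A B) # S)"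
  "lk_prems (beta_rule s A B S) = [seq_of ((s, A) # S), seq_of ((s, B) # S)]"
  by (simp_all add: beta_rule_def seq_of_def sequent_of_def conn_def)

definition depth_one_cedent :: "sfm list \<Rightarrow> bool" where
  "depth_one_cedent S \<longleftrightarrow> (\<forall>x \<in> set S. depth_one (snd x))"

lemma depth_one_cedent_simps [simp]:
  "depth_one_cedent []"
  "depth_one_cedent (x # S) \<longleftrightarrow> depth_one (snd x) \<and> depth_one_cedent S"
  "depth_one_cedent (S @ S') \<longleftrightarrow> depth_one_cedent S \<and> depth_one_cedent S'"
  by (auto simp: depth_one_cedent_def)

lemma depth_one_sequent_seq_of: "depth_one_cedent S \<Longrightarrow> depth_one_sequent (seq_of S)"
  by (auto simp: depth_one_cedent_def depth_one_sequent_def seq_of_def sequent_of_def lefts_def rights_def)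

lemma depth_one_FLit [simp]: "depth_one (FLit p)"
  by (simp add: depth_one_def)


section \<open>Derivations from hypotheses\<close>

text \<open>\<open>Hyp True S\<close> and \<open>Hyp False S\<close> stand for derivations, to be supplied, of the first and
  of the second hypothesis. Inferences are annotated with their conclusions.\<close>

datatype deriv = Hyp bool "sfm list" | Inf lk_rule "sfm list" "deriv list"

fun concl :: "deriv \<Rightarrow> sfm list" where
  "concl (Hyp b S) = S"
| "concl (Inf r S ds) = S"

text \<open>\<open>True\<close> denotes the first hypothesis. Rules are matched with sequents
  through \<open>seq_of\<close>, hence up to order, whereas \<open>concl\<close> is an exact list
  that can be tracked by equations.\<close>

fun valid :: "fm sequent list \<Rightarrow> deriv \<Rightarrow> bool" where
  "valid H (Hyp b S) \<longleftrightarrow> depth_one_cedent S \<and> (if b then 0 else 1) < length H \<and>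
     H ! (if b then 0 else 1) = seq_of S"
| "valid H (Inf r S ds) \<longleftrightarrow> depth_one_cedent S \<and> lk_concl r = seq_of S \<and>
     lk_prems r = map (\<lambda>d. seq_of (concl d)) ds \<and> (\<forall>d \<in> set ds. valid H d)"

lemma valid_depth_one: "valid H d \<Longrightarrow> depth_one_cedent (concl d)"
  by (cases d) auto

fun is_inf :: "deriv \<Rightarrow> bool" where
  "is_inf (Hyp b S) = False"
| "is_inf (Inf r S ds) = True"

text \<open>Every inference of a chain needs to know which formulas are already treated and which
  remain. Mapping over splits provides this without a special recursion, so that closure of
  polynomial time under \<open>map\<close> applies.\<close>

fun splits :: "'a list \<Rightarrow> ('a list \<times> 'a \<times> 'a list) list" where
  "splits [] = []"
| "splits (x # xs) = ([], x, xs) # map (\<lambda>p. (x # fst p, snd p)) (splits xs)"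

lemma splits_append: "(a, x, c) \<in> set (splits (a @ x # c))"
proof (induction a)
  case (Cons b a)
  then have "(\<lambda>p. (b # fst p, snd p)) (a, x, c) \<in> (\<lambda>p. (b # fst p, snd p)) ` set (splits (a @ x # c))"
    by (rule imageI)
  then show ?case by simp
qed simp

lemma splits_eqD: "p \<in> set (splits xs) \<Longrightarrow> xs = fst p @ fst (snd p) # snd (snd p)"
proof (induction xs arbitrary: p)
  case (Cons y xs)
  from Cons.prems consider "p = ([], y, xs)" | q where "q \<in> set (splits xs)" "p = (y # fst q, snd q)"
    unfolding splits.simps list.set set_map by blast
  then show ?case
  proof cases
    case 1
    then show ?thesis by simp
  next
    case 2
    with Cons.IH[OF 2(1)] show ?thesis by simp
  qed
qed simp

lemma mem_splits: "(a, x, c) \<in> set (splits xs) \<longleftrightarrow> xs = a @ x # c"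
  using splits_append splits_eqD by fastforce

text \<open>A step of a chain is a rule, its conclusion, and the derivations of the premises to the left
  and to the right of the main premise; the first step comes last in the derivation.\<close>

type_synonym step = "lk_rule \<times> sfm list \<times> deriv list \<times> deriv list"

definition chain :: "step list \<Rightarrow> deriv \<Rightarrow> deriv" where
  "chain sts d = foldr (\<lambda>st d. Inf (fst st) (fst (snd st)) (fst (snd (snd st)) @ d # snd (snd (snd st)))) sts d"

text \<open>Downwards from \<open>d\<close>, the elements of \<open>xs\<close> are treated from the last one to the first; \<open>P a c\<close> is
  the sequent that is reached when those of \<open>c\<close> are done and those of \<open>a\<close> remain.\<close>

lemma chain_splits:
  assumes "valid H d" "concl d = P xs []"
    and "\<And>a x c. xs = a @ x # c \<Longrightarrow> fst (snd (st (a, x, c))) = P a (x # c)"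
    and "\<And>a x c d'. xs = a @ x # c \<Longrightarrow> valid H d' \<Longrightarrow> concl d' = P (a @ [x]) c \<Longrightarrow>
      valid H (chain [st (a, x, c)] d')"
  shows "valid H (chain (map st (splits xs)) d) \<and> concl (chain (map st (splits xs)) d) = P [] xs"
  using assms
proof (induction xs arbitrary: P st)
  case Nil
  then show ?case by (simp add: chain_def)
next
  case (Cons x xs)
  let ?st = "\<lambda>p. st (x # fst p, snd p)"
  have IH: "valid H (chain (map ?st (splits xs)) d) \<and>
      concl (chain (map ?st (splits xs)) d) = P (x # []) xs"
  proof (rule Cons.IH)
    show "concl d = P (x # xs) []" by (rule Cons.prems)
    show "fst (snd (?st (a, y, c))) = P (x # a) (y # c)" if "xs = a @ y # c" for a y c
      using Cons.prems(3)[of "x # a" y c] that by simp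
    show "valid H (chain [?st (a, y, c)] d')"
      if "xs = a @ y # c" "valid H d'" "concl d' = P (x # a @ [y]) c" for a y c d'
      using Cons.prems(4)[of "x # a" y c d'] that by simp
  qed fact
  have eq: "chain (map st (splits (x # xs))) d = chain [st ([], x, xs)] (chain (map ?st (splits xs)) d)"
    by (simp add: chain_def comp_def)
  have "valid H (chain [st ([], x, xs)] (chain (map ?st (splits xs)) d))"
    by (rule Cons.prems(4)) (use IH in simp_all)
  moreover have "concl (chain [st ([], x, xs)] (chain (map ?st (splits xs)) d)) = P [] (x # xs)"
    using Cons.prems(3)[of "[]" x xs] by (simp add: chain_def)
  ultimately show ?case
    unfolding eq ..
qed

lemma is_inf_chain: "sts \<noteq> [] \<Longrightarrow> is_inf (chain sts d)"
  by (cases sts) (auto simp: chain_def)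

lemma splits_eq_Nil [simp]: "splits xs = [] \<longleftrightarrow> xs = []"
  by (cases xs) auto

definition structural :: "sfm list \<Rightarrow> deriv \<Rightarrow> deriv" where
  "structural S' d =
     chain (map (\<lambda>p. (contr_rule (fst (snd p)) (remove1 (fst (snd p)) (S' @ fst p)), S' @ fst p, [], []))
         (splits (concl d)))
       (chain (map (\<lambda>p. (weak_rule (fst (snd p)) (snd (snd p) @ concl d), fst (snd p) # snd (snd p) @ concl d, [], []))
         (splits S')) d)"

text \<open>All of \<open>S'\<close> is weakened in, then every formula of the old conclusion is
  contracted into a copy in \<open>S'\<close>. This is wasteful but covers reordering, weakening and
  contraction uniformly. \<open>remove1\<close> exposes the copy that the contraction rule puts in
  front.\<close>

lemma structural:
  assumes "valid H d" "set (concl d) \<subseteq> set S'" "depth_one_cedent S'"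
  shows "valid H (structural S' d) \<and> concl (structural S' d) = S'"
proof -
  let ?S = "concl d"
  have S: "depth_one_cedent ?S" using assms(1) by (rule valid_depth_one)
  let ?w = "\<lambda>p. (weak_rule (fst (snd p)) (snd (snd p) @ ?S), fst (snd p) # snd (snd p) @ ?S, [], [])"
  have weak: "valid H (chain (map ?w (splits S')) d) \<and> concl (chain (map ?w (splits S')) d) = S' @ ?S"
    using assms(3) S assms(1) by (intro chain_splits[where P = "\<lambda>a c. c @ ?S"]) (auto simp: chain_def weak_rule)
  show ?thesis
    unfolding structural_def
  proof (rule chain_splits[where P = "\<lambda>a c. S' @ a" and xs = ?S, unfolded append_Nil2], goal_cases)
    case (4 a x c d')
    then have x: "x \<in> set (S' @ a)" and a: "depth_one_cedent a" using assms(2) S by auto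
    have "seq_of (x # remove1 x (S' @ a)) = seq_of (S' @ a)"
      using x by (intro seq_of_cong) auto
    moreover have "seq_of (x # x # remove1 x (S' @ a)) = seq_of (S' @ a @ [x])"
      using x by (intro seq_of_cong) auto
    ultimately show ?case
      using 4 a assms(3) by (simp add: chain_def contr_rule)
  qed (use weak in auto)
qed

lemma is_inf_structural: "S' \<noteq> [] \<Longrightarrow> is_inf (structural S' d)"
  by (cases "concl d = []") (simp_all add: structural_def is_inf_chain, simp add: chain_def is_inf_chain[unfolded chain_def])

text \<open>Cuts on the formulas \<open>F\<close> of all pairs in \<open>Xs\<close>, which occur in \<open>d\<close> with sign \<open>s\<close>; the
  other component of a pair derives \<open>F\<close> with the opposite sign.\<close>

definition multicut :: "bool \<Rightarrow> (fm \<times> deriv) list \<Rightarrow> sfm list \<Rightarrow> deriv \<Rightarrow> deriv" where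
  "multicut s Xs S d =
     chain (map (\<lambda>p. (cut_rule (fst (fst (snd p))) (map (\<lambda>y. (s, fst y)) (fst p) @ S),
           map (\<lambda>y. (s, fst y)) (fst p) @ S,
           if s then [] else [structural ((\<not> s, fst (fst (snd p))) # map (\<lambda>y. (s, fst y)) (fst p) @ S) (snd (fst (snd p)))],
           if s then [structural ((\<not> s, fst (fst (snd p))) # map (\<lambda>y. (s, fst y)) (fst p) @ S) (snd (fst (snd p)))] else []))
         (splits Xs))
       (structural (map (\<lambda>y. (s, fst y)) Xs @ S) d)"

text \<open>The cut formulas still present are weakened into each \<open>e\<close>, so that the two
  premises of a cut agree in their side formulas. The premise with the cut formula in the succedent
  comes first, so the chain goes on through the left premise exactly if \<open>s\<close>
  holds.\<close>

lemma multicut: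
  assumes "valid H d" "set (concl d) \<subseteq> (\<lambda>y. (s, fst y)) ` set Xs \<union> set S" "depth_one_cedent S"
    and e: "\<And>F e. (F, e) \<in> set Xs \<Longrightarrow> depth_one F \<and> valid H e \<and> set (concl e) \<subseteq> insert (\<not> s, F) (set S)"
  shows "valid H (multicut s Xs S d) \<and> concl (multicut s Xs S d) = S"
  unfolding multicut_def
proof (rule chain_splits[where P = "\<lambda>a c. map (\<lambda>y. (s, fst y)) a @ S" and xs = Xs, unfolded list.map append_Nil],
    goal_cases)
  have "depth_one_cedent (map (\<lambda>y. (s, fst y)) Xs)"
    using e by (force simp: depth_one_cedent_def)
  then have *: "valid H (structural (map (\<lambda>y. (s, fst y)) Xs @ S) d) \<and>
      concl (structural (map (\<lambda>y. (s, fst y)) Xs @ S) d) = map (\<lambda>y. (s, fst y)) Xs @ S"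
    using assms by (intro structural) auto
  case 1
  from * show ?case ..
  case 2
  from * show ?case ..
next
  case (3 a x c)
  show ?case by simp
next
  case (4 a x c d')
  obtain F e where x: "x = (F, e)" by (cases x)
  let ?S = "map (\<lambda>y. (s, fst y)) a @ S"
  have "depth_one_cedent (map (\<lambda>y. (s, fst y)) a)"
    using assms(4) 4(1) by (force simp: depth_one_cedent_def)
  then have S: "depth_one_cedent ?S" using assms(3) by simp
  have F: "depth_one F" "valid H e" "set (concl e) \<subseteq> insert (\<not> s, F) (set S)"
    using assms(4)[of F e] 4(1) x by auto
  have st: "valid H (structural ((\<not> s, F) # ?S) e) \<and> concl (structural ((\<not> s, F) # ?S) e) = (\<not> s, F) # ?S"
    by (rule structural) (use F S in auto)
  have "seq_of (map (\<lambda>y. (s, fst y)) a @ (s, F) # S) = seq_of ((s, F) # ?S)"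
    by (rule seq_of_cong) simp
  then show ?case
    using st 4(2,3) S by (cases s) (simp_all add: chain_def cut_rule x)
qed

section \<open>Branches of decision trees\<close>

text \<open>A branch is given by the literals along the path and the literal at the leaf. The sign \<open>True\<close>
  yields terms and \<open>False\<close> yields clauses.\<close>

type_synonym branch = "lit list \<times> lit"

text \<open>The literal put in front of the branches of the left subtree; those of the right subtree
  receive \<open>edge (\<not> s) p\<close>.\<close>

definition edge :: "bool \<Rightarrow> lit \<Rightarrow> lit" where
  "edge s p = (if s then bar p else p)"

primrec branches :: "bool \<Rightarrow> dt \<Rightarrow> branch list" where
  "branches s (DLit p) = [([], p)]"
| "branches s (Dec B p C) =
     map (\<lambda>b. (edge s p # fst b, snd b)) (branches s B) @
     map (\<lambda>b. (edge (\<not> s) p # fst b, snd b)) (branches s C)"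

primrec fm_of :: "bool \<Rightarrow> lit list \<Rightarrow> lit \<Rightarrow> fm" where
  "fm_of s [] q = FLit q"
| "fm_of s (l # ls) q = conn (\<not> s) (FLit l) (fm_of s ls q)"

definition branch_fm :: "bool \<Rightarrow> branch \<Rightarrow> fm" where
  "branch_fm s b = fm_of s (fst b) (snd b)"

definition trans_fm :: "bool \<Rightarrow> dt \<Rightarrow> sfm list" where
  "trans_fm s A = map (\<lambda>b. (s, branch_fm s b)) (branches s A)"

definition trans_cedents :: "dt list \<Rightarrow> dt list \<Rightarrow> sfm list" where
  "trans_cedents \<Gamma> \<Delta> = concat (map (trans_fm False) \<Gamma>) @ concat (map (trans_fm True) \<Delta>)"

lemma depth_one_fm_of [simp]: "depth_one (fm_of s ls q)"
proof -
  have "(if s then is_term else is_clause) (fm_of s ls q)"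
    by (induction ls) (auto simp: conn_def)
  then show ?thesis by (auto simp: depth_one_def split: if_splits)
qed

lemma depth_one_conn [simp]:
  "depth_one (conn (\<not> s) (FLit l) (fm_of s ls q))" "depth_one (conn s (FLit l) (fm_of (\<not> s) ls q))"
  using depth_one_fm_of[of s "l # ls" q] depth_one_fm_of[of "\<not> s" "l # ls" q] by simp_all

lemma depth_one_branch_fm [simp]: "depth_one (branch_fm s b)"
  by (simp add: branch_fm_def)

lemma depth_one_trans_fm [simp]: "depth_one_cedent (trans_fm s A)"
  by (auto simp: depth_one_cedent_def trans_fm_def)

lemma depth_one_trans_cedents [simp]: "depth_one_cedent (trans_cedents \<Gamma> \<Delta>)"
  by (auto simp: depth_one_cedent_def trans_cedents_def trans_fm_def)

lemma Tms_branches: "Tms A = mset (map (branch_fm True) (branches True A))"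
  by (induction A) (simp_all add: branch_fm_def edge_def conn_def multiset.map_comp comp_def)

lemma Cls_branches: "Cls A = mset (map (branch_fm False) (branches False A))"
  by (induction A) (simp_all add: branch_fm_def edge_def conn_def multiset.map_comp comp_def)

lemma lefts_trans_fm: "mset (lefts (trans_fm s A)) = (if s then {#} else Cls A)"
  by (simp add: trans_fm_def lefts_def Cls_branches multiset.map_comp comp_def filter_map)

lemma rights_trans_fm: "mset (rights (trans_fm s A)) = (if s then Tms A else {#})"
  by (simp add: trans_fm_def rights_def Tms_branches multiset.map_comp comp_def filter_map)

lemma lefts_trans_cedents: "mset (lefts (trans_cedents \<Gamma> \<Delta>)) = (\<Sum>A \<in># mset \<Gamma>. Cls A)"
proof -
  have "lefts (concat (map (trans_fm True) \<Delta>)) = []"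
    by (induction \<Delta>) (auto simp: trans_fm_def lefts_def)
  moreover have "mset (lefts (concat (map (trans_fm False) \<Gamma>))) = (\<Sum>A \<in># mset \<Gamma>. Cls A)"
    by (induction \<Gamma>) (simp_all add: lefts_trans_fm)
  ultimately show ?thesis by (simp add: trans_cedents_def)
qed

lemma rights_trans_cedents: "mset (rights (trans_cedents \<Gamma> \<Delta>)) = (\<Sum>A \<in># mset \<Delta>. Tms A)"
proof -
  have "rights (concat (map (trans_fm False) \<Gamma>)) = []"
    by (induction \<Gamma>) (auto simp: trans_fm_def rights_def)
  moreover have "mset (rights (concat (map (trans_fm True) \<Delta>))) = (\<Sum>A \<in># mset \<Delta>. Tms A)"
    by (induction \<Delta>) (simp_all add: rights_trans_fm)
  ultimately show ?thesis by (simp add: trans_cedents_def)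
qed

lemma branches_nonempty: "branches s A \<noteq> []"
  by (induction A) auto

text \<open>A term and a clause of the same formula share a literal: the leaf if they belong to the same
  branch, and the literal tested where the branches part otherwise.\<close>

lemma common_literal:
  assumes "b \<in> set (branches s A)" "c \<in> set (branches (\<not> s) A)"
  shows "set (fst b @ [snd b]) \<inter> set (fst c @ [snd c]) \<noteq> {}"
  using assms
proof (induction A arbitrary: b c)
  case (DLit p)
  then show ?case by simp
next
  case (Dec B p C)
  from Dec.prems(1) consider
      b' where "b' \<in> set (branches s B)" "b = (edge s p # fst b', snd b')"
    | b' where "b' \<in> set (branches s C)" "b = (edge (\<not> s) p # fst b', snd b')"
    by auto
  then show ?case
  proof cases
    case 1
    from Dec.prems(2) consider
        c' where "c' \<in> set (branches (\<not> s) B)" "c = (edge (\<not> s) p # fst c', snd c')"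
      | c' where "c' \<in> set (branches (\<not> s) C)" "c = (edge s p # fst c', snd c')"
      by auto
    then show ?thesis
    proof cases
      case c: 1
      then show ?thesis using Dec.IH(1)[OF 1(1) c(1)] 1(2) by auto
    \<comment> \<open>Where the branches part, both start with \<open>edge s p\<close>: the left one
      for sign \<open>s\<close>, the right one for the opposite sign.\<close>
    qed (use 1 in auto)
  next
    case 2
    from Dec.prems(2) consider
        c' where "c' \<in> set (branches (\<not> s) B)" "c = (edge (\<not> s) p # fst c', snd c')"
      | c' where "c' \<in> set (branches (\<not> s) C)" "c = (edge s p # fst c', snd c')"
      by auto
    then show ?thesis
    proof cases
      case c: 2
      then show ?thesis using Dec.IH(2)[OF 2(1) c(1)] 2(2) by auto
    qed (use 2 in auto)
  qed
qed


section \<open>Derived rules\<close>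

definition init :: "lit \<Rightarrow> deriv" where
  "init p = Inf (LKCommon (Init p)) [(True, FLit p), (False, FLit p)] []"

definition init_left :: "lit \<Rightarrow> deriv" where
  "init_left p = Inf (LKCommon (InitL p)) [(False, FLit p), (False, FLit (bar p))] []"

definition init_right :: "lit \<Rightarrow> deriv" where
  "init_right p = Inf (LKCommon (InitR p)) [(True, FLit p), (True, FLit (bar p))] []"

lemma init: "valid H (init p)" "concl (init p) = [(True, FLit p), (False, FLit p)]"
  by (simp_all add: init_def seq_of_def)

lemma init_left: "valid H (init_left p)" "concl (init_left p) = [(False, FLit p), (False, FLit (bar p))]"
  by (simp_all add: init_left_def seq_of_def)

lemma init_right: "valid H (init_right p)" "concl (init_right p) = [(True, FLit p), (True, FLit (bar p))]"
  by (simp_all add: init_right_def seq_of_def)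

definition lits :: "bool \<Rightarrow> lit list \<Rightarrow> sfm list" where
  "lits s ls = map (\<lambda>l. (s, FLit l)) ls"

lemma lits_simps [simp]:
  "lits s [] = []" "lits s (l # ls) = (s, FLit l) # lits s ls"
  "lits s (ls @ ls') = lits s ls @ lits s ls'" "depth_one_cedent (lits s ls)"
  "(s', F) \<in> set (lits s ls) \<longleftrightarrow> s' = s \<and> (\<exists>l \<in> set ls. F = FLit l)"
  by (auto simp: lits_def depth_one_cedent_def)

definition collapse :: "bool \<Rightarrow> branch \<Rightarrow> sfm list \<Rightarrow> deriv \<Rightarrow> deriv" where
  "collapse s b R d =
     chain (map (\<lambda>p. (alpha_rule s (FLit (fst (snd p))) (fm_of (\<not> s) (snd (snd p)) (snd b)) (lits s (fst p) @ R),
         (s, fm_of (\<not> s) (fst (snd p) # snd (snd p)) (snd b)) # lits s (fst p) @ R, [], []))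
         (splits (fst b)))
       (structural ((s, FLit (snd b)) # lits s (fst b) @ R) d)"

text \<open>One-premise rules absorb the literals of the branch into its formula, starting at the
  leaf: a clause in the succedent or a term in the antecedent.\<close>

lemma collapse:
  assumes "valid H d" "set (concl d) \<subseteq> set (lits s (fst b @ [snd b]) @ R)" "depth_one_cedent R"
  shows "valid H (collapse s b R d) \<and> concl (collapse s b R d) = (s, branch_fm (\<not> s) b) # R"
proof -
  obtain ls q where b: "b = (ls, q)" by force
  have st: "valid H (structural ((s, FLit q) # lits s ls @ R) d) \<and>
      concl (structural ((s, FLit q) # lits s ls @ R) d) = (s, FLit q) # lits s ls @ R"
    by (rule structural) (use assms in \<open>auto simp: b\<close>)
  have "valid H (collapse s b R d) \<and> concl (collapse s b R d) = (s, fm_of (\<not> s) ls q) # lits s [] @ R"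
    unfolding collapse_def b fst_conv snd_conv
  proof (rule chain_splits[where P = "\<lambda>a c. (s, fm_of (\<not> s) c q) # lits s a @ R"], goal_cases)
    case (4 a x c d')
    have "seq_of ((s, FLit x) # (s, fm_of (\<not> s) c q) # lits s a @ R) =
        seq_of ((s, fm_of (\<not> s) c q) # lits s (a @ [x]) @ R)"
      by (rule seq_of_cong) simp
    then show ?case
      using 4 assms(3) by (simp add: chain_def alpha_rule)
  qed (use st in simp_all)
  then show ?thesis by (simp add: b branch_fm_def)
qed

definition expand :: "bool \<Rightarrow> branch \<Rightarrow> deriv" where
  "expand s b =
     chain (map (\<lambda>p. (beta_rule s (FLit (fst (snd p))) (fm_of s (snd (snd p)) (snd b)) (lits (\<not> s) (fst b @ [snd b])),
         (s, fm_of s (fst (snd p) # snd (snd p)) (snd b)) # lits (\<not> s) (fst b @ [snd b]),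
         [structural ((s, FLit (fst (snd p))) # lits (\<not> s) (fst b @ [snd b])) (init (fst (snd p)))], []))
         (splits (fst b)))
       (structural ((s, FLit (snd b)) # lits (\<not> s) (fst b @ [snd b])) (init (snd b)))"

text \<open>Two-premise rules build a term in the succedent, or a clause in the antecedent. All
  literals of the branch are kept as side formulas throughout, so that every left premise is a
  weakened initial sequent.\<close>

lemma expand:
  "valid H (expand s b) \<and> concl (expand s b) = (s, branch_fm s b) # lits (\<not> s) (fst b @ [snd b])"
proof -
  obtain ls q where b: "b = (ls, q)" by force
  let ?L = "lits (\<not> s) (ls @ [q])"
  have st: "valid H (structural ((s, FLit l) # ?L) (init l)) \<and>
      concl (structural ((s, FLit l) # ?L) (init l)) = (s, FLit l) # ?L" if "l \<in> set (ls @ [q])" for l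
    by (rule structural) (use that in \<open>auto simp: init\<close>)
  have "valid H (expand s b) \<and> concl (expand s b) = (s, fm_of s ls q) # ?L"
    unfolding expand_def b fst_conv snd_conv
  proof (rule chain_splits[where P = "\<lambda>a c. (s, fm_of s c q) # ?L"], goal_cases)
    case (4 a x c d')
    then show ?case
      using st[of x] by (simp add: chain_def beta_rule)
  qed (use st[of q] in simp_all)
  then show ?thesis by (simp add: b branch_fm_def)
qed

definition identity :: "bool \<Rightarrow> branch \<Rightarrow> deriv" where
  "identity s b = collapse (\<not> s) b [(s, branch_fm s b)] (expand s b)"

text \<open>Initial sequents exist for literals only. For terms and clauses the formula is built on
  one side by \<open>expand\<close>, and its literals on the other side are then absorbed by
  \<open>collapse\<close>.\<close>

lemma identity:
  "valid H (identity s b) \<and> concl (identity s b) = [(\<not> s, branch_fm s b), (s, branch_fm s b)]"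
  using collapse[of H "expand s b" "\<not> s" b "[(s, branch_fm s b)]"] expand[of H s b]
  by (auto simp: identity_def)

text \<open>The derivation \<open>e\<close> of \<open>l\<close> with sign \<open>s\<close> from \<open>z\<close> extends to the branch \<open>b\<close> prefixed
  by \<open>l\<close>.\<close>

definition prefixed :: "bool \<Rightarrow> lit \<Rightarrow> branch \<Rightarrow> sfm \<Rightarrow> deriv \<Rightarrow> deriv" where
  "prefixed s l b z e =
     Inf (beta_rule s (FLit l) (branch_fm s b) [(\<not> s, branch_fm s b), z])
       ((s, branch_fm s (l # fst b, snd b)) # [(\<not> s, branch_fm s b), z])
       [structural ((s, FLit l) # [(\<not> s, branch_fm s b), z]) e,
        structural ((s, branch_fm s b) # [(\<not> s, branch_fm s b), z]) (identity s b)]"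

text \<open>One two-premise inference: \<open>l\<close> comes from \<open>e\<close>, and the rest of
  the branch from its own identity derivation.\<close>

lemma prefixed:
  assumes "valid H e" "set (concl e) \<subseteq> {(s, FLit l), z}" "depth_one (snd z)"
  shows "valid H (prefixed s l b z e) \<and>
    concl (prefixed s l b z e) = [(s, branch_fm s (l # fst b, snd b)), (\<not> s, branch_fm s b), z]"
proof -
  let ?R = "[(\<not> s, branch_fm s b), z]"
  have 1: "valid H (structural ((s, FLit l) # ?R) e) \<and>
      concl (structural ((s, FLit l) # ?R) e) = (s, FLit l) # ?R"
    by (rule structural) (use assms in auto)
  have 2: "valid H (structural ((s, branch_fm s b) # ?R) (identity s b)) \<and>
      concl (structural ((s, branch_fm s b) # ?R) (identity s b)) = (s, branch_fm s b) # ?R"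
    by (rule structural) (use assms identity[of H s b] in auto)
  have "branch_fm s (l # fst b, snd b) = conn (\<not> s) (FLit l) (branch_fm s b)"
    by (simp add: branch_fm_def)
  then show ?thesis
    using 1 2 assms(3) depth_one_branch_fm[of s "(l # fst b, snd b)"]
    by (simp add: prefixed_def beta_rule)
qed

text \<open>Membership is written as non-emptiness of a filtered list to stay within the operations
  known to be polynomial-time.\<close>

definition common_lit :: "branch \<Rightarrow> branch \<Rightarrow> lit" where
  "common_lit b c = hd (filter (\<lambda>l. filter (\<lambda>l'. l' = l) (fst c @ [snd c]) \<noteq> []) (fst b @ [snd b]))"

lemma common_lit:
  assumes "set (fst b @ [snd b]) \<inter> set (fst c @ [snd c]) \<noteq> {}"
  shows "common_lit b c \<in> set (fst b @ [snd b]) \<inter> set (fst c @ [snd c])"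
proof -
  let ?f = "filter (\<lambda>l. filter (\<lambda>l'. l' = l) (fst c @ [snd c]) \<noteq> []) (fst b @ [snd b])"
  have set: "set ?f = set (fst b @ [snd b]) \<inter> set (fst c @ [snd c])"
    by (auto simp: filter_empty_conv)
  have "?f \<noteq> []"
  proof
    assume "?f = []"
    then have "set ?f = {}" by (simp only: list.set)
    with assms set show False by (simp only:)
  qed
  then have "hd ?f \<in> set ?f" by (rule hd_in_set)
  then show ?thesis unfolding common_lit_def set .
qed

definition clash :: "bool \<Rightarrow> branch \<Rightarrow> branch \<Rightarrow> deriv" where
  "clash s b c = collapse (\<not> s) b [(s, branch_fm (\<not> s) c)]
     (collapse s c (lits (\<not> s) (fst b @ [snd b])) (init (common_lit b c)))"

text \<open>An initial sequent for a shared literal, weakened to all literals of \<open>b\<close> on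
  one side and all those of \<open>c\<close> on the other, is collapsed on both sides.\<close>

lemma clash:
  assumes "b \<in> set (branches s A)" "c \<in> set (branches (\<not> s) A)"
  shows "valid H (clash s b c) \<and> concl (clash s b c) = [(\<not> s, branch_fm s b), (s, branch_fm (\<not> s) c)]"
proof -
  have l: "common_lit b c \<in> set (fst b @ [snd b]) \<inter> set (fst c @ [snd c])"
    by (rule common_lit[OF common_literal[OF assms]])
  let ?d = "collapse s c (lits (\<not> s) (fst b @ [snd b])) (init (common_lit b c))"
  have d: "valid H ?d \<and> concl ?d = (s, branch_fm (\<not> s) c) # lits (\<not> s) (fst b @ [snd b])"
  proof (rule collapse)
    show "set (concl (init (common_lit b c))) \<subseteq>
        set (lits s (fst c @ [snd c]) @ lits (\<not> s) (fst b @ [snd b]))"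
      using l by (cases s) (auto simp: init)
  qed (simp_all add: init)
  have "valid H (collapse (\<not> s) b [(s, branch_fm (\<not> s) c)] ?d) \<and>
      concl (collapse (\<not> s) b [(s, branch_fm (\<not> s) c)] ?d) =
      (\<not> s, branch_fm (\<not> \<not> s) b) # [(s, branch_fm (\<not> s) c)]"
    by (rule collapse) (use d in auto)
  then show ?thesis by (simp add: clash_def)
qed


section \<open>Translation of the rules of inference\<close>

text \<open>In the translation of a cut, the derivation of the premise with cut formula of sign \<open>s\<close> is
  used only once; the other one is used once for each branch of the cut formula.\<close>

definition cut_deriv :: "bool \<Rightarrow> dt \<Rightarrow> sfm list \<Rightarrow> deriv" where
  "cut_deriv s A S = multicut s
     (map (\<lambda>b. (branch_fm s b,
         multicut (\<not> s) (map (\<lambda>c. (branch_fm (\<not> s) c, clash s b c)) (branches (\<not> s) A))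
           ((\<not> s, branch_fm s b) # S) (Hyp (\<not> s) (trans_fm (\<not> s) A @ S))))
       (branches s A))
     S (Hyp s (trans_fm s A @ S))"

definition dec_half :: "bool \<Rightarrow> lit \<Rightarrow> branch list \<Rightarrow> sfm \<Rightarrow> deriv \<Rightarrow> sfm list \<Rightarrow> deriv \<Rightarrow> deriv" where
  "dec_half s l bs z e S h =
     multicut s (map (\<lambda>b. (branch_fm s b, prefixed s l b z e)) bs) (z # S) h"

definition dec_deriv :: "bool \<Rightarrow> dt \<Rightarrow> lit \<Rightarrow> dt \<Rightarrow> sfm list \<Rightarrow> deriv" where
  "dec_deriv s A p B S =
     Inf (cut_rule (FLit p) (trans_fm s (Dec A p B) @ S)) (trans_fm s (Dec A p B) @ S)
       [dec_half s (edge s p) (branches s A) (True, FLit p) (if s then init_right p else init p)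
          (trans_fm s (Dec A p B) @ S) (Hyp True (trans_fm s A @ (True, FLit p) # S)),
        dec_half s (edge (\<not> s) p) (branches s B) (False, FLit p) (if s then init p else init_left p)
          (trans_fm s (Dec A p B) @ S) (Hyp False ((False, FLit p) # trans_fm s B @ S))]"

text \<open>For a branch \<open>b\<close> of sign \<open>s\<close>, cutting all opposite branches of
  the other premise against their clashes with \<open>b\<close> leaves that premise with
  \<open>b\<close> alone. The sequents so obtained then remove the branches of the first premise one
  by one.\<close>

lemma cut_deriv:
  assumes "depth_one_cedent S" "length H = 2"
    "H ! 0 = seq_of (trans_fm True A @ S)" "H ! 1 = seq_of (trans_fm False A @ S)"
  shows "valid H (cut_deriv s A S) \<and> concl (cut_deriv s A S) = S"
  unfolding cut_deriv_def
proof (rule multicut)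
  have H: "valid H (Hyp s (trans_fm s A @ S))" for s
    using assms by simp
  show "valid H (Hyp s (trans_fm s A @ S))" by (rule H)
  show "set (concl (Hyp s (trans_fm s A @ S))) \<subseteq> (\<lambda>y. (s, fst y)) ` set (map (\<lambda>b. (branch_fm s b,
      multicut (\<not> s) (map (\<lambda>c. (branch_fm (\<not> s) c, clash s b c)) (branches (\<not> s) A))
        ((\<not> s, branch_fm s b) # S) (Hyp (\<not> s) (trans_fm (\<not> s) A @ S)))) (branches s A)) \<union> set S"
    by (auto simp: trans_fm_def image_iff)
  fix F e assume "(F, e) \<in> set (map (\<lambda>b. (branch_fm s b,
      multicut (\<not> s) (map (\<lambda>c. (branch_fm (\<not> s) c, clash s b c)) (branches (\<not> s) A))
        ((\<not> s, branch_fm s b) # S) (Hyp (\<not> s) (trans_fm (\<not> s) A @ S)))) (branches s A))"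
  then obtain b where b: "b \<in> set (branches s A)" "F = branch_fm s b"
    and e: "e = multicut (\<not> s) (map (\<lambda>c. (branch_fm (\<not> s) c, clash s b c)) (branches (\<not> s) A))
        ((\<not> s, branch_fm s b) # S) (Hyp (\<not> s) (trans_fm (\<not> s) A @ S))" by auto
  have "valid H e \<and> concl e = (\<not> s, branch_fm s b) # S"
    unfolding e
  proof (rule multicut)
    show "set (concl (Hyp (\<not> s) (trans_fm (\<not> s) A @ S))) \<subseteq>
        (\<lambda>y. (\<not> s, fst y)) ` set (map (\<lambda>c. (branch_fm (\<not> s) c, clash s b c)) (branches (\<not> s) A)) \<union>
        set ((\<not> s, branch_fm s b) # S)"
      by (auto simp: trans_fm_def image_iff)
    fix G d assume "(G, d) \<in> set (map (\<lambda>c. (branch_fm (\<not> s) c, clash s b c)) (branches (\<not> s) A))"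
    then obtain c where "c \<in> set (branches (\<not> s) A)" "G = branch_fm (\<not> s) c" "d = clash s b c" by auto
    then show "depth_one G \<and> valid H d \<and> set (concl d) \<subseteq> insert (\<not> \<not> s, G) (set ((\<not> s, branch_fm s b) # S))"
      using clash[OF b(1), of c H] by auto
  qed (use assms(1) H in simp_all)
  then show "depth_one F \<and> valid H e \<and> set (concl e) \<subseteq> insert (\<not> s, F) (set S)"
    using b by auto
qed fact

text \<open>A branch of a subtree becomes one of the whole tree when the tested literal is put in
  front. Cutting with \<open>prefixed\<close> makes this exchange, at the price of the side formula
  \<open>z\<close>.\<close>

lemma dec_half:
  assumes "valid H h" "set (concl h) \<subseteq> (\<lambda>b. (s, branch_fm s b)) ` set bs \<union> set (z # S)"
    and "depth_one_cedent (z # S)" "valid H e" "set (concl e) \<subseteq> {(s, FLit l), z}"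
    and "\<And>b. b \<in> set bs \<Longrightarrow> (s, branch_fm s (l # fst b, snd b)) \<in> set S"
  shows "valid H (dec_half s l bs z e S h) \<and> concl (dec_half s l bs z e S h) = z # S"
  unfolding dec_half_def
proof (rule multicut)
  show "set (concl h) \<subseteq> (\<lambda>y. (s, fst y)) ` set (map (\<lambda>b. (branch_fm s b, prefixed s l b z e)) bs) \<union> set (z # S)"
    using assms(2) by (simp add: image_image)
  fix F d assume "(F, d) \<in> set (map (\<lambda>b. (branch_fm s b, prefixed s l b z e)) bs)"
  then obtain b where "b \<in> set bs" "F = branch_fm s b" "d = prefixed s l b z e" by auto
  moreover have "valid H (prefixed s l b z e) \<and>
    concl (prefixed s l b z e) = [(s, branch_fm s (l # fst b, snd b)), (\<not> s, branch_fm s b), z]" for b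
    by (rule prefixed) (use assms in auto)
  ultimately show "depth_one F \<and> valid H d \<and> set (concl d) \<subseteq> insert (\<not> s, F) (set (z # S))"
    using assms(6) by auto
qed (use assms in auto)

text \<open>The new front literal of each branch is \<open>p\<close> or its negation, and an initial
  sequent links it to the occurrence of \<open>p\<close> in that premise. The two halves then differ
  only in the side on which \<open>p\<close> stands, and one cut on \<open>p\<close> joins them.
  Each hypothesis occurs once.\<close>

lemma dec_deriv:
  assumes "depth_one_cedent S" "length H = 2"
    "H ! 0 = seq_of (trans_fm s A @ (True, FLit p) # S)"
    "H ! 1 = seq_of ((False, FLit p) # trans_fm s B @ S)"
  shows "valid H (dec_deriv s A p B S) \<and> concl (dec_deriv s A p B S) = trans_fm s (Dec A p B) @ S"
proof -
  let ?S = "trans_fm s (Dec A p B) @ S"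
  let ?e1 = "if s then init_right p else init p" and ?e2 = "if s then init p else init_left p"
  let ?h1 = "Hyp True (trans_fm s A @ (True, FLit p) # S)"
  let ?h2 = "Hyp False ((False, FLit p) # trans_fm s B @ S)"
  have bar: "bar (bar p) = p" by (cases p) auto
  let ?d1 = "dec_half s (edge s p) (branches s A) (True, FLit p) ?e1 ?S ?h1"
  have 1: "valid H ?d1 \<and> concl ?d1 = (True, FLit p) # ?S"
  proof (rule dec_half)
    show "valid H ?e1" "set (concl ?e1) \<subseteq> {(s, FLit (edge s p)), (True, FLit p)}"
      by (simp_all add: init init_right edge_def)
    show "(s, branch_fm s (edge s p # fst b, snd b)) \<in> set ?S" if "b \<in> set (branches s A)" for b
      using that by (auto simp: trans_fm_def)
  qed (use assms in \<open>auto simp: trans_fm_def depth_one_cedent_def\<close>)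
  let ?d2 = "dec_half s (edge (\<not> s) p) (branches s B) (False, FLit p) ?e2 ?S ?h2"
  have 2: "valid H ?d2 \<and> concl ?d2 = (False, FLit p) # ?S"
  proof (rule dec_half)
    show "valid H ?e2" "set (concl ?e2) \<subseteq> {(s, FLit (edge (\<not> s) p)), (False, FLit p)}"
      by (simp_all add: init init_left edge_def)
    show "(s, branch_fm s (edge (\<not> s) p # fst b, snd b)) \<in> set ?S" if "b \<in> set (branches s B)" for b
      using that by (auto simp: trans_fm_def)
  qed (use assms in \<open>auto simp: trans_fm_def depth_one_cedent_def\<close>)
  show ?thesis
    using 1 2 assms(1) by (simp add: dec_deriv_def cut_rule)
qed

text \<open>The sign matters for cuts only: it names the hypothesis that is used once.\<close>

fun common_deriv :: "bool \<Rightarrow> dt common_rule \<Rightarrow> deriv" where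
  "common_deriv s (Init p) = init p"
| "common_deriv s (InitL p) = init_left p"
| "common_deriv s (InitR p) = init_right p"
| "common_deriv s (ContrL A \<Gamma> \<Delta>) = structural (trans_fm False A @ trans_cedents \<Gamma> \<Delta>)
     (Hyp True (trans_fm False A @ trans_fm False A @ trans_cedents \<Gamma> \<Delta>))"
| "common_deriv s (ContrR A \<Gamma> \<Delta>) = structural (trans_fm True A @ trans_cedents \<Gamma> \<Delta>)
     (Hyp True (trans_fm True A @ trans_fm True A @ trans_cedents \<Gamma> \<Delta>))"
| "common_deriv s (WeakL A \<Gamma> \<Delta>) = structural (trans_fm False A @ trans_cedents \<Gamma> \<Delta>)
     (Hyp True (trans_cedents \<Gamma> \<Delta>))"
| "common_deriv s (WeakR A \<Gamma> \<Delta>) = structural (trans_fm True A @ trans_cedents \<Gamma> \<Delta>)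
     (Hyp True (trans_cedents \<Gamma> \<Delta>))"
| "common_deriv s (Cut A \<Gamma> \<Delta>) = cut_deriv s A (trans_cedents \<Gamma> \<Delta>)"

fun rule_deriv :: "bool \<Rightarrow> ldt_rule \<Rightarrow> deriv" where
  "rule_deriv s (LDTCommon r) = common_deriv s r"
| "rule_deriv s (DecL A p B \<Gamma> \<Delta>) = dec_deriv False A p B (trans_cedents \<Gamma> \<Delta>)"
| "rule_deriv s (DecR A p B \<Gamma> \<Delta>) = dec_deriv True A p B (trans_cedents \<Gamma> \<Delta>)"

lemma cls_tms_sequent: "cls_tms (\<Gamma> \<turnstile> \<Delta>) = seq_of (trans_cedents \<Gamma> \<Delta>)"
  by (simp add: cls_tms_def seq_of_def sequent_of_def lefts_trans_cedents rights_trans_cedents)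

lemma common_deriv:
  "valid (map cls_tms (common_prems r)) (common_deriv s r) \<and>
    seq_of (concl (common_deriv s r)) = cls_tms (common_concl DLit r)"
proof (cases r)
  case (Init p)
  have "seq_of (concl (init p)) = cls_tms ([DLit p] \<turnstile> [DLit p])"
    by (simp add: init cls_tms_def seq_of_def sequent_of_def)
  then show ?thesis by (simp add: Init init)
next
  case (InitL p)
  have "seq_of (concl (init_left p)) = cls_tms ([DLit p, DLit (bar p)] \<turnstile> [])"
    by (simp add: init_left cls_tms_def seq_of_def sequent_of_def)
  then show ?thesis by (simp add: InitL init_left)
next
  case (InitR p)
  have "seq_of (concl (init_right p)) = cls_tms ([] \<turnstile> [DLit p, DLit (bar p)])"
    by (simp add: init_right cls_tms_def seq_of_def sequent_of_def)
  then show ?thesis by (simp add: InitR init_right)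
next
  case (Cut A \<Gamma> \<Delta>)
  let ?S = "trans_cedents \<Gamma> \<Delta>"
  have "valid (map cls_tms (common_prems r)) (cut_deriv s A ?S) \<and> concl (cut_deriv s A ?S) = ?S"
    by (rule cut_deriv) (simp_all add: Cut cls_tms_def seq_of_def sequent_of_def
        lefts_trans_fm rights_trans_fm lefts_trans_cedents rights_trans_cedents)
  then show ?thesis by (simp add: Cut cls_tms_sequent)
next
  case (ContrL A \<Gamma> \<Delta>)
  let ?S = "trans_fm False A @ trans_cedents \<Gamma> \<Delta>"
  have "valid (map cls_tms (common_prems r)) (common_deriv s r) \<and> concl (common_deriv s r) = ?S"
    unfolding ContrL common_deriv.simps
    by (rule structural) (auto simp: cls_tms_def seq_of_def sequent_of_def
        lefts_trans_fm rights_trans_fm lefts_trans_cedents rights_trans_cedents)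
  then show ?thesis by (simp add: ContrL cls_tms_def seq_of_def sequent_of_def
        lefts_trans_fm rights_trans_fm lefts_trans_cedents rights_trans_cedents)
next
  case (ContrR A \<Gamma> \<Delta>)
  let ?S = "trans_fm True A @ trans_cedents \<Gamma> \<Delta>"
  have "valid (map cls_tms (common_prems r)) (common_deriv s r) \<and> concl (common_deriv s r) = ?S"
    unfolding ContrR common_deriv.simps
    by (rule structural) (auto simp: cls_tms_def seq_of_def sequent_of_def
        lefts_trans_fm rights_trans_fm lefts_trans_cedents rights_trans_cedents)
  then show ?thesis by (simp add: ContrR cls_tms_def seq_of_def sequent_of_def
        lefts_trans_fm rights_trans_fm lefts_trans_cedents rights_trans_cedents)
next
  case (WeakL A \<Gamma> \<Delta>)
  let ?S = "trans_fm False A @ trans_cedents \<Gamma> \<Delta>"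
  have "valid (map cls_tms (common_prems r)) (common_deriv s r) \<and> concl (common_deriv s r) = ?S"
    unfolding WeakL common_deriv.simps
    by (rule structural) (auto simp: cls_tms_sequent)
  then show ?thesis by (simp add: WeakL cls_tms_def seq_of_def sequent_of_def
        lefts_trans_fm rights_trans_fm lefts_trans_cedents rights_trans_cedents)
next
  case (WeakR A \<Gamma> \<Delta>)
  let ?S = "trans_fm True A @ trans_cedents \<Gamma> \<Delta>"
  have "valid (map cls_tms (common_prems r)) (common_deriv s r) \<and> concl (common_deriv s r) = ?S"
    unfolding WeakR common_deriv.simps
    by (rule structural) (auto simp: cls_tms_sequent)
  then show ?thesis by (simp add: WeakR cls_tms_def seq_of_def sequent_of_def
        lefts_trans_fm rights_trans_fm lefts_trans_cedents rights_trans_cedents)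
qed

lemma rule_deriv:
  "valid (map cls_tms (ldt_prems r)) (rule_deriv s r) \<and>
    seq_of (concl (rule_deriv s r)) = cls_tms (ldt_concl r)"
proof (cases r)
  case (LDTCommon r)
  then show ?thesis using common_deriv by simp
next
  case (DecL A p B \<Gamma> \<Delta>)
  let ?S = "trans_cedents \<Gamma> \<Delta>"
  have "valid (map cls_tms (ldt_prems r)) (dec_deriv False A p B ?S) \<and>
      concl (dec_deriv False A p B ?S) = trans_fm False (Dec A p B) @ ?S"
    by (rule dec_deriv) (simp_all add: DecL cls_tms_def seq_of_def sequent_of_def
        lefts_trans_fm rights_trans_fm lefts_trans_cedents rights_trans_cedents)
  then show ?thesis by (simp add: DecL cls_tms_def seq_of_def sequent_of_def
        lefts_trans_fm rights_trans_fm lefts_trans_cedents rights_trans_cedents)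
next
  case (DecR A p B \<Gamma> \<Delta>)
  let ?S = "trans_cedents \<Gamma> \<Delta>"
  have "valid (map cls_tms (ldt_prems r)) (dec_deriv True A p B ?S) \<and>
      concl (dec_deriv True A p B ?S) = trans_fm True (Dec A p B) @ ?S"
    by (rule dec_deriv) (simp_all add: DecR cls_tms_def seq_of_def sequent_of_def
        lefts_trans_fm rights_trans_fm lefts_trans_cedents rights_trans_cedents)
  then show ?thesis by (simp add: DecR cls_tms_def seq_of_def sequent_of_def
        lefts_trans_fm rights_trans_fm lefts_trans_cedents rights_trans_cedents)
qed

section \<open>Dag-like proofs\<close>

text \<open>A line consists of a rule, its conclusion and its premises. The positions of the premises are found
  by searching the preceding lines, so that the positions in the given proof are not needed.\<close>

type_synonym line = "lk_rule \<times> sfm list \<times> sfm list list"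

text \<open>A hypothesis yields no line; its sequent is expected among the earlier ones.\<close>

fun flatten :: "deriv \<Rightarrow> line list" where
  "flatten (Hyp b S) = []"
| "flatten (Inf r S ds) = concat (map flatten ds) @ [(r, S, map concl ds)]"

text \<open>Lines are matched up to the order of formulas, because a hypothesis may list its sequent
  differently from the line that derives it. The index is the length of the prefix before the line
  found.\<close>

definition position :: "line list \<Rightarrow> sfm list \<Rightarrow> nat" where
  "position L p = length (fst (hd (filter (\<lambda>q. mset (fst (snd (fst (snd q)))) = mset p) (splits L))))"

definition resolve :: "line list \<Rightarrow> lk_rule dag" where
  "resolve L = map (\<lambda>q. (fst (fst (snd q)), map (position (fst q)) (snd (snd (fst (snd q)))))) (splits L)"

definition dag_trans :: "ldt_rule dag \<Rightarrow> lk_rule dag" where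
  "dag_trans \<pi> = resolve (concat (map (\<lambda>l. flatten (rule_deriv True (fst l))) \<pi>))"

lemma mset_by_signs:
  "mset S = image_mset (Pair False) (mset (lefts S)) + image_mset (Pair True) (mset (rights S))"
  by (induction S) auto

text \<open>The signs allow the multiset to be recovered from the two cedents, so the search for
  premises may compare signed lists.\<close>

lemma seq_of_eq_iff: "seq_of S = seq_of S' \<longleftrightarrow> mset S = mset S'"
  using mset_by_signs[of S] mset_by_signs[of S'] seq_of_cong[of S S']
  by (auto simp: seq_of_def sequent_of_def)

definition concls :: "line list \<Rightarrow> fm sequent set" where
  "concls L = (\<lambda>l. seq_of (fst (snd l))) ` set L"

text \<open>An index-free notion of proof: \<open>K\<close> collects the sequents available so far,
  so that pieces can simply be appended.\<close>

fun justified :: "fm sequent set \<Rightarrow> line list \<Rightarrow> bool" where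
  "justified K [] \<longleftrightarrow> True"
| "justified K (l # L) \<longleftrightarrow> seq_of ` set (snd (snd l)) \<subseteq> K \<and> lk_concl (fst l) = seq_of (fst (snd l)) \<and>
     lk_prems (fst l) = map seq_of (snd (snd l)) \<and> depth_one_cedent (fst (snd l)) \<and>
     justified (insert (seq_of (fst (snd l))) K) L"

lemma concls_simps [simp]:
  "concls [] = {}" "concls (l # L) = insert (seq_of (fst (snd l))) (concls L)"
  "concls (L @ L') = concls L \<union> concls L'"
  by (auto simp: concls_def)

lemma justified_append [simp]:
  "justified K (L @ L') \<longleftrightarrow> justified K L \<and> justified (K \<union> concls L) L'"
  by (induction L arbitrary: K) (auto simp: insert_commute Un_commute)

lemma justified_nth:
  assumes "justified K L" "k < length L"
  shows "seq_of ` set (snd (snd (L ! k))) \<subseteq> K \<union> concls (take k L)"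
    "lk_concl (fst (L ! k)) = seq_of (fst (snd (L ! k)))"
    "lk_prems (fst (L ! k)) = map seq_of (snd (snd (L ! k)))"
    "depth_one_cedent (fst (snd (L ! k)))"
proof -
  have "justified K (take k L @ L ! k # drop (Suc k) L)"
    using assms by (simp add: id_take_nth_drop[symmetric])
  then show "seq_of ` set (snd (snd (L ! k))) \<subseteq> K \<union> concls (take k L)"
    "lk_concl (fst (L ! k)) = seq_of (fst (snd (L ! k)))"
    "lk_prems (fst (L ! k)) = map seq_of (snd (snd (L ! k)))"
    "depth_one_cedent (fst (snd (L ! k)))"
    unfolding justified_append justified.simps by blast+
qed

lemma justified_flatten:
  assumes "valid H d" "set H \<subseteq> K"
  shows "justified K (flatten d) \<and> seq_of (concl d) \<in> K \<union> concls (flatten d)"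
  using assms
proof (induction d arbitrary: K)
  case (Hyp b S)
  then have "H ! (if b then 0 else 1) = seq_of S" "(if b then 0 else 1) < length H" by simp_all
  then have "seq_of S \<in> set H" by (metis nth_mem)
  with Hyp.prems(2) show ?case by auto
next
  case (Inf r S ds)
  \<comment> \<open>Induction from the right end, since the lines of earlier premises are available
    to later ones.\<close>
  have "justified K (concat (map flatten es)) \<and>
      (\<lambda>d. seq_of (concl d)) ` set es \<subseteq> K \<union> concls (concat (map flatten es))"
    if "set es \<subseteq> set ds" for es
    using that
  proof (induction es rule: rev_induct)
    case (snoc e es)
    then have e: "e \<in> set ds" by simp
    have K: "set H \<subseteq> K \<union> concls (concat (map flatten es))" using Inf.prems(2) by auto
    have "valid H e" using Inf.prems(1) e by simp
    from Inf.IH[OF e this K] snoc show ?case by auto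
  qed simp
  from this[of ds] Inf.prems(1) show ?case by (auto simp: comp_def)
qed

lemma length_splits [simp]: "length (splits xs) = length xs"
  by (induction xs) auto

lemma nth_splits: "k < length xs \<Longrightarrow> splits xs ! k = (take k xs, xs ! k, drop (Suc k) xs)"
proof (induction xs arbitrary: k)
  case (Cons x xs)
  then show ?case by (cases k) auto
qed simp

lemma position:
  assumes "seq_of p \<in> concls L"
  shows "position L p < length L" "seq_of (fst (snd (L ! position L p))) = seq_of p"
proof -
  let ?qs = "filter (\<lambda>q. mset (fst (snd (fst (snd q)))) = mset p) (splits L)"
  from assms obtain l where l: "l \<in> set L" "mset (fst (snd l)) = mset p"
    by (auto simp: concls_def seq_of_eq_iff)
  then obtain a c where "L = a @ l # c" by (meson split_list)
  then have "(a, l, c) \<in> set ?qs" using l(2) by (simp add: mem_splits)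
  then have hd: "hd ?qs \<in> set ?qs" by (intro hd_in_set) (metis empty_iff list.set(1))
  obtain a l c where q: "hd ?qs = (a, l, c)" by (cases "hd ?qs")
  have "(a, l, c) \<in> set (splits L)" and m: "mset (fst (snd l)) = mset p"
    using hd unfolding q by simp_all
  then have L: "L = a @ l # c" by (simp add: mem_splits)
  have "position L p = length a" by (simp add: position_def q)
  with L m show "position L p < length L" "seq_of (fst (snd (L ! position L p))) = seq_of p"
    by (simp_all add: seq_of_eq_iff)
qed

text \<open>Each premise is sought in the strict prefix before its line, where
  \<open>justified\<close> guarantees it; hence all references point backwards.\<close>

lemma LK1_proof_resolve:
  assumes "justified {} L" "L \<noteq> []"
  shows "LK1_proof (resolve L) (seq_of (fst (snd (last L))))"
proof -
  have len: "length (resolve L) = length L" by (simp add: resolve_def)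
  have nth: "resolve L ! k = (fst (L ! k), map (position (take k L)) (snd (snd (L ! k))))"
    if "k < length L" for k
    using that by (simp add: resolve_def nth_splits)
  have pos: "position (take k L) p < k" "lk_concl (fst (resolve L ! position (take k L) p)) = seq_of p"
    if k: "k < length L" and p: "p \<in> set (snd (snd (L ! k)))" for k p
  proof -
    have "seq_of p \<in> concls (take k L)"
      using justified_nth(1)[OF assms(1) k] p by auto
    note * = position[OF this]
    then show lt: "position (take k L) p < k" using k by simp
    then have "position (take k L) p < length L" using k by simp
    with justified_nth(2)[OF assms(1) this] * lt
    show "lk_concl (fst (resolve L ! position (take k L) p)) = seq_of p"
      by (simp add: nth)
  qed
  have "dag_proof lk_prems lk_concl (resolve L)"
    unfolding dag_proof_def
  proof (intro conjI allI impI)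
    show "resolve L \<noteq> []" using len assms(2) by auto
    fix k assume "k < length (resolve L)"
    then have k: "k < length L" by (simp add: len)
    show "\<forall>i \<in> set (snd (resolve L ! k)). i < k"
      using pos(1)[OF k] by (auto simp: nth[OF k])
    show "map (\<lambda>i. lk_concl (fst (resolve L ! i))) (snd (resolve L ! k)) = lk_prems (fst (resolve L ! k))"
      using pos(2)[OF k] justified_nth(3)[OF assms(1) k] by (simp add: nth[OF k])
  qed
  moreover have "dag_concl lk_concl (resolve L) = seq_of (fst (snd (last L)))"
  proof -
    have "resolve L \<noteq> []" using len assms(2) by auto
    then have "last (resolve L) = resolve L ! (length L - 1)" by (simp add: last_conv_nth len)
    moreover have "length L - 1 < length L" using assms(2) by simp
    moreover have "last L = L ! (length L - 1)" using assms(2) by (simp add: last_conv_nth)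
    ultimately show ?thesis
      using justified_nth(2)[OF assms(1)] by (simp add: dag_concl_def nth)
  qed
  moreover have "depth_one_sequent (lk_concl (fst l))" if "l \<in> set (resolve L)" for l
  proof -
    from that obtain k where "k < length L" "l = resolve L ! k" by (metis in_set_conv_nth len)
    then show ?thesis
      using justified_nth(2,4)[OF assms(1)] by (simp add: nth depth_one_sequent_seq_of)
  qed
  ultimately show ?thesis by (simp add: LK1_proof_def LK_proof_def)
qed

text \<open>A bare hypothesis would flatten to nothing. As every scheme ends with an inference, its
  last line carries its conclusion.\<close>

lemma is_inf_rule_deriv: "is_inf (rule_deriv s r)"
proof -
  have ne: "trans_fm s A \<noteq> []" for s A
    by (simp add: trans_fm_def branches_nonempty)
  have "is_inf (common_deriv s r)" for r
    by (cases r) (auto simp: init_def init_left_def init_right_def cut_deriv_def multicut_def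
        branches_nonempty ne intro!: is_inf_structural is_inf_chain)
  then show ?thesis
    by (cases r) (auto simp: dec_deriv_def)
qed

lemma last_flatten: "is_inf d \<Longrightarrow> flatten d \<noteq> [] \<and> fst (snd (last (flatten d))) = concl d"
  by (cases d) auto

lemma LK1_proof_dag_trans:
  assumes "LDT_proof \<pi> S"
  shows "LK1_proof (dag_trans \<pi>) (cls_tms S)"
proof -
  let ?F = "\<lambda>l. flatten (rule_deriv True (fst l))"
  from assms have \<pi>: "\<pi> \<noteq> []" "S = ldt_concl (fst (last \<pi>))"
    and step: "\<And>k. k < length \<pi> \<Longrightarrow> (\<forall>i \<in> set (snd (\<pi> ! k)). i < k) \<and>
        map (\<lambda>i. ldt_concl (fst (\<pi> ! i))) (snd (\<pi> ! k)) = ldt_prems (fst (\<pi> ! k))"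
    by (auto simp: LDT_proof_def dag_proof_def dag_concl_def)
  \<comment> \<open>The translations of the first \<open>n\<close> conclusions are available after
    \<open>n\<close> blocks, which is all that the hypotheses of the next block require.\<close>
  have "justified {} (concat (map ?F (take n \<pi>))) \<and>
      (\<forall>i < n. cls_tms (ldt_concl (fst (\<pi> ! i))) \<in> concls (concat (map ?F (take n \<pi>))))"
    if "n \<le> length \<pi>" for n
    using that
  proof (induction n)
    case (Suc n)
    let ?K = "concls (concat (map ?F (take n \<pi>)))" and ?d = "rule_deriv True (fst (\<pi> ! n))"
    have n: "n < length \<pi>" using Suc.prems by simp
    have IH: "justified {} (concat (map ?F (take n \<pi>)))"
      "\<And>i. i < n \<Longrightarrow> cls_tms (ldt_concl (fst (\<pi> ! i))) \<in> ?K"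
      using Suc by auto
    have "set (map cls_tms (ldt_prems (fst (\<pi> ! n)))) \<subseteq> ?K"
      using IH(2) step[OF n, THEN conjunct1] unfolding step[OF n, THEN conjunct2, symmetric] by auto
    with rule_deriv[of "fst (\<pi> ! n)" True]
    have d: "justified ?K (flatten ?d)" "seq_of (concl ?d) \<in> ?K \<union> concls (flatten ?d)"
      using justified_flatten by blast+
    have t: "concat (map ?F (take (Suc n) \<pi>)) = concat (map ?F (take n \<pi>)) @ flatten ?d"
      using n by (simp add: take_Suc_conv_app_nth)
    show ?case
      unfolding t using IH d rule_deriv[of "fst (\<pi> ! n)" True] by (auto simp: less_Suc_eq)
  qed simp
  from this[of "length \<pi>"] have j: "justified {} (concat (map ?F \<pi>))" by simp
  obtain \<pi>' l where \<pi>': "\<pi> = \<pi>' @ [l]" using \<pi>(1) by (metis rev_exhaust)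
  note lf = last_flatten[OF is_inf_rule_deriv[of True "fst l"]]
  from lf have "concat (map ?F \<pi>) \<noteq> []" by (simp add: \<pi>')
  note * = LK1_proof_resolve[OF j this]
  moreover have "seq_of (fst (snd (last (concat (map ?F \<pi>))))) = cls_tms S"
    using lf \<pi>(2) rule_deriv[of "fst l" True] by (simp add: \<pi>')
  ultimately show ?thesis by (simp add: dag_trans_def)
qed


section \<open>Encodings of formulas, rules and proofs\<close>

instantiation lit :: enc begin
definition "encode = enc_lit"
instance ..
end

instantiation dt :: enc begin
definition "encode = enc_dt"
instance ..
end

instantiation fm :: enc begin
definition "encode = enc_fm"
instance ..
end

instantiation common_rule :: (enc) enc begin
definition "encode (r :: 'a common_rule) = enc_common encode r"
instance ..
end

instantiation ldt_rule :: enc begin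
definition "encode = enc_ldt_rule"
instance ..
end

instantiation lk_rule :: enc begin
definition "encode = enc_lk_rule"
instance ..
end

instantiation ptree :: (enc) enc begin
definition "encode (t :: 'a ptree) = enc_tree encode t"
instance ..
end

primrec enc_deriv :: "deriv \<Rightarrow> data" where
  "enc_deriv (Hyp b S) = enc_node 0 [encode b, encode S]"
| "enc_deriv (Inf r S ds) = enc_node 1 [encode r, encode S, enc_list (map enc_deriv ds)]"

instantiation deriv :: enc begin
definition "encode = enc_deriv"
instance ..
end


section \<open>Tree-like proofs\<close>

text \<open>Each occurrence of a hypothesis receives its own copy of the subproof; here tree-like
  proofs pay for repetition.\<close>

fun fill :: "lk_rule ptree \<Rightarrow> lk_rule ptree \<Rightarrow> deriv \<Rightarrow> lk_rule ptree" where
  "fill t u (Hyp b S) = (if b then t else u)"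
| "fill t u (Inf r S ds) = Infer r (map (fill t u) ds)"

text \<open>In the translation of a cut it is the smaller subproof that gets duplicated.\<close>

fun tree_trans :: "ldt_rule ptree \<Rightarrow> lk_rule ptree" where
  "tree_trans (Infer r \<tau>s) = fill (hd (map tree_trans \<tau>s)) (hd (tl (map tree_trans \<tau>s)))
     (rule_deriv (sz (hd (tl \<tau>s)) \<le> sz (hd \<tau>s)) r)"

lemma LK1_tree_proof_Infer:
  "LK1_tree_proof (Infer r ts) S \<longleftrightarrow> lk_concl r = S \<and> depth_one_sequent S \<and>
     map (\<lambda>t. lk_concl (last_rule t)) ts = lk_prems r \<and>
     (\<forall>t \<in> set ts. LK1_tree_proof t (lk_concl (last_rule t)))"
  by (auto simp: LK1_tree_proof_def LK_tree_proof_def tree_concl_def)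

lemma LK1_tree_proof_fill:
  assumes "valid H d" "0 < length H \<Longrightarrow> LK1_tree_proof t (H ! 0)" "1 < length H \<Longrightarrow> LK1_tree_proof u (H ! 1)"
  shows "LK1_tree_proof (fill t u d) (seq_of (concl d))"
  using assms(1)
proof (induction d)
  case (Hyp b S)
  then show ?case using assms(2,3) by (auto split: if_splits)
next
  case (Inf r S ds)
  have ds: "LK1_tree_proof (fill t u d) (seq_of (concl d))" if "d \<in> set ds" for d
    using Inf that by simp
  then have "lk_concl (last_rule (fill t u d)) = seq_of (concl d)" if "d \<in> set ds" for d
    using that by (force simp: LK1_tree_proof_def LK_tree_proof_def tree_concl_def)
  with Inf.prems ds show ?case
    by (simp add: LK1_tree_proof_Infer depth_one_sequent_seq_of)
qed

text \<open>For rules with fewer than two premises the heads are unspecified, but a valid scheme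
  only contains hypotheses whose index is below the number of premises.\<close>

lemma LK1_tree_proof_tree_trans:
  assumes "tree_proof ldt_prems ldt_concl \<tau>"
  shows "LK1_tree_proof (tree_trans \<tau>) (cls_tms (ldt_concl (last_rule \<tau>)))"
  using assms
proof (induction \<tau>)
  case (Infer r \<tau>s)
  let ?H = "map cls_tms (ldt_prems r)" and ?d = "rule_deriv (sz (hd (tl \<tau>s)) \<le> sz (hd \<tau>s)) r"
  have prems: "map (\<lambda>\<tau>. ldt_concl (last_rule \<tau>)) \<tau>s = ldt_prems r"
    and IH: "\<And>\<tau>. \<tau> \<in> set \<tau>s \<Longrightarrow> LK1_tree_proof (tree_trans \<tau>) (cls_tms (ldt_concl (last_rule \<tau>)))"
    using Infer by auto
  have H: "?H = map (\<lambda>\<tau>. cls_tms (ldt_concl (last_rule \<tau>))) \<tau>s"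
    unfolding prems[symmetric] by simp
  have "LK1_tree_proof (fill (hd (map tree_trans \<tau>s)) (hd (tl (map tree_trans \<tau>s))) ?d) (seq_of (concl ?d))"
  proof (rule LK1_tree_proof_fill)
    show "valid ?H ?d" using rule_deriv by blast
    show "LK1_tree_proof (hd (map tree_trans \<tau>s)) (?H ! 0)" if "0 < length ?H"
      using that IH unfolding H by (cases \<tau>s) auto
    show "LK1_tree_proof (hd (tl (map tree_trans \<tau>s))) (?H ! 1)" if "1 < length ?H"
      using that IH unfolding H by (cases \<tau>s; cases "tl \<tau>s") auto
  qed
  then show ?case using rule_deriv[of r] by simp
qed

section \<open>The translation of dag-like proofs in polynomial time\<close>

text \<open>With this order of premises, \<open>THEN\<close> turns an assumption
  \<open>ptime f\<close> into a rule for \<open>f\<close> at any argument. Below a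
  \<open>map\<close> this is needed, where the outer argument has become a component of a
  pair.\<close>

lemma ptime_compose: "ptime g \<Longrightarrow> ptime f \<Longrightarrow> ptime (\<lambda>x. g (f x))"
  by (rule ptime_comp)

lemmas encode_defs = encode_lit_def encode_dt_def encode_fm_def encode_common_rule_def
  encode_ldt_rule_def encode_lk_rule_def encode_ptree_def encode_deriv_def

lemma enc_cedent_encode [simp]: "enc_cedent encode xs = encode xs"
  by (simp add: enc_cedent_def encode_list_def)

lemma encode_node_simps:
  "encode (Pos x) = enc_node 0 [encode x]" "encode (Neg x) = enc_node 1 [encode x]"
  "encode (DLit p) = enc_node 0 [encode p]" "encode (Dec A p B) = enc_node 1 [encode A, encode p, encode B]"
  "encode (FLit p) = enc_node 0 [encode p]" "encode (And F G) = enc_node 1 [encode F, encode G]"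
  "encode (Or F G) = enc_node 2 [encode F, encode G]"
  by (simp_all add: encode_defs encode_nat_def)

lemma encode_common_simps:
  fixes F :: "'f::enc"
  shows "encode (Init p :: 'f common_rule) = enc_node 0 [encode p]"
  "encode (InitL p :: 'f common_rule) = enc_node 1 [encode p]"
  "encode (InitR p :: 'f common_rule) = enc_node 2 [encode p]"
  "encode (ContrL F \<Gamma> \<Delta>) = enc_node 3 [encode F, encode \<Gamma>, encode \<Delta>]"
  "encode (ContrR F \<Gamma> \<Delta>) = enc_node 4 [encode F, encode \<Gamma>, encode \<Delta>]"
  "encode (WeakL F \<Gamma> \<Delta>) = enc_node 5 [encode F, encode \<Gamma>, encode \<Delta>]"
  "encode (WeakR F \<Gamma> \<Delta>) = enc_node 6 [encode F, encode \<Gamma>, encode \<Delta>]"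
  "encode (Cut F \<Gamma> \<Delta>) = enc_node 7 [encode F, encode \<Gamma>, encode \<Delta>]"
  by (simp_all add: encode_common_rule_def encode_lit_def)

lemma enc_common_encode:
  "enc_common enc_dt = (encode :: dt common_rule \<Rightarrow> data)"
  "enc_common enc_fm = (encode :: fm common_rule \<Rightarrow> data)"
  by (simp_all add: encode_common_rule_def[abs_def] encode_dt_def encode_fm_def)

lemma enc_cedent_encode':
  "enc_cedent enc_dt = (encode :: dt list \<Rightarrow> data)" "enc_cedent enc_fm = (encode :: fm list \<Rightarrow> data)"
  by (simp_all add: enc_cedent_def[abs_def] encode_list_def[abs_def] encode_dt_def encode_fm_def)

lemma encode_ldt_rule_simps:
  "encode (LDTCommon r) = enc_node 0 [encode r]"
  "encode (DecL A p B \<Gamma> \<Delta>) = enc_node 1 [encode A, encode p, encode B, encode \<Gamma>, encode \<Delta>]"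
  "encode (DecR A p B \<Gamma> \<Delta>) = enc_node 2 [encode A, encode p, encode B, encode \<Gamma>, encode \<Delta>]"
  by (simp_all add: encode_ldt_rule_def enc_common_encode enc_cedent_encode' encode_dt_def encode_lit_def)

lemma encode_lk_rule_simps:
  "encode (LKCommon r') = enc_node 0 [encode r']"
  "encode (AndL F G \<Gamma>' \<Delta>') = enc_node 1 [encode F, encode G, encode \<Gamma>', encode \<Delta>']"
  "encode (AndR F G \<Gamma>' \<Delta>') = enc_node 2 [encode F, encode G, encode \<Gamma>', encode \<Delta>']"
  "encode (OrL F G \<Gamma>' \<Delta>') = enc_node 3 [encode F, encode G, encode \<Gamma>', encode \<Delta>']"
  "encode (OrR F G \<Gamma>' \<Delta>') = enc_node 4 [encode F, encode G, encode \<Gamma>', encode \<Delta>']"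
  by (simp_all add: encode_lk_rule_def enc_common_encode enc_cedent_encode' encode_fm_def)

lemma encode_deriv_simps:
  "encode (Hyp b S) = enc_node 0 [encode b, encode S]"
  "encode (Inf r S ds) = enc_node 1 [encode r, encode S, encode ds]"
  by (simp_all add: encode_deriv_def encode_list_def)

lemma encode_Infer: "encode (Infer r ts) = Dot (encode r) (encode ts)"
  by (simp add: encode_ptree_def[abs_def] encode_list_def)

lemmas encode_simps = encode_node_simps encode_common_simps encode_ldt_rule_simps
  encode_lk_rule_simps encode_deriv_simps

section \<open>Constructors of formulas, rules and derivations\<close>

lemma ptime_node1:
  assumes "ptime f" "\<And>y. encode (K y) = enc_node k [encode y]"
  shows "ptime (\<lambda>x. K (f x))"
proof (rule ptime_cong)
  \<comment> \<open>As the tuple ends in \<open>()\<close>, it has the encoding of the tagged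
    node.\<close>
  show "ptime (\<lambda>x. (enc_nat k, f x, ()))" by (intro ptime_intros assms)
qed (simp add: assms enc_node_def)

lemma ptime_node2:
  assumes "ptime f" "ptime g" "\<And>y z. encode (K y z) = enc_node k [encode y, encode z]"
  shows "ptime (\<lambda>x. K (f x) (g x))"
proof (rule ptime_cong)
  show "ptime (\<lambda>x. (enc_nat k, f x, g x, ()))" by (intro ptime_intros assms)
qed (simp add: assms enc_node_def)

lemma ptime_node3:
  assumes "ptime f" "ptime g" "ptime h" "\<And>y z w. encode (K y z w) = enc_node k [encode y, encode z, encode w]"
  shows "ptime (\<lambda>x. K (f x) (g x) (h x))"
proof (rule ptime_cong)
  show "ptime (\<lambda>x. (enc_nat k, f x, g x, h x, ()))" by (intro ptime_intros assms)
qed (simp add: assms enc_node_def)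

lemma ptime_node4:
  assumes "ptime f" "ptime g" "ptime h" "ptime i"
    "\<And>y z w v. encode (K y z w v) = enc_node k [encode y, encode z, encode w, encode v]"
  shows "ptime (\<lambda>x. K (f x) (g x) (h x) (i x))"
proof (rule ptime_cong)
  show "ptime (\<lambda>x. (enc_nat k, f x, g x, h x, i x, ()))" by (intro ptime_intros assms)
qed (simp add: assms enc_node_def)

lemma ptime_FLit [ptime_intros]: "ptime f \<Longrightarrow> ptime (\<lambda>x. FLit (f x))"
  by (erule ptime_node1) (rule encode_simps)

lemma ptime_LKCommon [ptime_intros]: "ptime f \<Longrightarrow> ptime (\<lambda>x. LKCommon (f x))"
  by (erule ptime_node1) (rule encode_simps)

lemma ptime_init_constructors [ptime_intros]:
  assumes "ptime f"
  shows "ptime (\<lambda>x. Init (f x) :: 'f::enc common_rule)" "ptime (\<lambda>x. InitL (f x) :: 'f::enc common_rule)"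
    "ptime (\<lambda>x. InitR (f x) :: 'f::enc common_rule)"
  by (rule ptime_node1, fact, rule encode_simps)+

lemma ptime_fm_constructors [ptime_intros]:
  assumes "ptime f" "ptime g"
  shows "ptime (\<lambda>x. And (f x) (g x))" "ptime (\<lambda>x. Or (f x) (g x))"
  by (rule ptime_node2, fact, fact, rule encode_simps)+

lemma ptime_Hyp [ptime_intros]: "ptime f \<Longrightarrow> ptime g \<Longrightarrow> ptime (\<lambda>x. Hyp (f x) (g x))"
  by (erule (1) ptime_node2) (rule encode_simps)

lemma ptime_Inf [ptime_intros]: "ptime f \<Longrightarrow> ptime g \<Longrightarrow> ptime h \<Longrightarrow> ptime (\<lambda>x. Inf (f x) (g x) (h x))"
  by (erule (2) ptime_node3) (rule encode_simps)

lemma ptime_Dec [ptime_intros]: "ptime f \<Longrightarrow> ptime g \<Longrightarrow> ptime h \<Longrightarrow> ptime (\<lambda>x. Dec (f x) (g x) (h x))"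
  by (erule (2) ptime_node3) (rule encode_simps)

lemma ptime_Infer [ptime_intros]: "ptime f \<Longrightarrow> ptime g \<Longrightarrow> ptime (\<lambda>x. Infer (f x) (g x))"
  by (erule (1) ptime_Dot) (rule encode_Infer)

lemma ptime_common_constructors [ptime_intros]:
  assumes "ptime f" "ptime g" "ptime h"
  shows "ptime (\<lambda>x. ContrL (f x) (g x) (h x))" "ptime (\<lambda>x. ContrR (f x) (g x) (h x))"
    "ptime (\<lambda>x. WeakL (f x) (g x) (h x))" "ptime (\<lambda>x. WeakR (f x) (g x) (h x))"
    "ptime (\<lambda>x. Cut (f x) (g x) (h x))"
  by (rule ptime_node3, fact, fact, fact, rule encode_simps)+

lemma ptime_lk_constructors [ptime_intros]:
  assumes "ptime f" "ptime g" "ptime h" "ptime i"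
  shows "ptime (\<lambda>x. AndL (f x) (g x) (h x) (i x))" "ptime (\<lambda>x. AndR (f x) (g x) (h x) (i x))"
    "ptime (\<lambda>x. OrL (f x) (g x) (h x) (i x))" "ptime (\<lambda>x. OrR (f x) (g x) (h x) (i x))"
  by (rule ptime_node4, fact, fact, fact, fact, rule encode_simps)+

lemma inj_encode_data: "inj (encode :: data \<Rightarrow> data)"
  by (simp add: inj_def)

lemma inj_encode_lit: "inj (encode :: lit \<Rightarrow> data)"
  by (simp add: inj_def encode_lit_def)

lemma inj_encode_fm: "inj (encode :: fm \<Rightarrow> data)"
  by (simp add: inj_def encode_fm_def)

lemma ptime_eq_data [ptime_intros]: "ptime f \<Longrightarrow> ptime g \<Longrightarrow> ptime (\<lambda>x. (f x :: data) = g x)"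
  by (rule ptime_eq[OF inj_encode_data])

lemma ptime_eq_lit [ptime_intros]: "ptime f \<Longrightarrow> ptime g \<Longrightarrow> ptime (\<lambda>x. (f x :: lit) = g x)"
  by (rule ptime_eq[OF inj_encode_lit])

lemma ptime_eq_sfm [ptime_intros]: "ptime f \<Longrightarrow> ptime g \<Longrightarrow> ptime (\<lambda>x. (f x :: sfm) = g x)"
  by (rule ptime_eq[OF inj_encode_prod[OF inj_encode_bool inj_encode_fm]])

lemma ptime_eq_units [ptime_intros]: "ptime f \<Longrightarrow> ptime g \<Longrightarrow> ptime (\<lambda>x. (f x :: unit list) = g x)"
  by (rule ptime_eq[OF inj_encode_list[OF inj_encode_unit]])

section \<open>Constructor tests and selection of arguments\<close>

definition has_tag :: "nat \<Rightarrow> 'a::enc \<Rightarrow> bool" where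
  "has_tag k x \<longleftrightarrow> car (encode x) = enc_nat k"

lemma ptime_has_tag [ptime_intros]: "ptime f \<Longrightarrow> ptime (\<lambda>x. has_tag k (f x))"
  unfolding has_tag_def by (intro ptime_intros ptime_encode)

text \<open>Up to three constructors may share a tuple of arguments, as the initial sequents do;
  with fewer, a tag is repeated. On other constructors the selector returns the constant
  \<open>c\<close>, which is later \<open>undefined\<close>.\<close>

lemma ptime_select:
  assumes "\<And>r. encode (sel r) = (if has_tag i r \<or> has_tag j r \<or> has_tag k r then cdr (encode r) else encode c)"
    and "ptime f"
  shows "ptime (\<lambda>x. sel (f x))"
proof (rule ptime_via_data[OF _ _ assms(2)])
  show "ptime (\<lambda>d. if car d = enc_nat i then cdr d else if car d = enc_nat j then cdr d
      else if car d = enc_nat k then cdr d else encode c)"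
    by (intro ptime_intros)
qed (simp add: assms(1) has_tag_def)

lemma has_tag_node: "encode x = enc_node k xs \<Longrightarrow> has_tag l x \<longleftrightarrow> k = l"
  by (simp add: has_tag_def enc_node_def del: enc_nat_0)

lemmas has_tag_simps [simp] = encode_simps[THEN has_tag_node]

lemma cdr_enc_node [simp]: "cdr (enc_node k xs) = enc_list xs"
  by (simp add: enc_node_def)

lemma ptime_bar [ptime_intros]: "ptime f \<Longrightarrow> ptime (\<lambda>x. bar (f x))"
proof (erule ptime_via_data[rotated 2])
  show "ptime (\<lambda>d. Dot (if car d = Nul then enc_nat 1 else Nul) (cdr d))"
    by (intro ptime_intros)
  show "encode (bar p) = encode (Dot (if car (encode p) = Nul then enc_nat 1 else Nul) (cdr (encode p)))" for p
    by (cases p) (simp_all add: encode_simps enc_node_def enc_nat.simps[of 1] enc_nat.simps[of "Suc 0"])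
qed

lemma ptime_edge [ptime_intros]: "ptime f \<Longrightarrow> ptime g \<Longrightarrow> ptime (\<lambda>x. edge (f x) (g x))"
  unfolding edge_def by (intro ptime_intros)

lemma ptime_conn [ptime_intros]: "ptime f \<Longrightarrow> ptime g \<Longrightarrow> ptime h \<Longrightarrow> ptime (\<lambda>x. conn (f x) (g x) (h x))"
  unfolding conn_def by (intro ptime_intros)

definition dec_args :: "dt \<Rightarrow> dt \<times> lit \<times> dt \<times> unit" where
  "dec_args A = (case A of DLit p \<Rightarrow> undefined | Dec B p C \<Rightarrow> (B, p, C, ()))"

definition leaf_arg :: "dt \<Rightarrow> lit \<times> unit" where
  "leaf_arg A = (case A of DLit p \<Rightarrow> (p, ()) | Dec B p C \<Rightarrow> undefined)"

lemma ptime_dec_args [ptime_intros]: "ptime f \<Longrightarrow> ptime (\<lambda>x. dec_args (f x))"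
proof (erule ptime_select[rotated])
  show "encode (dec_args A) = (if has_tag 1 A \<or> has_tag 1 A \<or> has_tag 1 A then cdr (encode A)
      else encode (undefined :: dt \<times> lit \<times> dt \<times> unit))" for A
    by (cases A) (simp_all add: dec_args_def encode_simps(3,4))
qed

lemma ptime_leaf_arg [ptime_intros]: "ptime f \<Longrightarrow> ptime (\<lambda>x. leaf_arg (f x))"
proof (erule ptime_select[rotated])
  show "encode (leaf_arg A) = (if has_tag 0 A \<or> has_tag 0 A \<or> has_tag 0 A then cdr (encode A)
      else encode (undefined :: lit \<times> unit))" for A
    by (cases A) (simp_all add: leaf_arg_def encode_simps(3,4))
qed

lemma sz_node: "encode x = enc_node k xs \<Longrightarrow> sz x = Suc (dsize (enc_nat k) + dsize (enc_list xs))"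
  by (simp add: sz_def enc_node_def)

lemma sz_Dec: "sz A + sz p + sz B + 9 \<le> sz (Dec A p B)"
  using sz_node[OF encode_simps(4)[of A p B]] by (simp add: sz_def enc_nat.simps[of "Suc 0"])

text \<open>Negating a literal may change its tag from 0 to 1, whose encoding is larger by
  4.\<close>

lemma sz_edge: "sz (edge s p) \<le> sz p + 4"
  by (cases p) (auto simp: edge_def sz_def encode_simps enc_node_def enc_nat.simps[of "Suc 0"])

lemma length_branches: "length (branches s A) \<le> sz A"
proof (induction A)
  case (DLit p)
  then show ?case using sz_pos[of "DLit p"] by simp
next
  case (Dec B p C)
  then show ?case using sz_Dec[of B p C] by simp
qed

lemma sz_map_prefix: "sz (map (\<lambda>b. (l # fst b, snd b)) bs) = sz bs + length bs * Suc (sz l)"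
  by (induction bs) (auto simp: algebra_simps)

text \<open>Each test adds one literal to every branch through it. There are at most as many
  branches as the size of the tree, so the additional size per node is quadratic and growth is
  additive.\<close>

lemma ptime_branches [ptime_intros]:
  assumes "ptime f" "ptime g"
  shows "ptime (\<lambda>x. branches (f x) (g x))"
proof -
  define h where "h = (\<lambda>q::bool \<times> dt. branches (fst q) (snd q))"
  let ?L = "\<lambda>q::bool \<times> dt. fst (dec_args (snd q))" and ?P = "\<lambda>q::bool \<times> dt. fst (snd (dec_args (snd q)))"
    and ?R = "\<lambda>q::bool \<times> dt. fst (snd (snd (dec_args (snd q))))"
  let ?subs = "\<lambda>q. if has_tag 0 (snd q) then [] else [(fst q, ?L q), (fst q, ?R q)]"
  let ?step = "\<lambda>z::(bool \<times> dt) \<times> branch list list. if has_tag 0 (snd (fst z)) then [([], fst (leaf_arg (snd (fst z))))]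
    else map (\<lambda>b. (edge (fst (fst z)) (?P (fst z)) # fst b, snd b)) (hd (snd z)) @
      map (\<lambda>b. (edge (\<not> fst (fst z)) (?P (fst z)) # fst b, snd b)) (hd (tl (snd z)))"
  have "ptime h"
  proof (rule ptime_recursion[where subs = ?subs and step = ?step and m = "\<lambda>q. sz (snd q)"
        and q = "\<lambda>n. n * (n + 5) + (n + 5)"])
    show "ptime ?subs" by (intro ptime_intros)
    show "ptime ?step" by (intro ptime_intros)
    show "poly_bd (\<lambda>n. n * (n + 5) + (n + 5))" by (intro poly_bd_intros)
    fix q :: "bool \<times> dt"
    obtain s A where q: "q = (s, A)" by force
    show "h q = ?step (q, map h (?subs q))"
      by (cases A) (simp_all add: h_def q leaf_arg_def dec_args_def)
    show "sum_list (map (\<lambda>q. sz (snd q)) (?subs q)) < sz (snd q)"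
    proof (cases A)
      case (DLit p)
      then show ?thesis using sz_pos[of "DLit p"] by (simp add: q)
    next
      case (Dec B p C)
      then show ?thesis using sz_Dec[of B p C] by (simp add: q dec_args_def)
    qed
    show "sz (snd q) \<le> sz q" by (simp add: q)
    show "sz r \<le> sz q" if "r \<in> set (?subs q)" for r
    proof (cases A)
      case (Dec B p C)
      then show ?thesis using that sz_Dec[of B p C] by (auto simp: q dec_args_def)
    qed (use that q in simp)
    show "sz (h q) \<le> sum_list (map (sz \<circ> h) (?subs q)) + (sz q * (sz q + 5) + (sz q + 5))"
    proof (cases A)
      case (DLit p)
      have "sz p \<le> sz (DLit p)" using sz_node[OF encode_simps(3)[of p]] by (simp add: sz_def)
      then show ?thesis by (simp add: q h_def DLit)
    next
      case (Dec B p C)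
      have "length (branches s B) * Suc (sz (edge s p)) \<le> sz B * (sz q + 5)"
        using length_branches[of s B] sz_edge[of s p] sz_Dec[of B p C]
        by (intro mult_le_mono) (simp_all add: q Dec)
      moreover have "length (branches s C) * Suc (sz (edge (\<not> s) p)) \<le> sz C * (sz q + 5)"
        using length_branches[of s C] sz_edge[of "\<not> s" p] sz_Dec[of B p C]
        by (intro mult_le_mono) (simp_all add: q Dec)
      moreover have "sz B * (sz q + 5) + sz C * (sz q + 5) \<le> sz q * (sz q + 5)"
        unfolding distrib_right[symmetric] using sz_Dec[of B p C]
        by (intro mult_le_mono) (simp_all add: q Dec)
      moreover have "sz (h q) \<le> sz (map (\<lambda>b. (edge s p # fst b, snd b)) (branches s B)) +
          sz (map (\<lambda>b. (edge (\<not> s) p # fst b, snd b)) (branches s C))"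
        using sz_append[of "map (\<lambda>b. (edge s p # fst b, snd b)) (branches s B)"
            "map (\<lambda>b. (edge (\<not> s) p # fst b, snd b)) (branches s C)"] by (simp add: h_def q Dec)
      moreover have "sum_list (map (sz \<circ> h) (?subs q)) = sz (branches s B) + sz (branches s C)"
        by (simp add: q Dec h_def dec_args_def)
      ultimately show ?thesis
        unfolding sz_map_prefix by linarith
    qed
  qed
  then have "ptime (\<lambda>x. h (f x, g x))"
    by (rule ptime_compose) (intro ptime_intros assms)
  then show ?thesis by (simp add: h_def)
qed

lemma ptime_fm_of [ptime_intros]:
  assumes "ptime s" "ptime f" "ptime g"
  shows "ptime (\<lambda>x. fm_of (s x) (f x) (g x))"
proof -
  have "ptime (\<lambda>x. (\<lambda>(sq, ls). fm_of (fst sq) ls (snd sq)) ((s x, g x), f x))"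
  proof (rule ptime_list_rec[where base = "\<lambda>sq. FLit (snd sq)" and q = "\<lambda>n. n + 20"
        and step = "\<lambda>z. conn (\<not> fst (fst z)) (FLit (fst (snd z))) (snd (snd (snd z)))"])
    show "sz (case (p, x # xs) of (sq, ls) \<Rightarrow> fm_of (fst sq) ls (snd sq)) \<le>
      sz (case (p, xs) of (sq, ls) \<Rightarrow> fm_of (fst sq) ls (snd sq)) + (sz (p, x # xs) + 20)"
      for p :: "bool \<times> lit" and x xs
      by (simp add: conn_def sz_def encode_simps enc_node_def enc_nat.simps[of "Suc 0"] enc_nat.simps[of 2])
  qed (intro ptime_intros assms poly_bd_intros | simp)+
  then show ?thesis by simp
qed

lemma ptime_branch_fm [ptime_intros]: "ptime f \<Longrightarrow> ptime g \<Longrightarrow> ptime (\<lambda>x. branch_fm (f x) (g x))"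
  unfolding branch_fm_def by (intro ptime_intros)

lemma ptime_trans_fm [ptime_intros]:
  assumes "ptime f" "ptime g"
  shows "ptime (\<lambda>x. trans_fm (f x) (g x))"
  unfolding trans_fm_def by (intro ptime_intros assms[THEN ptime_compose])

lemma ptime_trans_cedents [ptime_intros]:
  assumes "ptime f" "ptime g"
  shows "ptime (\<lambda>x. trans_cedents (f x) (g x))"
  unfolding trans_cedents_def by (intro ptime_intros assms[THEN ptime_compose])

lemma ptime_lefts [ptime_intros]: "ptime f \<Longrightarrow> ptime (\<lambda>x. lefts (f x))"
  unfolding lefts_def by (intro ptime_intros)

lemma ptime_rights [ptime_intros]: "ptime f \<Longrightarrow> ptime (\<lambda>x. rights (f x))"
  unfolding rights_def by (intro ptime_intros)

lemma ptime_rules [ptime_intros]: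
  assumes "ptime f" "ptime g"
  shows "ptime (\<lambda>x. weak_rule (f x) (g x))" "ptime (\<lambda>x. contr_rule (f x) (g x))"
  unfolding weak_rule_def contr_rule_def by (intro ptime_intros assms)+

lemma ptime_cut_rule [ptime_intros]:
  "ptime f \<Longrightarrow> ptime g \<Longrightarrow> ptime (\<lambda>x. cut_rule (f x) (g x))"
  unfolding cut_rule_def by (intro ptime_intros)

lemma ptime_logical_rules [ptime_intros]:
  assumes "ptime s" "ptime f" "ptime g" "ptime h"
  shows "ptime (\<lambda>x. alpha_rule (s x) (f x) (g x) (h x))" "ptime (\<lambda>x. beta_rule (s x) (f x) (g x) (h x))"
  unfolding alpha_rule_def beta_rule_def by (intro ptime_intros assms)+

lemma encode_concl: "encode (concl d) = car (cdr (cdr (encode d)))"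
  by (cases d) (simp_all add: encode_simps)

lemma ptime_concl [ptime_intros]: "ptime f \<Longrightarrow> ptime (\<lambda>x. concl (f x))"
proof (erule ptime_via_data[rotated 2])
  show "ptime (\<lambda>d. car (cdr (cdr d)))" by (intro ptime_intros)
qed (simp add: encode_concl)

lemma ptime_splits [ptime_intros]:
  fixes f :: "'a::enc \<Rightarrow> 'b::enc list"
  assumes "ptime f"
  shows "ptime (\<lambda>x. splits (f x))"
proof -
  have "ptime (\<lambda>x. (\<lambda>(u, xs). splits xs) ((), f x))"
  proof (rule ptime_list_rec[where base = "\<lambda>u. []" and q = "\<lambda>n. n * (n + 1) + (n + 4)"
        and step = "\<lambda>z. ([], fst (snd z), fst (snd (snd z))) #
          map (\<lambda>p. (fst (snd z) # fst p, snd p)) (snd (snd (snd z)))"])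
    show "sz (case (u, x # xs) of (u, xs) \<Rightarrow> splits xs) \<le>
      sz (case (u, xs) of (u, xs) \<Rightarrow> splits xs) + (sz (u, x # xs) * (sz (u, x # xs) + 1) + (sz (u, x # xs) + 4))"
      for u :: unit and x :: 'b and xs
    proof -
      \<comment> \<open>The new element is added to the prefix of every later split.\<close>
      have "length xs * Suc (sz x) \<le> sz (u, x # xs) * (sz (u, x # xs) + 1)"
        using length_less_sz[of xs] by (intro mult_le_mono) simp_all
      then show ?thesis
        using sz_map_prefix[of x "splits xs"] by simp
    qed
  qed (intro ptime_intros assms poly_bd_intros | simp)+
  then show ?thesis by simp
qed

lemma ptime_chain [ptime_intros]:
  assumes "ptime f" "ptime g"
  shows "ptime (\<lambda>x. chain (f x) (g x))"
proof -
  have "ptime (\<lambda>x. (\<lambda>(d, sts). chain sts d) (g x, f x))"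
  proof (rule ptime_list_rec[where base = "\<lambda>d. d" and q = "\<lambda>n. n + 20"
        and step = "\<lambda>z. Inf (fst (fst (snd z))) (fst (snd (fst (snd z))))
          (fst (snd (snd (fst (snd z)))) @ snd (snd (snd z)) # snd (snd (snd (fst (snd z)))))"])
    show "sz (case (p, st # sts) of (d, sts) \<Rightarrow> chain sts d) \<le>
      sz (case (p, sts) of (d, sts) \<Rightarrow> chain sts d) + (sz (p, st # sts) + 20)" for p st sts
    proof -
      obtain r S ls rs where st: "st = (r, S, ls, rs)" by (cases st)
      have "sz (Inf r S (ls @ chain sts p # rs)) \<le> sz r + sz S + sz (ls @ chain sts p # rs) + 10"
        by (simp add: sz_def encode_simps enc_node_def enc_nat.simps[of "Suc 0"])
      moreover have "sz (ls @ chain sts p # rs) \<le> sz ls + sz rs + sz (chain sts p)"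
        using sz_append[of ls "chain sts p # rs"] by simp
      ultimately show ?thesis by (simp add: chain_def st)
    qed
  qed (intro ptime_intros assms poly_bd_intros | simp add: chain_def)+
  then show ?thesis by simp
qed

lemma ptime_remove1 [ptime_intros]:
  assumes "ptime f" "ptime g"
  shows "ptime (\<lambda>x. remove1 (f x :: sfm) (g x))"
proof -
  have "ptime (\<lambda>x. (\<lambda>(y, ys). remove1 (y::sfm) ys) (f x, g x))"
    by (rule ptime_list_rec[where base = "\<lambda>u. []" and q = "\<lambda>n. n"
        and step = "\<lambda>z. if fst z = fst (snd z) then fst (snd (snd z)) else fst (snd z) # snd (snd (snd z))"])
      (intro ptime_intros assms poly_bd_intros | auto)+
  then show ?thesis by simp
qed

lemma ptime_structural [ptime_intros]:
  assumes "ptime f" "ptime g"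
  shows "ptime (\<lambda>x. structural (f x) (g x))"
  unfolding structural_def by (intro ptime_intros assms[THEN ptime_compose])

lemma ptime_multicut [ptime_intros]:
  assumes "ptime s" "ptime f" "ptime g" "ptime h"
  shows "ptime (\<lambda>x. multicut (s x) (f x) (g x) (h x))"
  unfolding multicut_def by (intro ptime_intros assms[THEN ptime_compose])

lemma ptime_inits [ptime_intros]:
  assumes "ptime f"
  shows "ptime (\<lambda>x. init (f x))" "ptime (\<lambda>x. init_left (f x))" "ptime (\<lambda>x. init_right (f x))"
  unfolding init_def init_left_def init_right_def by (intro ptime_intros assms)+

lemma ptime_lits [ptime_intros]:
  assumes "ptime f" "ptime g"
  shows "ptime (\<lambda>x. lits (f x) (g x))"
  unfolding lits_def by (intro ptime_intros assms[THEN ptime_compose])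

lemma ptime_collapse [ptime_intros]:
  assumes "ptime s" "ptime f" "ptime g" "ptime h"
  shows "ptime (\<lambda>x. collapse (s x) (f x) (g x) (h x))"
  unfolding collapse_def by (intro ptime_intros assms[THEN ptime_compose])

lemma ptime_expand [ptime_intros]:
  assumes "ptime f" "ptime g"
  shows "ptime (\<lambda>x. expand (f x) (g x))"
  unfolding expand_def by (intro ptime_intros assms[THEN ptime_compose])

lemma ptime_identity [ptime_intros]: "ptime f \<Longrightarrow> ptime g \<Longrightarrow> ptime (\<lambda>x. identity (f x) (g x))"
  unfolding identity_def by (intro ptime_intros)

lemma ptime_prefixed [ptime_intros]:
  assumes "ptime s" "ptime f" "ptime g" "ptime h" "ptime i"
  shows "ptime (\<lambda>x. prefixed (s x) (f x) (g x) (h x) (i x))"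
  unfolding prefixed_def by (intro ptime_intros assms)

lemma ptime_common_lit [ptime_intros]:
  assumes "ptime f" "ptime g"
  shows "ptime (\<lambda>x. common_lit (f x) (g x))"
  unfolding common_lit_def by (intro ptime_intros assms[THEN ptime_compose])

lemma ptime_clash [ptime_intros]:
  assumes "ptime s" "ptime f" "ptime g"
  shows "ptime (\<lambda>x. clash (s x) (f x) (g x))"
  unfolding clash_def by (intro ptime_intros assms)

lemma ptime_cut_deriv [ptime_intros]:
  assumes "ptime s" "ptime f" "ptime g"
  shows "ptime (\<lambda>x. cut_deriv (s x) (f x) (g x))"
  unfolding cut_deriv_def by (intro ptime_intros assms[THEN ptime_compose])

lemma ptime_dec_half [ptime_intros]:
  assumes "ptime s" "ptime l" "ptime f" "ptime g" "ptime h" "ptime i" "ptime j"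
  shows "ptime (\<lambda>x. dec_half (s x) (l x) (f x) (g x) (h x) (i x) (j x))"
  unfolding dec_half_def by (intro ptime_intros assms[THEN ptime_compose])

lemma ptime_dec_deriv [ptime_intros]:
  assumes "ptime s" "ptime f" "ptime g" "ptime h" "ptime i"
  shows "ptime (\<lambda>x. dec_deriv (s x) (f x) (g x) (h x) (i x))"
  unfolding dec_deriv_def by (intro ptime_intros assms)

section \<open>Arguments of rules and derivations\<close>

definition rule_lit :: "dt common_rule \<Rightarrow> lit \<times> unit" where
  "rule_lit r = (case r of Init p \<Rightarrow> (p, ()) | InitL p \<Rightarrow> (p, ()) | InitR p \<Rightarrow> (p, ()) | _ \<Rightarrow> undefined)"

definition rule_args :: "dt common_rule \<Rightarrow> dt \<times> dt list \<times> dt list \<times> unit" where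
  "rule_args r = (case r of ContrL A \<Gamma> \<Delta> \<Rightarrow> (A, \<Gamma>, \<Delta>, ()) | ContrR A \<Gamma> \<Delta> \<Rightarrow> (A, \<Gamma>, \<Delta>, ())
     | WeakL A \<Gamma> \<Delta> \<Rightarrow> (A, \<Gamma>, \<Delta>, ()) | WeakR A \<Gamma> \<Delta> \<Rightarrow> (A, \<Gamma>, \<Delta>, ()) | Cut A \<Gamma> \<Delta> \<Rightarrow> (A, \<Gamma>, \<Delta>, ())
     | _ \<Rightarrow> undefined)"

definition common_arg :: "ldt_rule \<Rightarrow> dt common_rule \<times> unit" where
  "common_arg r = (case r of LDTCommon r' \<Rightarrow> (r', ()) | _ \<Rightarrow> undefined)"

definition dec_rule_args :: "ldt_rule \<Rightarrow> dt \<times> lit \<times> dt \<times> dt list \<times> dt list \<times> unit" where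
  "dec_rule_args r = (case r of DecL A p B \<Gamma> \<Delta> \<Rightarrow> (A, p, B, \<Gamma>, \<Delta>, ())
     | DecR A p B \<Gamma> \<Delta> \<Rightarrow> (A, p, B, \<Gamma>, \<Delta>, ()) | _ \<Rightarrow> undefined)"

definition hyp_args :: "deriv \<Rightarrow> bool \<times> sfm list \<times> unit" where
  "hyp_args d = (case d of Hyp b S \<Rightarrow> (b, S, ()) | _ \<Rightarrow> undefined)"

definition inf_args :: "deriv \<Rightarrow> lk_rule \<times> sfm list \<times> deriv list \<times> unit" where
  "inf_args d = (case d of Inf r S ds \<Rightarrow> (r, S, ds, ()) | _ \<Rightarrow> undefined)"

lemma ptime_rule_lit [ptime_intros]: "ptime f \<Longrightarrow> ptime (\<lambda>x. rule_lit (f x))"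
proof (erule ptime_select[rotated])
  show "encode (rule_lit r) = (if has_tag 0 r \<or> has_tag 1 r \<or> has_tag 2 r then cdr (encode r)
      else encode (undefined :: lit \<times> unit))" for r
    by (cases r) (simp_all add: rule_lit_def, simp_all add: encode_common_simps)
qed

lemma ptime_rule_args [ptime_intros]: "ptime f \<Longrightarrow> ptime (\<lambda>x. rule_args (f x))"
proof (erule ptime_via_data[rotated 2])
  show "ptime (\<lambda>d. if car d = enc_nat 0 then encode (undefined :: dt \<times> dt list \<times> dt list \<times> unit)
      else if car d = enc_nat 1 then encode (undefined :: dt \<times> dt list \<times> dt list \<times> unit)
      else if car d = enc_nat 2 then encode (undefined :: dt \<times> dt list \<times> dt list \<times> unit) else cdr d)"
    by (intro ptime_intros)
  show "encode (rule_args r) = encode (if car (encode r) = enc_nat 0 then encode (undefined :: dt \<times> dt list \<times> dt list \<times> unit)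
      else if car (encode r) = enc_nat 1 then encode (undefined :: dt \<times> dt list \<times> dt list \<times> unit)
      else if car (encode r) = enc_nat 2 then encode (undefined :: dt \<times> dt list \<times> dt list \<times> unit)
      else cdr (encode r))" for r
    unfolding has_tag_def[symmetric]
    by (cases r) (simp_all add: rule_args_def, simp_all add: encode_common_simps)
qed

lemma ptime_common_arg [ptime_intros]: "ptime f \<Longrightarrow> ptime (\<lambda>x. common_arg (f x))"
proof (erule ptime_select[rotated])
  show "encode (common_arg r) = (if has_tag 0 r \<or> has_tag 0 r \<or> has_tag 0 r then cdr (encode r)
      else encode (undefined :: dt common_rule \<times> unit))" for r
    by (cases r) (simp_all add: common_arg_def, simp_all add: encode_ldt_rule_simps)
qed

lemma ptime_dec_rule_args [ptime_intros]: "ptime f \<Longrightarrow> ptime (\<lambda>x. dec_rule_args (f x))"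
proof (erule ptime_select[rotated])
  show "encode (dec_rule_args r) = (if has_tag 1 r \<or> has_tag 2 r \<or> has_tag 2 r then cdr (encode r)
      else encode (undefined :: dt \<times> lit \<times> dt \<times> dt list \<times> dt list \<times> unit))" for r
    by (cases r) (simp_all add: dec_rule_args_def, simp_all add: encode_ldt_rule_simps)
qed

lemma ptime_hyp_args [ptime_intros]: "ptime f \<Longrightarrow> ptime (\<lambda>x. hyp_args (f x))"
proof (erule ptime_select[rotated])
  show "encode (hyp_args d) = (if has_tag 0 d \<or> has_tag 0 d \<or> has_tag 0 d then cdr (encode d)
      else encode (undefined :: bool \<times> sfm list \<times> unit))" for d
    by (cases d) (simp_all add: hyp_args_def, simp_all add: encode_deriv_simps)
qed

lemma ptime_inf_args [ptime_intros]: "ptime f \<Longrightarrow> ptime (\<lambda>x. inf_args (f x))"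
proof (erule ptime_select[rotated])
  show "encode (inf_args d) = (if has_tag 1 d \<or> has_tag 1 d \<or> has_tag 1 d then cdr (encode d)
      else encode (undefined :: lk_rule \<times> sfm list \<times> deriv list \<times> unit))" for d
    by (cases d) (simp_all add: inf_args_def, simp_all add: encode_deriv_simps)
qed

text \<open>Pattern matching is rewritten as a cascade of tag tests with selectors, to which the
  introduction rules apply.\<close>

lemma ptime_common_deriv [ptime_intros]:
  assumes "ptime f" "ptime g"
  shows "ptime (\<lambda>x. common_deriv (f x) (g x))"
proof -
  let ?A = "\<lambda>r. fst (rule_args r)"
    and ?S = "\<lambda>r. trans_cedents (fst (snd (rule_args r))) (fst (snd (snd (rule_args r))))"
  have "common_deriv s r = (if has_tag 0 r then init (fst (rule_lit r))
    else if has_tag 1 r then init_left (fst (rule_lit r))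
    else if has_tag 2 r then init_right (fst (rule_lit r))
    else if has_tag 3 r then structural (trans_fm False (?A r) @ ?S r)
      (Hyp True (trans_fm False (?A r) @ trans_fm False (?A r) @ ?S r))
    else if has_tag 4 r then structural (trans_fm True (?A r) @ ?S r)
      (Hyp True (trans_fm True (?A r) @ trans_fm True (?A r) @ ?S r))
    else if has_tag 5 r then structural (trans_fm False (?A r) @ ?S r) (Hyp True (?S r))
    else if has_tag 6 r then structural (trans_fm True (?A r) @ ?S r) (Hyp True (?S r))
    else cut_deriv s (?A r) (?S r))" for s r
    by (cases r) (simp_all add: rule_lit_def rule_args_def)
  then show ?thesis
    by (simp only:) (intro ptime_intros assms)
qed

lemma ptime_rule_deriv [ptime_intros]:
  assumes "ptime f" "ptime g"
  shows "ptime (\<lambda>x. rule_deriv (f x) (g x))"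
proof -
  let ?S = "\<lambda>r. trans_cedents (fst (snd (snd (snd (dec_rule_args r))))) (fst (snd (snd (snd (snd (dec_rule_args r))))))"
  have "rule_deriv s r = (if has_tag 0 r then common_deriv s (fst (common_arg r))
    else dec_deriv (if has_tag 1 r then False else True) (fst (dec_rule_args r)) (fst (snd (dec_rule_args r)))
      (fst (snd (snd (dec_rule_args r)))) (?S r))" for s r
    by (cases r) (simp_all add: common_arg_def dec_rule_args_def)
  then show ?thesis
    by (simp only:) (intro ptime_intros assms)
qed

lemma sum_sz: "sz xs = Suc (sum_list (map sz xs) + length xs)"
  by (induction xs) auto

lemma sz_concat: "sz (concat xss) \<le> Suc (sum_list (map sz xss))"
proof (induction xss)
  case (Cons xs xss)
  then show ?case using sz_append[of xs "concat xss"] by simp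
qed simp

lemma sz_Inf: "sz (Inf r S ds) = sz r + sz S + sz ds + 10"
  by (simp add: sz_def encode_deriv_simps enc_node_def enc_nat.simps[of "Suc 0"])

lemma sz_Hyp: "sz S \<le> sz (Hyp b S)"
  by (simp add: sz_def encode_deriv_simps enc_node_def)

lemma sz_concl: "sz (concl d) \<le> sz d"
  by (cases d) (simp_all add: sz_Inf sz_Hyp)

lemma sz_map_concl: "sz (map concl ds) \<le> sz ds"
  by (induction ds) (use sz_concl in \<open>auto intro: add_mono\<close>)

lemma ptime_flatten [ptime_intros]: "ptime f \<Longrightarrow> ptime (\<lambda>x. flatten (f x))"
proof (erule ptime_compose[rotated])
  let ?kids = "\<lambda>d. if has_tag 0 d then [] else fst (snd (snd (inf_args d)))"
  let ?step = "\<lambda>z::deriv \<times> line list list. if has_tag 0 (fst z) then []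
    else concat (snd z) @ [(fst (inf_args (fst z)), fst (snd (inf_args (fst z))), map concl (?kids (fst z)))]"
  show "ptime flatten"
  proof (rule ptime_recursion[where subs = ?kids and step = ?step and m = sz and q = "\<lambda>n. n + n + 10"])
    show "ptime ?kids" by (intro ptime_intros)
    show "ptime ?step" by (intro ptime_intros)
    fix d :: deriv
    show "flatten d = ?step (d, map flatten (?kids d))"
      by (cases d) (simp_all add: inf_args_def)
    show "sum_list (map sz (?kids d)) < sz d"
    proof (cases d)
      case (Inf r S ds)
      then show ?thesis using sum_sz[of ds] by (simp add: inf_args_def sz_Inf)
    qed (use sz_pos[of d] in simp)
    show "sz d \<le> sz d" ..
    show "sz e \<le> sz d" if "e \<in> set (?kids d)" for e
    proof (cases d)
      case (Inf r S ds)
      then show ?thesis using that sz_mem_list[of e ds] by (simp add: inf_args_def sz_Inf)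
    qed (use that in simp)
    show "sz (flatten d) \<le> sum_list (map (sz \<circ> flatten) (?kids d)) + (sz d + sz d + 10)"
    proof (cases d)
      case (Inf r S ds)
      have "sz (flatten d) \<le> sz (concat (map flatten ds)) + sz [(r, S, map concl ds)]"
        using sz_append[of "concat (map flatten ds)" "[(r, S, map concl ds)]"] by (simp add: Inf)
      then show ?thesis
        using sz_concat[of "map flatten ds"] sz_map_concl[of ds]
        by (simp add: Inf inf_args_def sz_Inf comp_def)
    qed simp
  qed (intro poly_bd_intros)
qed

text \<open>Both proofs to be inserted belong to the argument, so the copy made at a hypothesis
  stays within the additive allowance.\<close>

lemma ptime_fill [ptime_intros]:
  assumes "ptime f" "ptime g" "ptime h"
  shows "ptime (\<lambda>x. fill (f x) (g x) (h x))"
proof -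
  let ?h = "\<lambda>x::(lk_rule ptree \<times> lk_rule ptree) \<times> deriv. fill (fst (fst x)) (snd (fst x)) (snd x)"
  let ?kids = "\<lambda>d. if has_tag 0 d then [] else fst (snd (snd (inf_args d)))"
  let ?subs = "\<lambda>x::(lk_rule ptree \<times> lk_rule ptree) \<times> deriv. map (Pair (fst x)) (?kids (snd x))"
  let ?step = "\<lambda>z::((lk_rule ptree \<times> lk_rule ptree) \<times> deriv) \<times> lk_rule ptree list.
    if has_tag 0 (snd (fst z)) then if fst (hyp_args (snd (fst z))) then fst (fst (fst z)) else snd (fst (fst z))
    else Infer (fst (inf_args (snd (fst z)))) (snd z)"
  have "ptime ?h"
  proof (rule ptime_recursion[where subs = ?subs and step = ?step and m = "\<lambda>x. sz (snd x)" and q = "\<lambda>n. n"])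
    show "ptime ?subs" by (intro ptime_intros)
    show "ptime ?step" by (intro ptime_intros)
    fix x :: "(lk_rule ptree \<times> lk_rule ptree) \<times> deriv"
    obtain t u d where x: "x = ((t, u), d)" by (metis surj_pair)
    show "?h x = ?step (x, map ?h (?subs x))"
      by (cases d) (simp_all add: x inf_args_def hyp_args_def comp_def)
    show "sum_list (map (\<lambda>x. sz (snd x)) (?subs x)) < sz (snd x)"
    proof (cases d)
      case (Inf r S ds)
      then show ?thesis using sum_sz[of ds] by (simp add: x inf_args_def sz_Inf comp_def)
    qed (use sz_pos[of d] x in simp)
    show "sz (snd x) \<le> sz x" by (simp add: x)
    show "sz y \<le> sz x" if y: "y \<in> set (?subs x)" for y
    proof (cases d)
      case (Inf r S ds)
      then obtain e where "e \<in> set ds" "y = ((t, u), e)" using y by (auto simp: x inf_args_def)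
      then show ?thesis using sz_mem_list[of e ds] by (simp add: x Inf sz_Inf)
    qed (use y x in simp)
    show "sz (?h x) \<le> sum_list (map (sz \<circ> ?h) (?subs x)) + sz x"
    proof (cases d)
      case (Inf r S ds)
      have "sz (?h x) = Suc (sz r + sz (map (fill t u) ds))"
        by (simp add: x Inf sz_def encode_Infer)
      then show ?thesis
        using sum_sz[of ds] by (simp add: x Inf inf_args_def sz_Inf comp_def sum_sz[of "map (fill t u) ds"])
    qed (simp add: x)
  qed (intro poly_bd_intros)
  then have "ptime (\<lambda>x. ?h ((f x, g x), h x))"
    by (rule ptime_compose) (intro ptime_intros assms)
  then show ?thesis by simp
qed

text \<open>Multiplicities are compared in unary, as lists of units, which reduces equality of
  multisets to filters, maps and equality of lists.\<close>

lemma mset_eq_iff_filter: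
  "mset xs = mset ys \<longleftrightarrow> filter (\<lambda>x. map (\<lambda>_. ()) (filter (\<lambda>y. y = x) xs) \<noteq>
     map (\<lambda>_. ()) (filter (\<lambda>y. y = x) ys)) (xs @ ys) = []"
proof -
  have len: "map (\<lambda>_. ()) us = map (\<lambda>_. ()) vs \<longleftrightarrow> length us = length vs" for us vs :: "'a list"
    by (auto simp: map_replicate_const dest: arg_cong[where f = length])
  have cnt: "length (filter (\<lambda>y. y = x) zs) = count (mset zs) x" for x and zs :: "'a list"
    by (induction zs) auto
  have "mset xs = mset ys \<longleftrightarrow> (\<forall>x \<in> set (xs @ ys). count (mset xs) x = count (mset ys) x)"
  proof
    assume *: "\<forall>x \<in> set (xs @ ys). count (mset xs) x = count (mset ys) x"
    show "mset xs = mset ys"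
    proof (rule multiset_eqI)
      fix x show "count (mset xs) x = count (mset ys) x"
        using * by (cases "x \<in> set (xs @ ys)") (auto simp: count_eq_zero_iff[THEN iffD2])
    qed
  qed simp
  then show ?thesis
    unfolding len cnt filter_empty_conv by blast
qed

lemma ptime_mset_eq [ptime_intros]:
  assumes "ptime f" "ptime g"
  shows "ptime (\<lambda>x. mset (f x :: sfm list) = mset (g x))"
  unfolding mset_eq_iff_filter by (intro ptime_intros assms[THEN ptime_compose])

lemma ptime_position [ptime_intros]:
  assumes "ptime f" "ptime g"
  shows "ptime (\<lambda>x. position (f x) (g x))"
  unfolding position_def by (intro ptime_intros assms[THEN ptime_compose])

lemma ptime_resolve [ptime_intros]:
  assumes "ptime f"
  shows "ptime (\<lambda>x. resolve (f x))"
  unfolding resolve_def by (intro ptime_intros assms[THEN ptime_compose])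

lemma ptime_dag_trans: "ptime dag_trans"
  unfolding dag_trans_def by (intro ptime_intros)

section \<open>From computable translations to programs with bounded running time\<close>

lemma encode_dag:
  "encode (\<pi> :: ldt_rule dag) = enc_dag enc_ldt_rule \<pi>" "encode (\<pi>' :: lk_rule dag) = enc_dag enc_lk_rule \<pi>'"
  by (simp_all add: enc_dag_def encode_list_def encode_prod_def encode_ldt_rule_def encode_lk_rule_def
      encode_nat_def split_beta)

lemma encode_tree:
  "encode (\<tau> :: ldt_rule ptree) = enc_tree enc_ldt_rule \<tau>" "encode (\<tau>' :: lk_rule ptree) = enc_tree enc_lk_rule \<tau>'"
  by (simp_all add: encode_ptree_def encode_ldt_rule_def encode_lk_rule_def)

lemma poly_bd_imp_polynomially_bounded:
  assumes "poly_bd b"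
  shows "polynomially_bounded b"
proof -
  obtain c k where b: "\<And>n. b n \<le> c * Suc n ^ k"
    using assms by (auto simp: poly_bd_def)
  have "real (b n) \<le> real (c * 2 ^ k) * real n ^ k" if "n \<ge> 1" for n
  proof -
    have "Suc n ^ k \<le> (2 * n) ^ k" using that by (intro power_mono) simp_all
    then have "b n \<le> c * (2 * n) ^ k" using b[of n] by (meson le_trans mult_le_mono2)
    then have "real (b n) \<le> real (c * (2 * n) ^ k)" by (simp only: of_nat_le_iff)
    then show ?thesis by (simp add: power_mult_distrib)
  qed
  then have "(\<lambda>n. real (b n)) \<in> O(\<lambda>n. real n ^ k)"
    by (intro bigoI[where c = "real (c * 2 ^ k)"] eventually_sequentiallyI[of 1]) simp
  then show ?thesis by (auto simp: polynomially_bounded_def)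
qed

lemma run_of_eval:
  assumes "P \<noteq> []" "eval P [encode x] (P ! 0) (encode y) t" "t \<le> b"
  shows "\<exists>t'. run P (encode x) (encode y) t' \<and> t' \<le> 2 + sz x + (b + b)"
proof (intro exI conjI)
  show "run P (encode x) (encode y) ((1 + sz x) + t + 1 + sz y)"
    unfolding run_def sz_def using assms(1)
    by (intro eval.Call[OF _ _ assms(2)] eval_arg[unfolded sz_def]) simp
  show "(1 + sz x) + t + 1 + sz y \<le> 2 + sz x + (b + b)"
    using dsize_le_time[OF assms(2)] assms(3) by (simp add: sz_def)
qed

lemma dag_simulation:
  "\<exists>P T. polynomially_bounded T \<and>
      (\<forall>\<pi> S. LDT_proof \<pi> S \<longrightarrow>
        (\<exists>\<pi>' t. run P (enc_dag enc_ldt_rule \<pi>) (enc_dag enc_lk_rule \<pi>') t \<and>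
           t \<le> T (dsize (enc_dag enc_ldt_rule \<pi>)) \<and>
           LK1_proof \<pi>' (cls_tms S)))"
proof -
  obtain P b where P: "poly_bd b" "computes P b dag_trans"
    using ptime_dag_trans by (auto simp: ptime_def)
  have "polynomially_bounded (\<lambda>n. 2 + n + (b n + b n))"
    by (intro poly_bd_imp_polynomially_bounded poly_bd_intros P)
  moreover have "\<exists>\<pi>' t. run P (enc_dag enc_ldt_rule \<pi>) (enc_dag enc_lk_rule \<pi>') t \<and>
      t \<le> 2 + dsize (enc_dag enc_ldt_rule \<pi>) + (b (dsize (enc_dag enc_ldt_rule \<pi>)) + b (dsize (enc_dag enc_ldt_rule \<pi>))) \<and>
      LK1_proof \<pi>' (cls_tms S)" if "LDT_proof \<pi> S" for \<pi> S
  proof -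
    obtain t where "eval P [encode \<pi>] (P ! 0) (encode (dag_trans \<pi>)) t" "t \<le> b (sz \<pi>)"
      using P(2) by (auto simp: computes_def)
    with P(2) obtain t' where "run P (encode \<pi>) (encode (dag_trans \<pi>)) t'" "t' \<le> 2 + sz \<pi> + (b (sz \<pi>) + b (sz \<pi>))"
      using run_of_eval unfolding computes_def by blast
    then show ?thesis
      using LK1_proof_dag_trans[OF that] unfolding sz_def encode_dag by blast
  qed
  ultimately show ?thesis by blast
qed

section \<open>The translation of tree-like proofs\<close>

lemma ptime_length_le [ptime_intros]:
  fixes f g :: "'a::enc \<Rightarrow> unit list"
  assumes "ptime f" "ptime g"
  shows "ptime (\<lambda>x. length (f x) \<le> length (g x))"
proof -
  let ?h = "\<lambda>p::unit list \<times> unit list. length (fst p) \<le> length (snd p)"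
  let ?subs = "\<lambda>p::unit list \<times> unit list. if fst p = [] then [] else if snd p = [] then [] else [(tl (fst p), tl (snd p))]"
  let ?step = "\<lambda>z::(unit list \<times> unit list) \<times> bool list.
    if fst (fst z) = [] then True else if snd (fst z) = [] then False else hd (snd z)"
  have "ptime ?h"
  proof (rule ptime_recursion[where subs = ?subs and step = ?step and m = "\<lambda>p. Suc (length (fst p))" and q = "\<lambda>n. 3"])
    show "ptime ?subs" by (intro ptime_intros)
    show "ptime ?step" by (intro ptime_intros)
    fix p :: "unit list \<times> unit list"
    obtain xs ys where p: "p = (xs, ys)" by force
    show "?h p = ?step (p, map ?h (?subs p))"
      by (cases xs; cases ys) (simp_all add: p)
    show "sum_list (map (\<lambda>p. Suc (length (fst p))) (?subs p)) < Suc (length (fst p))"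
      by (cases xs; cases ys) (simp_all add: p)
    show "Suc (length (fst p)) \<le> sz p"
      using length_less_sz[of xs] by (simp add: p)
    show "sz r \<le> sz p" if "r \<in> set (?subs p)" for r
      using that by (cases xs; cases ys) (simp_all add: p)
    show "sz (?h p) \<le> sum_list (map (sz \<circ> ?h) (?subs p)) + 3"
      using sz_bool le_add2 le_trans by blast
  qed (intro poly_bd_intros)
  then have "ptime (\<lambda>x. ?h (f x, g x))"
    by (rule ptime_compose) (intro ptime_intros assms)
  then show ?thesis by simp
qed

text \<open>The size in unary has polynomial length, so sizes can be compared by stepping through
  two lists at once.\<close>

primrec units :: "data \<Rightarrow> unit list" where
  "units Nul = [()]"
| "units (Dot x y) = () # units x @ units y"

lemma length_units: "length (units d) = dsize d"
  by (induction d) auto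

lemma ptime_units [ptime_intros]: "ptime f \<Longrightarrow> ptime (\<lambda>x. units (f x))"
proof (erule ptime_compose[rotated])
  let ?subs = "\<lambda>d::data. if d = Nul then [] else [car d, cdr d]"
  let ?step = "\<lambda>z::data \<times> unit list list. if fst z = Nul then [()] else () # hd (snd z) @ hd (tl (snd z))"
  show "ptime units"
  proof (rule ptime_recursion[where subs = ?subs and step = ?step and m = dsize and q = "\<lambda>n. 3"])
    show "ptime ?subs" by (intro ptime_intros)
    show "ptime ?step" by (intro ptime_intros)
    fix d :: data
    show "units d = ?step (d, map units (?subs d))"
      by (cases d) simp_all
    show "sum_list (map dsize (?subs d)) < dsize d" by (cases d) simp_all
    show "dsize d \<le> sz d" by (simp add: sz_def)
    show "sz r \<le> sz d" if "r \<in> set (?subs d)" for r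
      using that by (cases d) (auto simp: sz_def)
    show "sz (units d) \<le> sum_list (map (sz \<circ> units) (?subs d)) + 3"
    proof (cases d)
      case (Dot x y)
      then show ?thesis using sz_append[of "units x" "units y"] by simp
    qed simp
  qed (intro poly_bd_intros)
qed

lemma ptime_sz_le [ptime_intros]:
  assumes "ptime f" "ptime g"
  shows "ptime (\<lambda>x. sz (f x) \<le> sz (g x))"
  unfolding sz_def length_units[symmetric] by (intro ptime_intros ptime_encode assms)

lemma encode_last_rule: "encode (last_rule t) = car (encode t)"
  and encode_subproofs: "encode (subproofs t) = cdr (encode t)"
  by (cases t; simp add: encode_Infer)+

lemma ptime_last_rule [ptime_intros]: "ptime f \<Longrightarrow> ptime (\<lambda>x. last_rule (f x))"
  by (erule ptime_via_data[OF ptime_car, rotated]) (simp add: encode_last_rule)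

lemma ptime_subproofs [ptime_intros]: "ptime f \<Longrightarrow> ptime (\<lambda>x. subproofs (f x))"
  by (erule ptime_via_data[OF ptime_cdr, rotated]) (simp add: encode_subproofs)

lemma sz_Infer: "sz (Infer r ts) = Suc (sz r + sz ts)"
  by (simp add: sz_def encode_Infer)


section \<open>The size of the translation of tree-like proofs\<close>

fun uses :: "bool \<Rightarrow> deriv \<Rightarrow> nat" where
  "uses b (Hyp b' S) = (if b = b' then 1 else 0)"
| "uses b (Inf r S ds) = sum_list (map (uses b) ds)"

lemma uses_chain:
  "uses b (chain sts d) = uses b d +
     sum_list (map (\<lambda>st. sum_list (map (uses b) (fst (snd (snd st)))) + sum_list (map (uses b) (snd (snd (snd st))))) sts)"
  by (induction sts) (auto simp: chain_def)

lemma uses_structural [simp]: "uses b (structural S d) = uses b d"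
  by (simp add: structural_def uses_chain comp_def)

lemma sum_list_splits: "sum_list (map (\<lambda>p. f (fst (snd p))) (splits xs)) = sum_list (map f xs)"
  by (induction xs) (auto simp: comp_def)

lemma uses_multicut: "uses b (multicut s Xs S d) = uses b d + sum_list (map (\<lambda>y. uses b (snd y)) Xs)"
proof -
  have "uses b (multicut s Xs S d) = uses b d + sum_list (map (\<lambda>p. uses b (snd (fst (snd p)))) (splits Xs))"
    unfolding multicut_def uses_chain uses_structural map_map
    by (intro arg_cong2[where f = "(+)"] arg_cong[where f = sum_list] map_cong) auto
  then show ?thesis
    using sum_list_splits[of "\<lambda>y. uses b (snd y)" Xs] by simp
qed

lemma uses_init [simp]: "uses b (init p) = 0" "uses b (init_left p) = 0" "uses b (init_right p) = 0"
  by (simp_all add: init_def init_left_def init_right_def)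

lemma uses_collapse [simp]: "uses b (collapse s c R d) = uses b d"
  by (simp add: collapse_def uses_chain comp_def)

lemma uses_expand [simp]: "uses b (expand s c) = 0"
  by (simp add: expand_def uses_chain comp_def)

lemma uses_prefixed: "uses b (prefixed s l c z e) = uses b e"
  by (simp add: prefixed_def identity_def)

lemma uses_clash [simp]: "uses b (clash s c c') = 0"
  by (simp add: clash_def)

text \<open>Hypothesis \<open>\<not> s\<close> enters through the inner cuts, once for each branch
  of sign \<open>s\<close>; clashes use no hypotheses.\<close>

lemma uses_cut_deriv:
  "uses b (cut_deriv s A S) = (if b = s then 1 else length (branches s A))"
  by (cases "b = s") (simp_all add: cut_deriv_def uses_multicut comp_def sum_list_triv)

lemma uses_dec_deriv: "uses b (dec_deriv s A p B S) = 1"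
  by (simp add: dec_deriv_def dec_half_def uses_multicut comp_def uses_prefixed)

text \<open>Only a cut needs the second alternative. Its formula is part of the rule instance, whose
  size therefore bounds the number of branches.\<close>

lemma uses_rule_deriv:
  "(uses True (rule_deriv s r) \<le> 1 \<and> uses False (rule_deriv s r) \<le> 1) \<or>
   (length (ldt_prems r) = 2 \<and> uses s (rule_deriv s r) = 1 \<and> uses (\<not> s) (rule_deriv s r) \<le> sz r)"
proof (cases r)
  case (LDTCommon r')
  show ?thesis
  proof (cases r')
    case (Cut A \<Gamma> \<Delta>)
    have "sz A \<le> sz r'" "sz r' \<le> sz r"
      by (simp_all add: sz_def Cut LDTCommon encode_ldt_rule_simps encode_common_simps enc_node_def)
    then show ?thesis
      using length_branches[of s A] by (simp add: LDTCommon Cut uses_cut_deriv)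
  qed (simp_all add: LDTCommon)
qed (simp_all add: uses_dec_deriv)

lemma uses_valid:
  assumes "valid H d"
  shows "length H \<le> 1 \<Longrightarrow> uses False d = 0" "length H = 0 \<Longrightarrow> uses True d = 0"
  using assms by (induction d) (auto split: if_splits)

lemma sz_fill: "sz (fill t u d) \<le> uses True d * sz t + uses False d * sz u + sz d"
proof (induction d)
  case (Hyp b S)
  then show ?case by simp
next
  case (Inf r S ds)
  have "sum_list (map (\<lambda>d. sz (fill t u d)) es) \<le> sum_list (map (uses True) es) * sz t +
      sum_list (map (uses False) es) * sz u + sum_list (map sz es)" if "set es \<subseteq> set ds" for es
    using that
  proof (induction es)
    case (Cons e es)
    then have "sz (fill t u e) \<le> uses True e * sz t + uses False e * sz u + sz e"
      using Inf.IH by simp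
    with Cons show ?case by (simp add: algebra_simps)
  qed simp
  from this[of ds] show ?case
    by (simp add: sz_Infer sz_Inf sum_sz[of ds] sum_sz[of "map (fill t u) ds"] comp_def)
qed

text \<open>Solves the recurrence in which the smaller of two subproofs is multiplied by at most
  \<open>K\<close> and \<open>K\<close> is added: the logarithm counts nested duplications, and the
  extra factor \<open>K\<close> absorbs what is added.\<close>

definition tree_bound :: "nat \<Rightarrow> nat \<Rightarrow> nat" where
  "tree_bound K m = m * K ^ Suc (floor_log m)"

lemma tree_bound_add:
  assumes "i + j < m" "B \<le> K" "1 \<le> K"
  shows "tree_bound K i + tree_bound K j + B \<le> tree_bound K m"
proof -
  let ?p = "K ^ Suc (floor_log m)"
  have "K ^ Suc (floor_log i) \<le> ?p" "K ^ Suc (floor_log j) \<le> ?p"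
    using assms by (intro power_increasing; simp add: floor_log_le_iff)+
  then have "tree_bound K i \<le> i * ?p" "tree_bound K j \<le> j * ?p"
    by (simp_all add: tree_bound_def del: power_Suc)
  moreover have "B \<le> ?p"
    using assms(2,3) power_increasing[of 1 "Suc (floor_log m)" K] by (simp del: power_Suc)
  \<comment> \<open>The strict inequality leaves one spare multiple of \<open>?p\<close>, which pays
    for \<open>B\<close>.\<close>
  moreover have "i * ?p + j * ?p + ?p \<le> m * ?p"
    unfolding distrib_right[symmetric] using assms(1)
    by (metis Suc_leI add.commute mult_Suc mult_le_mono1)
  ultimately show ?thesis
    unfolding tree_bound_def[of K m] by linarith
qed

text \<open>The smaller argument \<open>j\<close> is at most \<open>m / 2\<close>, so that its logarithm is smaller by one, which
  pays for the factor \<open>c\<close>.\<close>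

lemma tree_bound_mult:
  assumes "i + j < m" "j \<le> i" "B \<le> K" "c \<le> K" "1 \<le> K"
  shows "tree_bound K i + c * tree_bound K j + B \<le> tree_bound K m"
\<comment> \<open>Doubling raises \<open>floor_log\<close> by one for positive arguments only; at 0
  the bound itself vanishes.\<close>
proof (cases "j = 0")
  case True
  then show ?thesis using tree_bound_add[of i j m B K] assms by (simp add: tree_bound_def)
next
  case False
  let ?p = "K ^ Suc (floor_log m)"
  have "floor_log (2 * j) \<le> floor_log m"
    using assms by (intro floor_log_le_iff) simp
  then have "K * K ^ Suc (floor_log j) \<le> ?p"
    unfolding power_Suc[symmetric] using False assms(5) by (intro power_increasing) simp_all
  then have "c * K ^ Suc (floor_log j) \<le> ?p"
    using assms(4) by (meson le_trans mult_le_mono1)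
  then have "j * (c * K ^ Suc (floor_log j)) \<le> j * ?p"
    by (rule mult_le_mono2)
  then have "c * tree_bound K j \<le> j * ?p"
    by (simp only: tree_bound_def mult.left_commute)
  moreover have "K ^ Suc (floor_log i) \<le> ?p"
    using assms by (intro power_increasing; simp add: floor_log_le_iff)
  then have "tree_bound K i \<le> i * ?p"
    by (simp add: tree_bound_def del: power_Suc)
  moreover have "B \<le> ?p"
    using assms(3,5) power_increasing[of 1 "Suc (floor_log m)" K] by (simp del: power_Suc)
  moreover have "i * ?p + j * ?p + ?p \<le> m * ?p"
    unfolding distrib_right[symmetric] using assms(1)
    by (metis Suc_leI add.commute mult_Suc mult_le_mono1)
  ultimately show ?thesis
    unfolding tree_bound_def[of K m] by linarith
qed

lemma tree_bound_mono:
  assumes "i \<le> m" "1 \<le> K"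
  shows "tree_bound K i \<le> tree_bound K m"
  unfolding tree_bound_def using assms
  by (intro mult_le_mono power_increasing) (simp_all add: floor_log_le_iff)

text \<open>\<open>K\<close> is fixed by the size \<open>N\<close> of the whole proof, so that only
  the size of the subproof varies in the induction.\<close>

lemma sz_tree_trans:
  assumes "\<And>s r. sz r \<le> N \<Longrightarrow> sz (rule_deriv s r) \<le> K" "N \<le> K" "1 \<le> K"
    and "tree_proof ldt_prems ldt_concl \<tau>" "sz \<tau> \<le> N"
  shows "sz (tree_trans \<tau>) \<le> tree_bound K (sz \<tau>)"
  using assms(4,5)
proof (induction \<tau>)
  case (Infer r \<tau>s)
  define s where "s = (sz (hd (tl \<tau>s)) \<le> sz (hd \<tau>s))"
  let ?d = "rule_deriv s r"
  have len: "length \<tau>s = length (ldt_prems r)"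
    using Infer.prems(1) by (metis length_map tree_proof.simps)
  have IH: "sz (tree_trans \<tau>) \<le> tree_bound K (sz \<tau>)" if "\<tau> \<in> set \<tau>s" for \<tau>
    using Infer.IH[OF that] Infer.prems sz_mem_list[OF that] that by (simp add: sz_Infer)
  have d: "sz ?d \<le> K"
    using Infer.prems(2) by (intro assms(1)) (simp add: sz_Infer)
  have v: "valid (map cls_tms (ldt_prems r)) ?d"
    using rule_deriv by blast
  have fill: "sz (tree_trans (Infer r \<tau>s)) \<le> uses True ?d * sz (hd (map tree_trans \<tau>s)) +
      uses False ?d * sz (hd (tl (map tree_trans \<tau>s))) + sz ?d"
    using sz_fill by (simp add: s_def)
  have two: "length (ldt_prems r) \<le> 2"
  proof (cases r)
    case (LDTCommon r')
    then show ?thesis by (cases r') auto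
  qed auto
  consider "\<tau>s = []" | \<tau> where "\<tau>s = [\<tau>]" | \<tau> \<tau>' where "\<tau>s = [\<tau>, \<tau>']"
    using two unfolding len[symmetric] by (cases \<tau>s; cases "tl \<tau>s"; cases "tl (tl \<tau>s)") auto
  then show ?case
  proof cases
    case 1
    then have "uses True ?d = 0" "uses False ?d = 0"
      using uses_valid[OF v] len by simp_all
    with fill have "sz (tree_trans (Infer r \<tau>s)) \<le> K" using d by simp
    then show ?thesis
      using tree_bound_add[of 0 0 "sz (Infer r \<tau>s)" K K] assms(3) by (simp add: sz_Infer tree_bound_def)
  next
    case (2 \<tau>)
    then have "uses False ?d = 0" using uses_valid[OF v] len by simp
    have "uses True ?d \<le> 1"
      using uses_rule_deriv[of s r] len 2 by auto
    then have "uses True ?d * sz (tree_trans \<tau>) \<le> 1 * sz (tree_trans \<tau>)" by (rule mult_le_mono1)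
    moreover have "sz (tree_trans (Infer r \<tau>s)) \<le> uses True ?d * sz (tree_trans \<tau>) + K"
      using fill d \<open>uses False ?d = 0\<close> 2 by (simp del: tree_trans.simps)
    moreover have "sz (tree_trans \<tau>) \<le> tree_bound K (sz \<tau>)" using IH 2 by simp
    ultimately have "sz (tree_trans (Infer r \<tau>s)) \<le> tree_bound K (sz \<tau>) + K"
      unfolding mult_1 by linarith
    then show ?thesis
      using tree_bound_add[of "sz \<tau>" 0 "sz (Infer r \<tau>s)" K K] assms(3) 2 by (simp add: sz_Infer tree_bound_def)
  next
    case (3 \<tau> \<tau>')
    let ?m = "sz (Infer r \<tau>s)"
    have m: "sz \<tau> + sz \<tau>' < ?m" "sz \<tau>' + sz \<tau> < ?m" using 3 by (simp_all add: sz_Infer)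
    have f: "sz (tree_trans (Infer r \<tau>s)) \<le> uses True ?d * tree_bound K (sz \<tau>) +
        uses False ?d * tree_bound K (sz \<tau>') + K"
    proof -
      have "uses True ?d * sz (tree_trans \<tau>) \<le> uses True ?d * tree_bound K (sz \<tau>)"
        "uses False ?d * sz (tree_trans \<tau>') \<le> uses False ?d * tree_bound K (sz \<tau>')"
        using IH 3 by (intro mult_le_mono2; simp)+
      moreover have "sz (tree_trans (Infer r \<tau>s)) \<le> uses True ?d * sz (tree_trans \<tau>) +
          uses False ?d * sz (tree_trans \<tau>') + K"
        using fill d 3 by (simp del: tree_trans.simps)
      ultimately show ?thesis by linarith
    qed
    have sz_r: "sz r \<le> K" using Infer.prems(2) assms(2) by (simp add: sz_Infer)
    from uses_rule_deriv[of s r] show ?thesis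
    proof (elim disjE conjE)
      assume "uses True ?d \<le> 1" "uses False ?d \<le> 1"
      then have "uses True ?d * tree_bound K (sz \<tau>) \<le> 1 * tree_bound K (sz \<tau>)"
        "uses False ?d * tree_bound K (sz \<tau>') \<le> 1 * tree_bound K (sz \<tau>')"
        by (intro mult_le_mono1; simp)+
      with f tree_bound_add[OF m(1) order.refl assms(3)] show ?thesis
        unfolding mult_1 by linarith
    next
      assume u: "uses s ?d = 1" "uses (\<not> s) ?d \<le> sz r"
      show ?thesis
      \<comment> \<open>\<open>s\<close> names the larger subproof, so the multiplied one satisfies
        the order premise of \<open>tree_bound_mult\<close>.\<close>
      proof (cases s)
        case True
        then have "sz \<tau>' \<le> sz \<tau>" using 3 by (simp add: s_def)
        with f tree_bound_mult[OF m(1), of K K "uses False ?d"] u sz_r assms(3) True show ?thesis by simp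
      next
        case False
        then have "sz \<tau> \<le> sz \<tau>'" using 3 by (simp add: s_def)
        with f tree_bound_mult[OF m(2), of K K "uses True ?d"] u sz_r assms(3) False show ?thesis by simp
      qed
    qed
  qed
qed


section \<open>Quasipolynomial bounds\<close>

text \<open>For \<open>n \<ge> 2\<close> the logarithm is at least 1, so that all bounds hold without exceptions.\<close>

definition quasi_bd :: "(nat \<Rightarrow> nat) \<Rightarrow> bool" where
  "quasi_bd T \<longleftrightarrow> (\<exists>a. \<forall>n \<ge> 2. real (T n) \<le> 2 powr (real a * (log 2 n)\<^sup>2))"

lemma log_ge_1: "2 \<le> n \<Longrightarrow> 1 \<le> log 2 (real n)"
  by (simp add: le_log_iff)

lemma quasi_bd_add:
  assumes "quasi_bd f" "quasi_bd g"
  shows "quasi_bd (\<lambda>n. f n + g n)"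
proof -
  obtain a a' where a: "\<And>n. n \<ge> 2 \<Longrightarrow> real (f n) \<le> 2 powr (real a * (log 2 n)\<^sup>2)"
    "\<And>n. n \<ge> 2 \<Longrightarrow> real (g n) \<le> 2 powr (real a' * (log 2 n)\<^sup>2)"
    using assms by (auto simp: quasi_bd_def)
  have "real (f n + g n) \<le> 2 powr (real (a + a' + 1) * (log 2 n)\<^sup>2)" if n: "n \<ge> 2" for n
  proof -
    let ?l = "(log 2 n)\<^sup>2"
    have l: "1 \<le> ?l" using log_ge_1[OF n] by (simp add: one_le_power)
    have "1 \<le> 2 powr (real a * ?l)" "1 \<le> 2 powr (real a' * ?l)"
      by (intro ge_one_powr_ge_zero; simp)+
    \<comment> \<open>For x, y \<ge> 1, x + y \<le> 2xy.\<close>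
    then have "2 powr (real a * ?l) + 2 powr (real a' * ?l) \<le> 2 * (2 powr (real a * ?l) * 2 powr (real a' * ?l))"
      by (smt (verit) mult_left_mono mult_right_mono mult_cancel_left1 mult_cancel_right1)
    also have "\<dots> = 2 powr (1 + real a * ?l + real a' * ?l)"
      by (simp add: powr_add)
    also have "\<dots> \<le> 2 powr (real (a + a' + 1) * ?l)"
      using l by (intro powr_mono) (simp_all add: algebra_simps)
    finally show ?thesis using a(1)[OF n] a(2)[OF n] by simp
  qed
  then show ?thesis unfolding quasi_bd_def by blast
qed

lemma quasi_bd_mult:
  assumes "quasi_bd f" "quasi_bd g"
  shows "quasi_bd (\<lambda>n. f n * g n)"
proof -
  obtain a a' where a: "\<And>n. n \<ge> 2 \<Longrightarrow> real (f n) \<le> 2 powr (real a * (log 2 n)\<^sup>2)"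
    "\<And>n. n \<ge> 2 \<Longrightarrow> real (g n) \<le> 2 powr (real a' * (log 2 n)\<^sup>2)"
    using assms by (auto simp: quasi_bd_def)
  have "real (f n * g n) \<le> 2 powr (real (a + a') * (log 2 n)\<^sup>2)" if n: "n \<ge> 2" for n
    using mult_mono[OF a(1)[OF n] a(2)[OF n]] by (simp add: powr_add distrib_right)
  then show ?thesis unfolding quasi_bd_def by blast
qed

lemma quasi_bd_const: "quasi_bd (\<lambda>n. c)"
  unfolding quasi_bd_def
proof (intro exI allI impI)
  fix n :: nat assume n: "n \<ge> 2"
  have "real c \<le> 2 powr real c" by (simp add: powr_realpow less_imp_le)
  also have "\<dots> \<le> 2 powr (real c * (log 2 n)\<^sup>2)"
    using log_ge_1[OF n] by (intro powr_mono) (simp_all add: mult_le_cancel_left1 one_le_power)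
  finally show "real c \<le> 2 powr (real c * (log 2 n)\<^sup>2)" .
qed

lemma quasi_bd_id: "quasi_bd (\<lambda>n. n)"
  unfolding quasi_bd_def
proof (intro exI allI impI)
  fix n :: nat assume n: "n \<ge> 2"
  have "real n = 2 powr (log 2 n)" using n by simp
  also have "\<dots> \<le> 2 powr (real 1 * (log 2 n)\<^sup>2)"
    using log_ge_1[OF n] self_le_power[of "log 2 n" 2] by (intro powr_mono) simp_all
  finally show "real n \<le> 2 powr (real 1 * (log 2 n)\<^sup>2)" .
qed

lemma quasi_bd_power: "quasi_bd f \<Longrightarrow> quasi_bd (\<lambda>n. f n ^ k)"
  by (induction k) (simp_all add: quasi_bd_const quasi_bd_mult)

lemma quasi_bd_le: "quasi_bd g \<Longrightarrow> (\<And>n. f n \<le> g n) \<Longrightarrow> quasi_bd f"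
  unfolding quasi_bd_def by (meson of_nat_le_iff order_trans)

lemma quasi_bd_poly:
  assumes "poly_bd b" "quasi_bd f"
  shows "quasi_bd (\<lambda>n. b (f n))"
proof -
  obtain c k where "\<And>n. b n \<le> c * Suc n ^ k"
    using assms(1) by (auto simp: poly_bd_def)
  then have "b (f n) \<le> c * (f n + 1) ^ k" for n by simp
  moreover have "quasi_bd (\<lambda>n. c * (f n + 1) ^ k)"
    by (intro quasi_bd_mult quasi_bd_power quasi_bd_add quasi_bd_const assms)
  ultimately show ?thesis by (rule quasi_bd_le[rotated])
qed

text \<open>With l = log n, a polynomial is 2 to the power O(l); raising it to a power O(l) makes
  the exponent O(l * l).\<close>

lemma quasi_bd_tree_bound:
  assumes "poly_bd K"
  shows "quasi_bd (\<lambda>n. tree_bound (K n) n)"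
proof -
  obtain c k where K: "\<And>n. K n \<le> c * Suc n ^ k"
    using assms by (auto simp: poly_bd_def)
  have "quasi_bd (\<lambda>n. K n ^ Suc (floor_log n))"
    unfolding quasi_bd_def
  proof (intro exI allI impI)
    fix n :: nat assume n: "n \<ge> 2"
    let ?l = "log 2 n"
    have l: "1 \<le> ?l" by (rule log_ge_1[OF n])
    have "real (K n) \<le> real c * real (Suc n) ^ k"
      using K[of n] by (metis of_nat_le_iff of_nat_mult of_nat_power)
    also have "\<dots> \<le> real c * (2 * real n) ^ k"
      using n by (intro mult_left_mono power_mono) simp_all
    also have "\<dots> \<le> 2 powr real c * (2 powr (2 * ?l)) ^ k"
    proof (intro mult_mono power_mono)
      show "real c \<le> 2 powr real c" by (simp add: powr_realpow less_imp_le)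
      have "2 * real n = 2 powr (1 + ?l)" using n by (simp add: powr_add)
      also have "\<dots> \<le> 2 powr (2 * ?l)" using l by (intro powr_mono) simp_all
      finally show "2 * real n \<le> 2 powr (2 * ?l)" .
    qed simp_all
    also have "\<dots> = 2 powr (real c + 2 * ?l * real k)"
      by (simp add: powr_add powr_power mult.commute)
    also have "\<dots> \<le> 2 powr (real (c + 2 * k) * ?l)"
      using l by (intro powr_mono) (simp_all add: algebra_simps mult_le_cancel_left1)
    finally have *: "real (K n) \<le> 2 powr (real (c + 2 * k) * ?l)" .
    have "real (floor_log n) \<le> ?l"
      using n by (simp add: floor_log_altdef)
    then have fl: "real (Suc (floor_log n)) \<le> 2 * ?l" using l by simp
    have "real (K n ^ Suc (floor_log n)) \<le> (2 powr (real (c + 2 * k) * ?l)) ^ Suc (floor_log n)"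
      unfolding of_nat_power by (intro power_mono *) simp
    also have "\<dots> = 2 powr (real (c + 2 * k) * ?l * real (Suc (floor_log n)))"
      by (simp only: powr_power mult.commute)
    also have "\<dots> \<le> 2 powr (real (c + 2 * k) * ?l * (2 * ?l))"
      using fl l by (intro powr_mono mult_left_mono) simp_all
    also have "\<dots> = 2 powr (real (2 * (c + 2 * k)) * ?l\<^sup>2)"
      by (simp add: power2_eq_square algebra_simps)
    finally show "real (K n ^ Suc (floor_log n)) \<le> 2 powr (real (2 * (c + 2 * k)) * ?l\<^sup>2)" .
  qed
  then show ?thesis
    unfolding tree_bound_def by (intro quasi_bd_mult quasi_bd_id)
qed

text \<open>One more factor log n absorbs the constant \<open>a\<close> as soon as log n \<ge> a,
  hence the exponent 3.\<close>

lemma quasi_bd_imp_quasipolynomially_bounded: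
  assumes "quasi_bd T"
  shows "quasipolynomially_bounded T"
proof -
  obtain a where a: "\<And>n. n \<ge> 2 \<Longrightarrow> real (T n) \<le> 2 powr (real a * (log 2 n)\<^sup>2)"
    using assms by (auto simp: quasi_bd_def)
  have "real (T n) \<le> 2 powr ((log 2 (real n)) ^ 3)" if n: "n \<ge> 2 ^ (a + 1)" for n
  proof -
    have "log 2 (real (2 ^ (a + 1))) = real (a + 1)"
      unfolding of_nat_power of_nat_numeral by (rule log_pow_cancel) simp_all
    then have "real a \<le> log 2 (real (2 ^ (a + 1)))" by simp
    also have "\<dots> \<le> log 2 (real n)"
      using n by (intro log_mono) (simp_all del: power_Suc)
    finally have "real a * (log 2 n)\<^sup>2 \<le> log 2 n * (log 2 n)\<^sup>2"
      by (rule mult_right_mono) simp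
    also have "\<dots> = (log 2 n) ^ 3" by (simp add: power2_eq_square power3_eq_cube)
    finally have "2 powr (real a * (log 2 n)\<^sup>2) \<le> 2 powr ((log 2 (real n)) ^ 3)"
      by (intro powr_mono) simp_all
    moreover have "n \<ge> 2"
      using n self_le_power[of "2::nat" "a + 1"] by linarith
    ultimately show ?thesis using a[of n] by linarith
  qed
  then show ?thesis
    unfolding quasipolynomially_bounded_def by (intro exI eventually_sequentiallyI)
qed

text \<open>Results are not of polynomial size, so \<open>recursion_time\<close> is used directly,
  with \<open>tree_bound\<close> as the bound on values. That bound holds for correct proofs only,
  which is why the recursion is restricted to a set closed under subproofs.\<close>

lemma tree_simulation:
  "\<exists>P T. quasipolynomially_bounded T \<and>
      (\<forall>\<tau> S. LDT_tree_proof \<tau> S \<longrightarrow>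
        (\<exists>\<tau>' t. run P (enc_tree enc_ldt_rule \<tau>) (enc_tree enc_lk_rule \<tau>') t \<and>
           t \<le> T (dsize (enc_tree enc_ldt_rule \<tau>)) \<and>
           LK1_tree_proof \<tau>' (cls_tms S)))"
proof -
  let ?step = "\<lambda>z::ldt_rule ptree \<times> lk_rule ptree list. fill (hd (snd z)) (hd (tl (snd z)))
    (rule_deriv (sz (hd (tl (subproofs (fst z)))) \<le> sz (hd (subproofs (fst z)))) (last_rule (fst z)))"
  have "ptime (\<lambda>\<tau>::ldt_rule ptree. subproofs \<tau>)" "ptime ?step" by (intro ptime_intros)+
  moreover have "tree_trans \<tau> = ?step (\<tau>, map tree_trans (subproofs \<tau>))" for \<tau>
    by (cases \<tau>) simp
  ultimately obtain P b where P: "P \<noteq> []" "poly_bd b"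
    "\<forall>m N D X. recursion_bounds subproofs tree_trans m N D X \<longrightarrow>
      (\<forall>\<tau> \<in> X. \<exists>t. eval P [encode \<tau>] (P ! 0) (encode (tree_trans \<tau>)) t \<and> t \<le> m \<tau> * b (N + D))"
    by (rule recursion_time)
  have "ptime (\<lambda>p::bool \<times> ldt_rule. rule_deriv (fst p) (snd p))" by (intro ptime_intros)
  then obtain B where B: "poly_bd B" "\<And>p. sz (rule_deriv (fst p) (snd p)) \<le> B (sz p)"
    by (rule ptime_size) blast
  \<comment> \<open>\<open>N + 4\<close> bounds the size of a pair of a truth value and a rule; the
    last two summands provide \<open>N \<le> K N\<close> and \<open>1 \<le> K N\<close>.\<close>
  define K where "K N = B (N + 4) + N + 1" for N
  have K: "poly_bd K"
    unfolding K_def by (intro poly_bd_intros poly_bd_comp[OF B(1)])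
  let ?D = "\<lambda>N. tree_bound (K N) N"
  define T where "T N = 2 + N + (N * b (N + ?D N) + N * b (N + ?D N))" for N
  have "quasi_bd (\<lambda>N. b (N + ?D N))"
    by (intro quasi_bd_poly[OF P(2)] quasi_bd_add quasi_bd_id quasi_bd_tree_bound K)
  then have "quasi_bd T"
    unfolding T_def by (intro quasi_bd_add quasi_bd_mult quasi_bd_id quasi_bd_const)
  moreover have "\<exists>\<tau>' t. run P (enc_tree enc_ldt_rule \<tau>) (enc_tree enc_lk_rule \<tau>') t \<and>
      t \<le> T (dsize (enc_tree enc_ldt_rule \<tau>)) \<and> LK1_tree_proof \<tau>' (cls_tms S)" if "LDT_tree_proof \<tau> S" for \<tau> S
  proof -
    have \<tau>: "tree_proof ldt_prems ldt_concl \<tau>" "S = ldt_concl (last_rule \<tau>)"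
      using that by (auto simp: LDT_tree_proof_def tree_concl_def)
    define N where "N = sz \<tau>"
    have KN: "sz (rule_deriv s r) \<le> K N" if "sz r \<le> N" for s r
    proof -
      have "sz (rule_deriv s r) \<le> B (sz (s, r))" using B(2)[of "(s, r)"] by simp
      also have "\<dots> \<le> B (N + 4)"
        using that sz_bool[of s] by (intro poly_bd_mono[OF B(1)]) simp
      finally show ?thesis by (simp add: K_def)
    qed
    have "recursion_bounds subproofs tree_trans sz N (?D N) {\<sigma>. tree_proof ldt_prems ldt_concl \<sigma> \<and> sz \<sigma> \<le> N}"
      unfolding recursion_bounds_def
    proof
      fix \<sigma> assume "\<sigma> \<in> {\<sigma>. tree_proof ldt_prems ldt_concl \<sigma> \<and> sz \<sigma> \<le> N}"
      then have \<sigma>: "tree_proof ldt_prems ldt_concl \<sigma>" "sz \<sigma> \<le> N" by simp_all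
      obtain r \<tau>s where s: "\<sigma> = Infer r \<tau>s" by (cases \<sigma>)
      have "sz (tree_trans \<sigma>) \<le> tree_bound (K N) (sz \<sigma>)"
        by (rule sz_tree_trans[OF KN]) (use \<sigma> in \<open>simp_all add: K_def\<close>)
      also have "\<dots> \<le> ?D N"
        using \<sigma>(2) by (intro tree_bound_mono) (simp_all add: K_def)
      finally have "sz (tree_trans \<sigma>) \<le> ?D N" .
      moreover have "set (subproofs \<sigma>) \<subseteq> {\<sigma>. tree_proof ldt_prems ldt_concl \<sigma> \<and> sz \<sigma> \<le> N}"
      proof
        fix \<rho> assume "\<rho> \<in> set (subproofs \<sigma>)"
        then show "\<rho> \<in> {\<sigma>. tree_proof ldt_prems ldt_concl \<sigma> \<and> sz \<sigma> \<le> N}"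
          using \<sigma> sz_mem_list[of \<rho> \<tau>s] by (simp add: s sz_Infer)
      qed
      moreover have "sum_list (map sz (subproofs \<sigma>)) < sz \<sigma>"
        using sum_sz[of \<tau>s] by (simp add: s sz_Infer)
      ultimately show "set (subproofs \<sigma>) \<subseteq> {\<sigma>. tree_proof ldt_prems ldt_concl \<sigma> \<and> sz \<sigma> \<le> N} \<and>
          sum_list (map sz (subproofs \<sigma>)) < sz \<sigma> \<and> sz \<sigma> \<le> N \<and> sz (tree_trans \<sigma>) \<le> ?D N"
        using \<sigma> by simp
    qed
    then obtain t where "eval P [encode \<tau>] (P ! 0) (encode (tree_trans \<tau>)) t" "t \<le> N * b (N + ?D N)"
      using P(3) \<tau>(1) unfolding N_def by blast
    from run_of_eval[OF P(1) this] obtain t' where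
      "run P (encode \<tau>) (encode (tree_trans \<tau>)) t'" "t' \<le> T (sz \<tau>)"
      by (auto simp: T_def N_def)
    then show ?thesis
      using LK1_tree_proof_tree_trans[OF \<tau>(1)] unfolding \<tau>(2) sz_def encode_tree by blast
  qed
  ultimately show ?thesis
    using quasi_bd_imp_quasipolynomially_bounded by blast
qed

theorem theorem3p10:
  "(\<exists>P T. polynomially_bounded T \<and>
      (\<forall>\<pi> S. LDT_proof \<pi> S \<longrightarrow>
        (\<exists>\<pi>' t. run P (enc_dag enc_ldt_rule \<pi>) (enc_dag enc_lk_rule \<pi>') t \<and>
           t \<le> T (dsize (enc_dag enc_ldt_rule \<pi>)) \<and>
           LK1_proof \<pi>' (cls_tms S)))) \<and>
   (\<exists>P T. quasipolynomially_bounded T \<and>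
      (\<forall>\<tau> S. LDT_tree_proof \<tau> S \<longrightarrow>
        (\<exists>\<tau>' t. run P (enc_tree enc_ldt_rule \<tau>) (enc_tree enc_lk_rule \<tau>') t \<and>
           t \<le> T (dsize (enc_tree enc_ldt_rule \<tau>)) \<and>
           LK1_tree_proof \<tau>' (cls_tms S))))"
  using dag_simulation tree_simulation by (rule conjI)

end
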